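(* For each $n\ge 1$ let $\pi_n$ be a uniformly random perfect matching of the half-hexagon graph $R_n^\vee$. The limit shape of $\pi_n$, rescaled by $1/n$, is a parabola, in the following sense. There is a parabola $\mathcal P\subset\mathbb R^2$ such that, writing $I$ for the open convex region bounded by $\mathcal P$ and $T$ for the closed trapezoid with corners $(\pm 1,0)$, $(\pm\frac12,\frac{\sqrt3}{2})$ (the limit of $\frac1n R_n$), the following hold. (Frozen outside.) For every connected component $C$ of $\operatorname{int}(T)\setminus\overline{I}$ there is one of the three edge directions $\theta$ such that for every open disc $D$ with $\overline D\subset C$, the proportion $\rho_{n,\theta}(D)$ converges to $1$ in probability as $n\to\infty$. (Not frozen inside.) For every open disc $D$ with $\overline D\subset \operatorname{int}(T)\cap I$ and for each of the three edge directions $\theta$, the proportion $\rho_{n,\theta}(D)$ does not converge to $1$ in probability as $n\to\infty$.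
   Context: Let $v=(1,0)$, $w=\frac12(1,\sqrt3)$, and let $\mathcal L$ be the triangular lattice: the planar graph with vertex set $\mathbb Zv+\mathbb Zw$ and edges joining vertices at unit distance; it subdivides the plane into unit equilateral triangles. Let $R_n\subset\mathbb R^2$ be the union of the large trapezoid with corners $nv,\ nw,\ n(w-v),\ -nv$ and the $n$ small trapezoids with corners $(2i-n+1)v+v$, $(2i-n+1)v-v$, $(2i-n+1)v-w$, $(2i-n+1)v+v-w$, for $i=0,\dots,n-1$. Let $\mathcal L^\vee$ be the planar dual of $\mathcal L$ (the hexagonal lattice), drawn with its vertices at the centres of the triangles of $\mathcal L$ and straight edges. The half-hexagon graph $R_n^\vee$ is the subgraph of $\mathcal L^\vee$ induced by the vertices lying in $R_n$. The edges of $\mathcal L^\vee$ have three possible directions (one of them vertical); perfect matchings of $R_n^\vee$ correspond to lozenge tilings of $R_n$, an edge corresponding to the lozenge formed by the two triangles dual to its endpoints. For an open disc $D$ and an edge direction $\theta$, $\rho_{n,\theta}(D)$ denotes the number of edges of $\pi_n$ with direction $\theta$ whose midpoint lies in $nD$, divided by the number of all edges of $\pi_n$ whose midpoint lies in $nD$. *)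

theory Defs
  imports "HOL-Probability.Probability"
begin

type_synonym plane = "real \<times> real"

definition vec_v :: plane where "vec_v = (1, 0)"
definition vec_w :: plane where "vec_w = (1/2, sqrt 3 / 2)"

definition lattice_vertices :: "plane set" where
  "lattice_vertices = {of_int a *\<^sub>R vec_v + of_int b *\<^sub>R vec_w | a b. True}"

definition lattice_adj :: "plane \<Rightarrow> plane \<Rightarrow> bool" where
  "lattice_adj x y \<longleftrightarrow> x \<in> lattice_vertices \<and> y \<in> lattice_vertices \<and> dist x y = 1"

(* All faces of the triangular lattice are unit triangles; a face is represented by its set of
   three corners. *)
definition lattice_faces :: "plane set set" where
  "lattice_faces = {{a, b, c} | a b c. lattice_adj a b \<and> lattice_adj b c \<and> lattice_adj a c}"

definition face_centre :: "plane set \<Rightarrow> plane" where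
  "face_centre t = (1/3) *\<^sub>R (\<Sum>x\<in>t. x)"

(* The planar dual, drawn with straight edges: an edge is the set of its two end points.
   Two distinct faces are adjacent iff they share an edge of the lattice. *)
definition dual_vertices :: "plane set" where
  "dual_vertices = face_centre ` lattice_faces"

definition dual_edges :: "plane set set" where
  "dual_edges = {{face_centre s, face_centre t} | s t.
     s \<in> lattice_faces \<and> t \<in> lattice_faces \<and> s \<noteq> t \<and>
     (\<exists>a b. lattice_adj a b \<and> {a, b} \<subseteq> s \<inter> t)}"

definition large_trapezoid :: "nat \<Rightarrow> plane set" where
  "large_trapezoid n = convex hull
     {real n *\<^sub>R vec_v, real n *\<^sub>R vec_w, real n *\<^sub>R (vec_w - vec_v), - (real n *\<^sub>R vec_v)}"

definition small_trapezoid :: "nat \<Rightarrow> nat \<Rightarrow> plane set" where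
  "small_trapezoid n i =
     (let c = (2 * real i - real n + 1) *\<^sub>R vec_v
      in convex hull {c + vec_v, c - vec_v, c - vec_w, c + vec_v - vec_w})"

definition half_hexagon_region :: "nat \<Rightarrow> plane set" where
  "half_hexagon_region n = large_trapezoid n \<union> (\<Union>i<n. small_trapezoid n i)"

definition half_hexagon_vertices :: "nat \<Rightarrow> plane set" where
  "half_hexagon_vertices n = dual_vertices \<inter> half_hexagon_region n"

definition half_hexagon_edges :: "nat \<Rightarrow> plane set set" where
  "half_hexagon_edges n = {e \<in> dual_edges. e \<subseteq> half_hexagon_vertices n}"

definition perfect_matchings :: "'a set \<Rightarrow> 'a set set \<Rightarrow> 'a set set set" where
  "perfect_matchings V E = {M. M \<subseteq> E \<and> (\<forall>x\<in>V. \<exists>!e. e \<in> M \<and> x \<in> e)}"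

(* The law of a uniformly random perfect matching of the half-hexagon graph. *)
definition random_matching :: "nat \<Rightarrow> plane set set pmf" where
  "random_matching n =
     pmf_of_set (perfect_matchings (half_hexagon_vertices n) (half_hexagon_edges n))"

(* The (unoriented) direction of an edge is the line through the origin parallel to it. *)
definition edge_direction :: "plane set \<Rightarrow> plane set" where
  "edge_direction e = span {x - y | x y. x \<in> e \<and> y \<in> e}"

definition edge_directions :: "plane set set" where
  "edge_directions = edge_direction ` dual_edges"

definition edge_midpoint :: "plane set \<Rightarrow> plane" where
  "edge_midpoint e = (1/2) *\<^sub>R (\<Sum>x\<in>e. x)"

definition edges_in :: "plane set set \<Rightarrow> plane set \<Rightarrow> plane set set" where
  "edges_in M A = {e \<in> M. edge_midpoint e \<in> A}"

(* Takes the value 0 (division by zero) if no edge of M has its midpoint in nD. *)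
definition proportion :: "nat \<Rightarrow> plane set \<Rightarrow> plane set \<Rightarrow> plane set set \<Rightarrow> real" where
  "proportion n \<theta> D M =
     (let N = edges_in M ((\<lambda>x. real n *\<^sub>R x) ` D)
      in real (card {e \<in> N. edge_direction e = \<theta>}) / real (card N))"

(* Convergence in probability of X n, evaluated at a sample from p n, to the constant c. *)
definition converges_in_probability ::
  "(nat \<Rightarrow> 'a pmf) \<Rightarrow> (nat \<Rightarrow> 'a \<Rightarrow> real) \<Rightarrow> real \<Rightarrow> bool" where
  "converges_in_probability p X c \<longleftrightarrow>
     (\<forall>\<epsilon>>0. (\<lambda>n. measure_pmf.prob (p n) {\<omega>. \<bar>X n \<omega> - c\<bar> > \<epsilon>}) \<longlonglongrightarrow> 0)"

(* Focus F and directrix d. *)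
definition parabola :: "plane set \<Rightarrow> bool" where
  "parabola P \<longleftrightarrow>
     (\<exists>F d. affine d \<and> aff_dim d = 1 \<and> F \<notin> d \<and> P = {x. dist x F = infdist x d})"

definition limit_trapezoid :: "plane set" where
  "limit_trapezoid =
     convex hull {(1, 0), (-1, 0), (1/2, sqrt 3 / 2), (-1/2, sqrt 3 / 2)}"

end

theory Submission
  imports
    Defs
    "Jordan_Normal_Form.Determinant"
    "HOL-Computational_Algebra.Computational_Algebra"
    "HOL-Real_Asymp.Real_Asymp"
begin

text \<open>
  Call the vertical edges of a matching particles. Row \<open>k\<close> (counted from the top) carries \<open>k\<close> of
  them, consecutive rows interlace, and the bottom row has one particle in each pair of columns
  \<open>{2 j, 2 j + 1}\<close>; a matching is the same thing as such a pattern. Summing over interlacing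
  rows maps \<open>det (g\<^sub>i (x\<^sub>j))\<close> to a determinant of the same form, with the \<open>g\<^sub>i\<close> replaced by their
  prefix sums and a row of ones added. Choosing in row \<open>k\<close> the polynomials biorthogonal to the
  functionals given by \<open>(1 + u)\<^bsup>m + i\<^esup> (1 - u)\<^bsup>i\<^esup>\<close>, \<open>m = n - k + 1\<close>, makes the final determinant
  triangular, which gives in closed form the expectation of
  \<open>\<Sum>x (1 - a)\<^bsup>x\<^esup> (1 + a)\<^bsup>n + k - 1 - x\<^esup>\<close>, summed over the particles \<open>x\<close> of row \<open>k\<close>. First moments suffice.

  Markov's inequality with a small \<open>a\<close> shows that up to exponentially small probability no particle
  lies outside the interval of half-width \<open>\<surd>(k n)\<close> around the middle of row \<open>k\<close>. This interval sweeps
  out the interior of the parabola, and a row without particles on one side is frozen there.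

  The coefficients of powers of \<open>a\<close> give the limits of all moments of the particle density at
  height \<open>k \<approx> \<kappa> n\<close>; by the Weierstrass theorem the expected densities converge weakly to an explicit
  density, which is positive inside the parabola and below \<open>1/2\<close>. Hence neither the vertical edges
  nor the other edges can dominate in a disc inside the parabola.
\<close>

section \<open>Determinants\<close>

text \<open>The functionals come from one identity: multiplication by \<open>1 - u\<close> acts on a
  sequence as minus the forward difference, so it undoes a prefix sum up to sign. The sums over the
  bottom pairs are, after a triangular column operation, pairings with
  \<open>(1 + u) (1 - u^2)^j\<close>; each of the \<open>n - k\<close> prefix sums below row
  \<open>k\<close> removes one factor \<open>1 - u\<close>, which leaves
  \<open>(1 + u)^(m + i) (1 - u)^i\<close>.

  The weight \<open>(1 - a)^x (1 + a)^(N - x)\<close> plays two roles. For small \<open>a\<close> it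
  is close to \<open>exp (a (N - 2 x))\<close>, an exponential moment; as a polynomial in
  \<open>a\<close> it has Krawtchouk polynomials in \<open>x\<close> as coefficients, with leading
  part \<open>(N - 2 x)^p / p!\<close>, so the same closed form yields all power moments.

  First moments give no concentration inside the parabola, so the contradiction there is reached in
  the mean: if one direction filled a disc, the expected number of other edges in it would be
  \<open>o(n^2)\<close>, and averaging over rows yields for every large \<open>n\<close> one row, at
  an unknown height, where it is small. Hence the limit of the density is taken along arbitrary rows
  with convergent \<open>k / n\<close>.\<close>

definition dtm :: "nat \<Rightarrow> (nat \<Rightarrow> nat \<Rightarrow> real) \<Rightarrow> real" where
  "dtm l A = det (mat l l (\<lambda>(i, j). A i j))"

lemma dtm_Leibniz:
  "dtm l A = (\<Sum>p | p permutes {..<l}. signof p * (\<Prod>i<l. A i (p i)))"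
proof -
  have "dtm l A = (\<Sum>p | p permutes {0..<l}. signof p * (\<Prod>i = 0..<l. mat l l (\<lambda>(i, j). A i j) $$ (i, p i)))"
    unfolding dtm_def by (rule det_def') simp
  also have "\<dots> = (\<Sum>p | p permutes {0..<l}. signof p * (\<Prod>i = 0..<l. A i (p i)))"
    by (intro sum.cong refl arg_cong2[where f="(*)"] prod.cong) (auto dest: permutes_in_image)
  finally show ?thesis by (simp add: atLeast0LessThan)
qed

lemma dtm_cong:
  assumes "\<And>i j. i < l \<Longrightarrow> j < l \<Longrightarrow> A i j = B i j"
  shows "dtm l A = dtm l B"
  unfolding dtm_def using assms by (intro arg_cong[where f=det] cong_mat) auto

lemma dtm_mult:
  "dtm l A * dtm l B = dtm l (\<lambda>i j. \<Sum>r<l. A i r * B r j)"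
proof -
  have "dtm l A * dtm l B = det (mat l l (\<lambda>(i, j). A i j) * mat l l (\<lambda>(i, j). B i j))"
    unfolding dtm_def by (rule det_mult[symmetric]) auto
  also have "mat l l (\<lambda>(i, j). A i j) * mat l l (\<lambda>(i, j). B i j) = mat l l (\<lambda>(i, j). \<Sum>r<l. A i r * B r j)"
    by (rule eq_matI) (auto simp: scalar_prod_def atLeast0LessThan)
  finally show ?thesis unfolding dtm_def .
qed

lemma dtm_upper_triangular:
  assumes "\<And>i j. j < i \<Longrightarrow> i < l \<Longrightarrow> A i j = 0"
  shows "dtm l A = (\<Prod>i<l. A i i)"
proof -
  have "dtm l A = prod_list (diag_mat (mat l l (\<lambda>(i, j). A i j)))"
    unfolding dtm_def by (rule det_upper_triangular) (use assms in \<open>auto simp: upper_triangular_def\<close>)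
  also have "\<dots> = (\<Prod>i<l. A i i)"
    by (simp add: prod_list_diag_prod atLeast0LessThan)
  finally show ?thesis .
qed

lemma dtm_transpose: "dtm l (\<lambda>i j. A j i) = dtm l A"
proof -
  have "mat l l (\<lambda>(i, j). A j i) = transpose_mat (mat l l (\<lambda>(i, j). A i j))" by auto
  then show ?thesis unfolding dtm_def by (metis det_transpose mat_carrier)
qed

lemma dtm_lower_triangular:
  assumes "\<And>i j. i < j \<Longrightarrow> j < l \<Longrightarrow> A i j = 0"
  shows "dtm l A = (\<Prod>i<l. A i i)"
  using dtm_upper_triangular[of l "\<lambda>i j. A j i"] assms dtm_transpose[of l A] by simp

text \<open>Expanding along column \<open>c\<close>, both determinants are their diagonal entry in
  that column times the same cofactor; cross-multiplication avoids division. This measures the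
  effect of changing row \<open>c\<close> only.\<close>

lemma dtm_single_entry_column:
  assumes "c < l" "\<And>i. i < l \<Longrightarrow> i \<noteq> c \<Longrightarrow> A i c = 0"
    and "\<And>i. i < l \<Longrightarrow> i \<noteq> c \<Longrightarrow> B i c = 0"
    and "\<And>i j. i < l \<Longrightarrow> j < l \<Longrightarrow> i \<noteq> c \<Longrightarrow> A i j = B i j"
  shows "dtm l A * B c c = dtm l B * A c c"
proof -
  have *: "dtm l A = A c c * cofactor (mat l l (\<lambda>(i, j). A i j)) c c"
    if "\<And>i. i < l \<Longrightarrow> i \<noteq> c \<Longrightarrow> A i c = 0" for A
  proof -
    let ?A = "mat l l (\<lambda>(i, j). A i j)"
    have "dtm l A = (\<Sum>i<l. ?A $$ (i, c) * cofactor ?A i c)"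
      unfolding dtm_def by (rule laplace_expansion_column) (use assms in auto)
    also have "\<dots> = (\<Sum>i<l. if i = c then A c c * cofactor ?A c c else 0)"
      using that assms(1) by (intro sum.cong) auto
    finally show ?thesis using assms(1) by simp
  qed
  have "mat_delete (mat l l (\<lambda>(i, j). A i j)) c c = mat_delete (mat l l (\<lambda>(i, j). B i j)) c c"
    by (rule eq_matI) (use assms in \<open>auto simp: mat_delete_def\<close>)
  then have "cofactor (mat l l (\<lambda>(i, j). A i j)) c c = cofactor (mat l l (\<lambda>(i, j). B i j)) c c"
    by (simp add: cofactor_def)
  with *[of A] *[of B] assms(2,3) show ?thesis by simp
qed

lemma dtm_first_row_unit:
  assumes "A 0 0 = 1" "\<And>j. 0 < j \<Longrightarrow> j \<le> l \<Longrightarrow> A 0 j = 0"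
  shows "dtm (Suc l) A = dtm l (\<lambda>i j. A (Suc i) (Suc j))"
proof -
  let ?A = "mat (Suc l) (Suc l) (\<lambda>(i, j). A i j)"
  have "dtm (Suc l) A = (\<Sum>j<Suc l. ?A $$ (0, j) * cofactor ?A 0 j)"
    unfolding dtm_def by (rule laplace_expansion_row) auto
  also have "\<dots> = (\<Sum>j<Suc l. if j = 0 then cofactor ?A 0 0 else 0)"
    using assms by (intro sum.cong) auto
  also have "\<dots> = cofactor ?A 0 0" by simp
  also have "mat_delete ?A 0 0 = mat l l (\<lambda>(i, j). A (Suc i) (Suc j))"
    by (rule eq_matI) (auto simp: mat_delete_def)
  then have "cofactor ?A 0 0 = dtm l (\<lambda>i j. A (Suc i) (Suc j))"
    by (simp add: cofactor_def dtm_def)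
  finally show ?thesis .
qed

text \<open>Multilinearity in the columns: reindexing each Leibniz product by the inverse
  permutation groups it by columns, so that the sum over independent choices \<open>y j\<close>
  factors.\<close>

lemma dtm_column_sums:
  assumes "\<And>j. j < l \<Longrightarrow> finite (R j)"
  shows "(\<Sum>y\<in>PiE {..<l} R. dtm l (\<lambda>i j. g i (y j))) = dtm l (\<lambda>i j. \<Sum>x\<in>R j. g i x)"
proof -
  have eq: "(\<Prod>i<l. g i (y (p i))) = (\<Prod>j<l. g (inv_into UNIV p j) (y j))"
    if "p permutes {..<l}" for p and y
    using prod.permute[OF that, of "\<lambda>j. g (inv_into UNIV p j) (y j)"] permutes_inverses(2)[OF that]
    by (simp add: o_def)
  have eq2: "(\<Prod>i<l. \<Sum>x\<in>R (p i). g i x) = (\<Prod>j<l. \<Sum>x\<in>R j. g (inv_into UNIV p j) x)"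
    if "p permutes {..<l}" for p
    using prod.permute[OF that, of "\<lambda>j. \<Sum>x\<in>R j. g (inv_into UNIV p j) x"] permutes_inverses(2)[OF that]
    by (simp add: o_def)
  have "(\<Sum>y\<in>PiE {..<l} R. dtm l (\<lambda>i j. g i (y j))) =
     (\<Sum>p | p permutes {..<l}. signof p * (\<Sum>y\<in>PiE {..<l} R. \<Prod>j<l. g (inv_into UNIV p j) (y j)))"
    unfolding dtm_Leibniz by (subst sum.swap) (simp add: eq sum_distrib_left)
  also have "\<dots> = (\<Sum>p | p permutes {..<l}. signof p * (\<Prod>j<l. \<Sum>x\<in>R j. g (inv_into UNIV p j) x))"
    by (subst prod_sum_PiE) (use assms in auto)
  also have "\<dots> = dtm l (\<lambda>i j. \<Sum>x\<in>R j. g i x)"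
    unfolding dtm_Leibniz by (simp add: eq2)
  finally show ?thesis .
qed

text \<open>In the Leibniz sum, weighting row \<open>c\<close> contributes the factor
  \<open>w (y (p c))\<close>, and \<open>p\<close> merely permutes these factors when
  \<open>c\<close> runs over all rows. Thus a linear statistic of a configuration times its
  determinant is again a sum of determinants of that form.\<close>

lemma dtm_scaled_rows_eq_columns:
  "(\<Sum>j<l. w (y j)) * dtm l (\<lambda>i j. g i (y j)) =
   (\<Sum>c<l. dtm l (\<lambda>i j. if i = c then w (y j) * g i (y j) else g i (y j)))"
proof -
  have *: "(\<Prod>i<l. if i = c then w (y (p i)) * g i (y (p i)) else g i (y (p i))) =
      w (y (p c)) * (\<Prod>i<l. g i (y (p i)))" if "c < l" for c p
  proof -
    have "(\<Prod>i<l. if i = c then w (y (p i)) * g i (y (p i)) else g i (y (p i))) =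
      (\<Prod>i<l. (if i = c then w (y (p i)) else 1) * g i (y (p i)))"
      by (intro prod.cong) auto
    also have "\<dots> = (\<Prod>i<l. (if i = c then w (y (p i)) else 1)) * (\<Prod>i<l. g i (y (p i)))"
      by (rule prod.distrib)
    also have "(\<Prod>i<l. (if i = c then w (y (p i)) else 1)) = w (y (p c))"
      using that by (simp add: prod.delta)
    finally show ?thesis .
  qed
  have "(\<Sum>c<l. dtm l (\<lambda>i j. if i = c then w (y j) * g i (y j) else g i (y j))) =
    (\<Sum>c<l. \<Sum>p | p permutes {..<l}. signof p * (w (y (p c)) * (\<Prod>i<l. g i (y (p i)))))"
    unfolding dtm_Leibniz by (intro sum.cong refl) (simp add: *)
  also have "\<dots> = (\<Sum>p | p permutes {..<l}. signof p * ((\<Sum>c<l. w (y (p c))) * (\<Prod>i<l. g i (y (p i)))))"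
    by (subst sum.swap) (simp add: sum_distrib_left sum_distrib_right)
  also have "\<dots> = (\<Sum>p | p permutes {..<l}. signof p * ((\<Sum>c<l. w (y c)) * (\<Prod>i<l. g i (y (p i)))))"
  proof (intro sum.cong refl)
    fix p assume "p \<in> {p. p permutes {..<l}}"
    then have "(\<Sum>c<l. w (y (p c))) = (\<Sum>c<l. w (y c))"
      using sum.permute[of p "{..<l}" "\<lambda>c. w (y c)"] by (simp add: o_def)
    then show "signof p * ((\<Sum>c<l. w (y (p c))) * (\<Prod>i<l. g i (y (p i)))) =
      signof p * ((\<Sum>c<l. w (y c)) * (\<Prod>i<l. g i (y (p i))))" by simp
  qed
  also have "\<dots> = (\<Sum>j<l. w (y j)) * dtm l (\<lambda>i j. g i (y j))"
    unfolding dtm_Leibniz by (simp add: sum_distrib_left algebra_simps)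
  finally show ?thesis by simp
qed

definition prefix_sum :: "(nat \<Rightarrow> real) \<Rightarrow> nat \<Rightarrow> real" where
  "prefix_sum g x = (\<Sum>y<x. g y)"

definition push_rows :: "(nat \<Rightarrow> nat \<Rightarrow> real) \<Rightarrow> nat \<Rightarrow> nat \<Rightarrow> real" where
  "push_rows g i = (case i of 0 \<Rightarrow> (\<lambda>_. 1) | Suc i' \<Rightarrow> prefix_sum (g i'))"

text \<open>The sum of \<open>g i\<close> over \<open>{a j..<a (Suc j)}\<close> is the difference of
  the prefix sums in two neighbouring columns. Such differences are what remains after subtracting
  from each column its predecessor, which clears the row of ones up to its first entry.\<close>

lemma dtm_push_rows:
  assumes "\<And>j. j < l \<Longrightarrow> a j \<le> a (Suc j)"
  shows "(\<Sum>y\<in>PiE {..<l} (\<lambda>j. {a j..<a (Suc j)}). dtm l (\<lambda>i j. g i (y j))) =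
         dtm (Suc l) (\<lambda>i j. push_rows g i (a j))"
proof -
  \<comment> \<open>Right multiplication by \<open>U\<close> subtracts from each column its left
    neighbour; \<open>U\<close> is unitriangular.\<close>
  define U :: "nat \<Rightarrow> nat \<Rightarrow> real" where
    "U r j = (if r = j then 1 else if Suc r = j then -1 else 0)" for r j
  have U: "dtm (Suc l) U = 1"
    by (subst dtm_upper_triangular) (auto simp: U_def)
  have colop: "(\<Sum>r<Suc l. f r * U r j) = (if j = 0 then f 0 else f j - f (j - 1))"
    if "j < Suc l" for f :: "nat \<Rightarrow> real" and j
  proof (cases j)
    case 0
    have "(\<Sum>r<Suc l. f r * U r j) = (\<Sum>r<Suc l. if r = 0 then f 0 else 0)"
      using 0 by (intro sum.cong) (auto simp: U_def)
    then show ?thesis using 0 by simp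
  next
    case (Suc j')
    have "(\<Sum>r<Suc l. f r * U r j) = (\<Sum>r<Suc l. (if r = j then f j else 0) - (if r = j' then f j' else 0))"
      using Suc by (intro sum.cong) (auto simp: U_def)
    also have "\<dots> = f j - f j'"
      using that Suc by (subst sum_subtractf) simp
    finally show ?thesis using Suc by simp
  qed
  have "dtm (Suc l) (\<lambda>i j. push_rows g i (a j)) =
        dtm (Suc l) (\<lambda>i j. push_rows g i (a j)) * dtm (Suc l) U" using U by simp
  also have "\<dots> = dtm (Suc l) (\<lambda>i j. \<Sum>r<Suc l. push_rows g i (a r) * U r j)"
    by (rule dtm_mult)
  also have "\<dots> = dtm (Suc l) (\<lambda>i j. if j = 0 then push_rows g i (a 0)
      else push_rows g i (a j) - push_rows g i (a (j - 1)))"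
    by (rule dtm_cong) (rule colop)
  also have "\<dots> = dtm l (\<lambda>i j. prefix_sum (g i) (a (Suc j)) - prefix_sum (g i) (a j))"
    by (subst dtm_first_row_unit) (auto simp: push_rows_def)
  also have "\<dots> = dtm l (\<lambda>i j. \<Sum>x\<in>{a j..<a (Suc j)}. g i x)"
  proof (rule dtm_cong)
    fix i j assume "j < l"
    then have le: "a j \<le> a (Suc j)" by (rule assms)
    have "{..<a (Suc j)} = {..<a j} \<union> {a j..<a (Suc j)}" using le by auto
    then show "prefix_sum (g i) (a (Suc j)) - prefix_sum (g i) (a j) = (\<Sum>x\<in>{a j..<a (Suc j)}. g i x)"
      unfolding prefix_sum_def by (simp add: sum.union_disjoint ivl_disj_int)
  qed
  also have "\<dots> = (\<Sum>y\<in>PiE {..<l} (\<lambda>j. {a j..<a (Suc j)}). dtm l (\<lambda>i j. g i (y j)))"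
    by (subst dtm_column_sums) auto
  finally show ?thesis by simp
qed

section \<open>Interlacing patterns\<close>

definition nth_elem :: "nat set \<Rightarrow> nat \<Rightarrow> nat" where
  "nth_elem A j = sorted_list_of_set A ! j"

lemma nth_elem_strict_mono:
  assumes "i < j" "j < card A"
  shows "nth_elem A i < nth_elem A j"
  unfolding nth_elem_def
  using assms sorted_wrt_nth_less[OF strict_sorted_list_of_set, of i j A] by simp

lemma nth_elem_mono:
  assumes "i \<le> j" "j < card A"
  shows "nth_elem A i \<le> nth_elem A j"
  using nth_elem_strict_mono[of i j A] assms by (cases "i = j") auto

lemma nth_elem_image:
  assumes "finite A"
  shows "nth_elem A ` {..<card A} = A"
proof -
  have "nth_elem A ` {..<card A} = set (sorted_list_of_set A)"
    by (auto simp: nth_elem_def set_conv_nth)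
  then show ?thesis using assms by simp
qed

lemma nth_elem_inj: "inj_on (nth_elem A) {..<card A}"
  unfolding inj_on_def using nth_elem_strict_mono
  by (metis lessThan_iff less_irrefl linorder_neqE_nat)

lemma nth_elem_of_image:
  assumes "strict_mono_on {..<l} y" "j < l"
  shows "nth_elem (y ` {..<l}) j = y j"
proof -
  have "sorted_list_of_set (y ` {..<l}) = map y [0..<l]"
  proof (rule sorted_list_of_set_unique[THEN iffD1, rotated])
    have "inj_on y {..<l}" by (rule strict_mono_on_imp_inj_on[OF assms(1)])
    then show "sorted_wrt (<) (map y [0..<l]) \<and> set (map y [0..<l]) = y ` {..<l} \<and>
        length (map y [0..<l]) = card (y ` {..<l})"
      using strict_mono_onD[OF assms(1)]
      by (auto simp: sorted_wrt_map sorted_wrt_iff_nth_less card_image atLeast0LessThan)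
  qed simp
  then show ?thesis using assms(2) by (simp add: nth_elem_def)
qed

text \<open>Passes between order statistics and counting functions, which form a Galois
  connection.\<close>

lemma nth_elem_less_iff:
  assumes "finite A" "j < card A"
  shows "nth_elem A j < x \<longleftrightarrow> j < card (A \<inter> {..<x})"
proof -
  define J where "J = {j. j < card A \<and> nth_elem A j < x}"
  have "A \<inter> {..<x} = nth_elem A ` J"
  proof -
    have "A \<inter> {..<x} = nth_elem A ` {..<card A} \<inter> {..<x}" by (simp add: nth_elem_image[OF assms(1)])
    also have "\<dots> = nth_elem A ` J" by (auto simp: J_def)
    finally show ?thesis .
  qed
  moreover have "inj_on (nth_elem A) J"
    by (rule inj_on_subset[OF nth_elem_inj]) (auto simp: J_def)
  ultimately have c: "card (A \<inter> {..<x}) = card J" by (simp add: card_image)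
  have fin: "finite J" by (simp add: J_def)
  show ?thesis
  proof
    assume "nth_elem A j < x"
    then have "{..j} \<subseteq> J"
      using assms(2) nth_elem_mono[of _ j A] by (fastforce simp: J_def)
    then show "j < card (A \<inter> {..<x})" using card_mono[OF fin, of "{..j}"] c by simp
  next
    assume j: "j < card (A \<inter> {..<x})"
    show "nth_elem A j < x"
    proof (rule ccontr)
      assume neg: "\<not> nth_elem A j < x"
      have "J \<subseteq> {..<j}"
      proof
        fix i assume "i \<in> J"
        then have "nth_elem A i < nth_elem A j" "i < card A" using neg by (auto simp: J_def)
        then show "i \<in> {..<j}" using nth_elem_mono[of j i A] by (cases "i < j") auto
      qed
      then have "card J \<le> j" using card_mono[of "{..<j}" J] by simp
      with j c show False by simp
    qed
  qed
qed

text \<open>Stated with counting functions because a row of a matching is scanned that way. The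
  closed bound on \<open>A\<close> in the first part makes one of the inequalities strict: the order
  is \<open>a 0 \<le> b 0 < a 1 \<le> b 1 < ...\<close>, as \<open>interlaces_iff\<close>
  shows.\<close>

definition interlaces :: "nat set \<Rightarrow> nat set \<Rightarrow> bool" where
  "interlaces A B \<longleftrightarrow> (\<forall>x. card (A \<inter> {..x}) \<le> Suc (card (B \<inter> {..<x})) \<and>
     card (B \<inter> {..<x}) \<le> card (A \<inter> {..<x}))"

text \<open>Evaluating the counting inequalities at the elements themselves gives the order
  relations. Conversely, if a counting inequality fails at \<open>x\<close>, the smaller count is an
  index at which the order relations fail.\<close>

lemma interlaces_iff:
  assumes "finite A" "card A = Suc l" "finite B" "card B = l"
  shows "interlaces A B \<longleftrightarrow> (\<forall>j<l. nth_elem A j \<le> nth_elem B j \<and> nth_elem B j < nth_elem A (Suc j))"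
proof
  assume il: "interlaces A B"
  show "\<forall>j<l. nth_elem A j \<le> nth_elem B j \<and> nth_elem B j < nth_elem A (Suc j)"
  proof (intro allI impI conjI)
    fix j assume j: "j < l"
    have "j < card (B \<inter> {..<Suc (nth_elem B j)})"
      using nth_elem_less_iff[OF assms(3), of j "Suc (nth_elem B j)"] j assms by simp
    also have "\<dots> \<le> card (A \<inter> {..<Suc (nth_elem B j)})" using il by (simp add: interlaces_def)
    finally show "nth_elem A j \<le> nth_elem B j"
      using nth_elem_less_iff[OF assms(1), of j "Suc (nth_elem B j)"] j assms by simp
    have "Suc j < card (A \<inter> {..<Suc (nth_elem A (Suc j))})"
      using nth_elem_less_iff[OF assms(1), of "Suc j" "Suc (nth_elem A (Suc j))"] j assms by simp
    also have "\<dots> \<le> Suc (card (B \<inter> {..<nth_elem A (Suc j)}))"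
      using il by (simp add: interlaces_def lessThan_Suc_atMost)
    finally show "nth_elem B j < nth_elem A (Suc j)"
      using nth_elem_less_iff[OF assms(3), of j "nth_elem A (Suc j)"] j assms by simp
  qed
next
  assume R: "\<forall>j<l. nth_elem A j \<le> nth_elem B j \<and> nth_elem B j < nth_elem A (Suc j)"
  show "interlaces A B" unfolding interlaces_def
  proof (intro allI conjI)
    fix x
    show "card (A \<inter> {..x}) \<le> Suc (card (B \<inter> {..<x}))"
    proof (rule ccontr)
      assume "\<not> ?thesis"
      then have lt: "Suc (card (B \<inter> {..<x})) < card (A \<inter> {..<Suc x})"
        by (simp add: lessThan_Suc_atMost)
      moreover have "card (A \<inter> {..<Suc x}) \<le> Suc l"
        using card_mono[OF assms(1), of "A \<inter> {..<Suc x}"] assms by auto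
      ultimately have b: "card (B \<inter> {..<x}) < l" by simp
      then have "nth_elem A (Suc (card (B \<inter> {..<x}))) < Suc x"
        using lt nth_elem_less_iff[OF assms(1)] assms by simp
      then have "nth_elem B (card (B \<inter> {..<x})) < x" using R b by fastforce
      then show False using nth_elem_less_iff[OF assms(3)] b assms by simp
    qed
    show "card (B \<inter> {..<x}) \<le> card (A \<inter> {..<x})"
    proof (rule ccontr)
      assume "\<not> ?thesis"
      then have lt: "card (A \<inter> {..<x}) < card (B \<inter> {..<x})" by simp
      moreover have "card (B \<inter> {..<x}) \<le> l"
        using card_mono[OF assms(3), of "B \<inter> {..<x}"] assms by auto
      ultimately have b: "card (A \<inter> {..<x}) < l" by simp
      then have "nth_elem B (card (A \<inter> {..<x})) < x"
        using lt nth_elem_less_iff[OF assms(3)] assms by simp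
      then have "nth_elem A (card (A \<inter> {..<x})) < x" using R b by fastforce
      then show False using nth_elem_less_iff[OF assms(1)] b assms by simp
    qed
  qed
qed

definition transversals :: "nat \<Rightarrow> (nat \<Rightarrow> nat set) \<Rightarrow> nat set set" where
  "transversals l R = {A. finite A \<and> card A = l \<and> (\<forall>j<l. nth_elem A j \<in> R j)}"

definition ordered_family :: "nat \<Rightarrow> (nat \<Rightarrow> nat set) \<Rightarrow> bool" where
  "ordered_family l R \<longleftrightarrow> (\<forall>i j x y. i < j \<longrightarrow> j < l \<longrightarrow> x \<in> R i \<longrightarrow> y \<in> R j \<longrightarrow> x < y)"

lemma ordered_family_strict_mono:
  assumes "ordered_family l R" "y \<in> PiE {..<l} R"
  shows "strict_mono_on {..<l} y"
proof (rule strict_mono_onI)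
  fix i j assume ij: "i \<in> {..<l}" "j \<in> {..<l}" "i < j"
  have "y i \<in> R i" "y j \<in> R j" using ij PiE_mem[OF assms(2)] by blast+
  then show "y i < y j"
    using assms(1)[unfolded ordered_family_def, rule_format, of i j "y i" "y j"] ij by simp
qed

text \<open>Every element of \<open>R i\<close> precedes every element of \<open>R j\<close> for
  \<open>i < j\<close>, so the choice from \<open>R j\<close> is recovered as the
  \<open>j\<close>-th smallest element of the set of choices. Sums over configurations become sums
  over independent choices, as \<open>dtm_column_sums\<close> requires.\<close>

lemma bij_betw_transversals:
  assumes "ordered_family l R"
  shows "bij_betw (\<lambda>y. y ` {..<l}) (PiE {..<l} R) (transversals l R)"
proof (rule bij_betw_byWitness[where f' = "\<lambda>A. restrict (nth_elem A) {..<l}"])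
  show "\<forall>y\<in>PiE {..<l} R. restrict (nth_elem (y ` {..<l})) {..<l} = y"
  proof
    fix y assume y: "y \<in> PiE {..<l} R"
    note sm = ordered_family_strict_mono[OF assms y]
    show "restrict (nth_elem (y ` {..<l})) {..<l} = y"
    proof (rule ext)
      fix j
      show "restrict (nth_elem (y ` {..<l})) {..<l} j = y j"
        using nth_elem_of_image[OF sm, of j] PiE_arb[OF y, of j] by (cases "j < l") simp_all
    qed
  qed
  show "\<forall>A\<in>transversals l R. restrict (nth_elem A) {..<l} ` {..<l} = A"
    using nth_elem_image by (auto simp: transversals_def)
  show "(\<lambda>y. y ` {..<l}) ` PiE {..<l} R \<subseteq> transversals l R"
  proof (rule image_subsetI)
    fix y assume y: "y \<in> PiE {..<l} R"
    note sm = ordered_family_strict_mono[OF assms y]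
    have "card (y ` {..<l}) = l"
      using strict_mono_on_imp_inj_on[OF sm] by (simp add: card_image)
    then show "y ` {..<l} \<in> transversals l R"
      using y nth_elem_of_image[OF sm] by (auto simp: transversals_def)
  qed
  show "(\<lambda>A. restrict (nth_elem A) {..<l}) ` transversals l R \<subseteq> PiE {..<l} R"
    by (auto simp: transversals_def split: if_splits)
qed

definition config_det :: "nat \<Rightarrow> (nat \<Rightarrow> nat \<Rightarrow> real) \<Rightarrow> nat set \<Rightarrow> real" where
  "config_det l g A = dtm l (\<lambda>i j. g i (nth_elem A j))"

lemma sum_config_det_transversals:
  assumes "ordered_family l R"
  shows "(\<Sum>A\<in>transversals l R. config_det l g A) = (\<Sum>y\<in>PiE {..<l} R. dtm l (\<lambda>i j. g i (y j)))"
proof -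
  have "(\<Sum>A\<in>transversals l R. config_det l g A) = (\<Sum>y\<in>PiE {..<l} R. config_det l g (y ` {..<l}))"
    by (rule sum.reindex_bij_betw[OF bij_betw_transversals[OF assms], symmetric])
  also have "\<dots> = (\<Sum>y\<in>PiE {..<l} R. dtm l (\<lambda>i j. g i (y j)))"
    unfolding config_det_def
    by (intro sum.cong refl dtm_cong)
       (use nth_elem_of_image[OF ordered_family_strict_mono[OF assms]] in auto)
  finally show ?thesis .
qed

definition below_configs :: "nat \<Rightarrow> nat set \<Rightarrow> nat set set" where
  "below_configs l A = {B. finite B \<and> card B = l \<and> interlaces A B}"

lemma below_configs_eq:
  assumes "finite A" "card A = Suc l"
  shows "below_configs l A = transversals l (\<lambda>j. {nth_elem A j..<nth_elem A (Suc j)})"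
    and "ordered_family l (\<lambda>j. {nth_elem A j..<nth_elem A (Suc j)})"
proof -
  show "below_configs l A = transversals l (\<lambda>j. {nth_elem A j..<nth_elem A (Suc j)})"
    unfolding below_configs_def transversals_def using interlaces_iff[OF assms] by auto
  show "ordered_family l (\<lambda>j. {nth_elem A j..<nth_elem A (Suc j)})"
    unfolding ordered_family_def
  proof (intro allI impI)
    fix i j x y assume a: "i < j" "j < l" "x \<in> {nth_elem A i..<nth_elem A (Suc i)}" "y \<in> {nth_elem A j..<nth_elem A (Suc j)}"
    then have "nth_elem A (Suc i) \<le> nth_elem A j" using assms by (intro nth_elem_mono) auto
    then show "x < y" using a by auto
  qed
qed

lemma finite_below_configs:
  assumes "finite A" "card A = Suc l"
  shows "finite (below_configs l A)"
  using bij_betw_finite[OF bij_betw_transversals[OF below_configs_eq(2)[OF assms]]]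
  by (simp add: below_configs_eq[OF assms] finite_PiE)

lemma sum_config_det_below:
  assumes "finite A" "card A = Suc l"
  shows "(\<Sum>B\<in>below_configs l A. config_det l g B) = config_det (Suc l) (push_rows g) A"
proof -
  have "(\<Sum>B\<in>below_configs l A. config_det l g B) =
      (\<Sum>y\<in>PiE {..<l} (\<lambda>j. {nth_elem A j..<nth_elem A (Suc j)}). dtm l (\<lambda>i j. g i (y j)))"
    unfolding below_configs_eq(1)[OF assms]
    by (rule sum_config_det_transversals[OF below_configs_eq(2)[OF assms]])
  also have "\<dots> = config_det (Suc l) (push_rows g) A"
    unfolding config_det_def
    by (rule dtm_push_rows) (use assms in \<open>auto intro: nth_elem_mono\<close>)
  finally show ?thesis .
qed

definition base_configs :: "nat \<Rightarrow> nat set set" where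
  "base_configs n = {A. A \<subseteq> {..<2 * n} \<and> (\<forall>j<n. (2 * j \<in> A) \<noteq> (2 * j + 1 \<in> A))}"

lemma base_configs_eq:
  "base_configs n = transversals n (\<lambda>j. {2 * j, 2 * j + 1})"
  and ordered_family_pairs: "ordered_family n (\<lambda>j. {2 * j, 2 * j + 1})"
proof -
  let ?R = "\<lambda>j::nat. {2 * j, 2 * j + 1}"
  show o: "ordered_family n ?R" by (auto simp: ordered_family_def)
  have "base_configs n = (\<lambda>y. y ` {..<n}) ` PiE {..<n} ?R"
  proof (intro equalityI subsetI)
    fix A assume A: "A \<in> base_configs n"
    define y where "y = restrict (\<lambda>j. if 2 * j \<in> A then 2 * j else 2 * j + 1) {..<n}"
    have "y \<in> PiE {..<n} ?R" by (auto simp: y_def)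
    moreover have "y ` {..<n} = A"
    proof (intro equalityI subsetI)
      fix x assume "x \<in> y ` {..<n}"
      then show "x \<in> A" using A by (auto simp: y_def base_configs_def split: if_splits)
    next
      fix x assume x: "x \<in> A"
      then have xn: "x div 2 < n" using A by (auto simp: base_configs_def)
      moreover have "y (x div 2) = x"
      proof (cases "even x")
        case True then show ?thesis using x xn by (auto simp: y_def)
      next
        case False
        then have e: "x = 2 * (x div 2) + 1" by presburger
        then have "2 * (x div 2) \<notin> A" using A x xn by (auto simp: base_configs_def)
        then show ?thesis using xn e by (auto simp: y_def)
      qed
      ultimately show "x \<in> y ` {..<n}" by (metis imageI lessThan_iff)
    qed
    ultimately show "A \<in> (\<lambda>y. y ` {..<n}) ` PiE {..<n} ?R" by blast
  next
    fix A assume "A \<in> (\<lambda>y. y ` {..<n}) ` PiE {..<n} ?R"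
    then obtain y where y: "y \<in> PiE {..<n} ?R" "A = y ` {..<n}" by blast
    have yj: "y j = 2 * j \<or> y j = 2 * j + 1" if "j < n" for j using y(1) that by (auto dest: PiE_mem)
    have "A \<subseteq> {..<2 * n}" using y(2) yj by fastforce
    moreover have "(2 * j \<in> A) \<noteq> (2 * j + 1 \<in> A)" if "j < n" for j
    proof -
      have u: "i = j" if "i < n" "y i = 2 * j \<or> y i = 2 * j + 1" for i
        using yj[OF that(1)] that(2) by presburger
      show ?thesis
      proof (cases "y j = 2 * j")
        case True
        then have "2 * j \<in> A" using y(2) that by (metis imageI lessThan_iff)
        moreover have "2 * j + 1 \<notin> A" using u True y(2) by fastforce
        ultimately show ?thesis by simp
      next
        case False
        then have "y j = 2 * j + 1" using yj[OF that] by simp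
        then have "2 * j + 1 \<in> A" using y(2) that by (metis imageI lessThan_iff)
        moreover have "2 * j \<notin> A" using u False y(2) by fastforce
        ultimately show ?thesis by simp
      qed
    qed
    ultimately show "A \<in> base_configs n" by (simp add: base_configs_def)
  qed
  then show "base_configs n = transversals n ?R"
    using bij_betw_transversals[OF o] by (simp add: bij_betw_def)
qed

lemma sum_config_det_base:
  "(\<Sum>A\<in>base_configs n. config_det n g A) = dtm n (\<lambda>i j. g i (2 * j) + g i (2 * j + 1))"
  unfolding base_configs_eq sum_config_det_transversals[OF ordered_family_pairs]
  by (subst dtm_column_sums) auto

text \<open>The rows beyond \<open>l\<close> are set to \<open>{}\<close> so that a pattern is
  determined by its rows up to \<open>l\<close> and there are only finitely many patterns.\<close>

definition patterns :: "nat \<Rightarrow> nat set \<Rightarrow> (nat \<Rightarrow> nat set) set" where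
  "patterns l A = {X. X l = A \<and> (\<forall>j\<le>l. finite (X j) \<and> card (X j) = j) \<and>
     (\<forall>j<l. interlaces (X (Suc j)) (X j)) \<and> (\<forall>j>l. X j = {})}"

lemma patterns_0: "patterns 0 {} = {\<lambda>_. {}}"
proof (intro equalityI subsetI)
  fix X assume X: "X \<in> patterns 0 {}"
  have "X j = {}" for j using X by (cases "j = 0") (simp_all add: patterns_def)
  then show "X \<in> {\<lambda>_. {}}" by (simp add: fun_eq_iff)
qed (simp add: patterns_def)

lemma bij_betw_patterns_Suc:
  assumes "finite A" "card A = Suc l"
  shows "bij_betw (\<lambda>(B, X). X(Suc l := A)) (SIGMA B:below_configs l A. patterns l B) (patterns (Suc l) A)"
proof (rule bij_betw_byWitness[where f' = "\<lambda>X. (X l, X(Suc l := {}))"])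
  show "\<forall>p\<in>SIGMA B:below_configs l A. patterns l B.
      (((\<lambda>(B, X). X(Suc l := A)) p) l, ((\<lambda>(B, X). X(Suc l := A)) p)(Suc l := {})) = p"
    by (auto simp: patterns_def fun_eq_iff)
  show "\<forall>X\<in>patterns (Suc l) A. (\<lambda>(B, X). X(Suc l := A)) (X l, X(Suc l := {})) = X"
    by (auto simp: patterns_def)
  show "(\<lambda>(B, X). X(Suc l := A)) ` (SIGMA B:below_configs l A. patterns l B) \<subseteq> patterns (Suc l) A"
    using assms by (auto simp: patterns_def below_configs_def le_Suc_eq less_Suc_eq)
  show "(\<lambda>X. (X l, X(Suc l := {}))) ` patterns (Suc l) A \<subseteq> (SIGMA B:below_configs l A. patterns l B)"
    by (auto simp: patterns_def below_configs_def split: if_splits)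
qed

lemma finite_patterns:
  assumes "finite A" "card A = l"
  shows "finite (patterns l A)"
  using assms
proof (induction l arbitrary: A)
  case 0 then show ?case by (simp add: patterns_0)
next
  case (Suc l)
  have "finite (SIGMA B:below_configs l A. patterns l B)"
    using finite_below_configs[OF Suc.prems] Suc.IH by (intro finite_SigmaI) (auto simp: below_configs_def)
  then show ?case using bij_betw_finite[OF bij_betw_patterns_Suc[OF Suc.prems]] by simp
qed

lemma sum_patterns_Suc:
  assumes "finite A" "card A = Suc l"
  shows "(\<Sum>X\<in>patterns (Suc l) A. F X) = (\<Sum>B\<in>below_configs l A. \<Sum>X\<in>patterns l B. F (X(Suc l := A)))"
proof -
  have "(\<Sum>X\<in>patterns (Suc l) A. F X) =
     (\<Sum>p\<in>(SIGMA B:below_configs l A. patterns l B). F ((\<lambda>(B, X). X(Suc l := A)) p))"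
    by (rule sum.reindex_bij_betw[OF bij_betw_patterns_Suc[OF assms], symmetric])
  also have "\<dots> = (\<Sum>B\<in>below_configs l A. \<Sum>X\<in>patterns l B. F (X(Suc l := A)))"
    using finite_below_configs[OF assms]
    by (subst sum.Sigma) (auto simp: below_configs_def intro!: finite_patterns sum.cong)
  finally show ?thesis .
qed

text \<open>A fixed point of \<open>push_rows\<close>; in closed form these are the binomial
  coefficients \<open>x choose i\<close>.\<close>

definition sum_rows :: "nat \<Rightarrow> nat \<Rightarrow> real" where
  "sum_rows i = (prefix_sum ^^ i) (\<lambda>_. 1)"

lemma push_rows_sum_rows: "push_rows sum_rows = sum_rows"
  by (rule ext) (simp add: push_rows_def sum_rows_def split: nat.split)

text \<open>Each interlacing sum applies \<open>push_rows\<close>, which fixes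
  \<open>sum_rows\<close>, and the empty determinant is 1. Since row \<open>i\<close> is a
  polynomial of degree \<open>i\<close> in the position, this is the Vandermonde count of
  Gelfand-Tsetlin patterns.\<close>

lemma card_patterns:
  assumes "finite A" "card A = l"
  shows "real (card (patterns l A)) = config_det l sum_rows A"
  using assms
proof (induction l arbitrary: A)
  case 0
  then show ?case by (simp add: patterns_0 config_det_def dtm_def det_dim_zero)
next
  case (Suc l)
  have "real (card (patterns (Suc l) A)) = (\<Sum>X\<in>patterns (Suc l) A. 1)" by simp
  also have "\<dots> = (\<Sum>B\<in>below_configs l A. real (card (patterns l B)))"
    by (subst sum_patterns_Suc[OF Suc.prems]) simp
  also have "\<dots> = (\<Sum>B\<in>below_configs l A. config_det l sum_rows B)"
    by (intro sum.cong refl Suc.IH) (auto simp: below_configs_def)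
  also have "\<dots> = config_det (Suc l) sum_rows A"
    by (simp add: sum_config_det_below[OF Suc.prems] push_rows_sum_rows)
  finally show ?case .
qed

text \<open>A statistic of row \<open>k\<close> alone splits the pattern there: the rows up to
  \<open>k\<close> contribute the count \<open>card (patterns k B)\<close>, and the \<open>r\<close>
  further interlacing sums act on determinants through \<open>push_rows\<close>. The last hypothesis
  expresses count times statistic by determinants.\<close>

lemma sum_patterns_level:
  assumes "finite A" "card A = k + r"
    and "\<And>B. finite B \<Longrightarrow> card B = k \<Longrightarrow> real (card (patterns k B)) * \<Phi> B = (\<Sum>c\<in>C. config_det k (g c) B)"
  shows "(\<Sum>X\<in>patterns (k + r) A. \<Phi> (X k)) = (\<Sum>c\<in>C. config_det (k + r) ((push_rows ^^ r) (g c)) A)"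
  using assms(1,2)
proof (induction r arbitrary: A)
  case 0
  have "(\<Sum>X\<in>patterns k A. \<Phi> (X k)) = (\<Sum>X\<in>patterns k A. \<Phi> A)"
    by (intro sum.cong) (auto simp: patterns_def)
  then show ?case using assms(3)[of A] 0 by simp
next
  case (Suc r)
  then have A: "finite A" "card A = Suc (k + r)" by auto
  have "(\<Sum>X\<in>patterns (k + Suc r) A. \<Phi> (X k)) = (\<Sum>B\<in>below_configs (k + r) A. \<Sum>X\<in>patterns (k + r) B. \<Phi> (X k))"
    using sum_patterns_Suc[OF A, of "\<lambda>X. \<Phi> (X k)"] by simp
  also have "\<dots> = (\<Sum>B\<in>below_configs (k + r) A. \<Sum>c\<in>C. config_det (k + r) ((push_rows ^^ r) (g c)) B)"
    by (intro sum.cong refl Suc.IH) (auto simp: below_configs_def)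
  also have "\<dots> = (\<Sum>c\<in>C. config_det (Suc (k + r)) ((push_rows ^^ Suc r) (g c)) A)"
    by (subst sum.swap) (simp add: sum_config_det_below[OF A])
  finally show ?case by simp
qed

lemma push_rows_funpow:
  "(push_rows ^^ r) g i = (if i < r then (prefix_sum ^^ i) (\<lambda>_. 1) else (prefix_sum ^^ r) (g (i - r)))"
proof (induction r arbitrary: i)
  case (Suc r)
  then show ?case by (cases i) (auto simp: push_rows_def)
qed simp

section \<open>A biorthogonal polynomial basis\<close>

text \<open>The linear functional on polynomials that sends \<open>u^x\<close> to
  \<open>g x\<close>. Multiplication by \<open>u\<close> becomes a shift of \<open>g\<close>, so
  difference operators on sequences can be computed in the polynomial ring.\<close>

definition pair_with :: "real poly \<Rightarrow> (nat \<Rightarrow> real) \<Rightarrow> real" where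
  "pair_with p g = (\<Sum>x\<le>degree p. coeff p x * g x)"

lemma pair_with_bound:
  assumes "degree p \<le> N"
  shows "pair_with p g = (\<Sum>x\<le>N. coeff p x * g x)"
  unfolding pair_with_def by (rule sum.mono_neutral_left) (use assms in \<open>auto simp: coeff_eq_0\<close>)

lemma pair_with_add: "pair_with (p + q) g = pair_with p g + pair_with q g"
proof -
  let ?N = "max (degree p) (degree q)"
  have "degree (p + q) \<le> ?N" by (simp add: degree_add_le_max)
  then show ?thesis
    using pair_with_bound[of "p + q" ?N] pair_with_bound[of p ?N] pair_with_bound[of q ?N]
    by (simp add: distrib_right sum.distrib)
qed

lemma pair_with_smult: "pair_with (Polynomial.smult c p) g = c * pair_with p g"
  using pair_with_bound[of "Polynomial.smult c p" "degree p"] by (simp add: pair_with_def sum_distrib_left mult.assoc)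

lemma pair_with_0: "pair_with 0 g = 0"
  by (simp add: pair_with_def)

lemma pair_with_sum: "finite A \<Longrightarrow> pair_with (\<Sum>i\<in>A. f i) g = (\<Sum>i\<in>A. pair_with (f i) g)"
  by (induction rule: finite_induct) (auto simp: pair_with_0 pair_with_add)

lemma pair_with_pCons: "pair_with (pCons c p) g = c * g 0 + pair_with p (\<lambda>x. g (Suc x))"
proof -
  have "pair_with (pCons c p) g = (\<Sum>x\<le>Suc (degree p). coeff (pCons c p) x * g x)"
    by (rule pair_with_bound) (rule degree_pCons_le)
  also have "\<dots> = coeff (pCons c p) 0 * g 0 + (\<Sum>x\<le>degree p. coeff (pCons c p) (Suc x) * g (Suc x))"
    by (rule sum.atMost_Suc_shift)
  finally show ?thesis by (simp add: pair_with_def)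
qed

lemma pair_with_fun_add:
  "pair_with p (\<lambda>x. f x + g x) = pair_with p f + pair_with p g"
  by (simp add: pair_with_def distrib_left sum.distrib)

lemma pair_with_fun_cmult:
  "pair_with p (\<lambda>x. c * f x) = c * pair_with p f"
  by (simp add: pair_with_def sum_distrib_left algebra_simps)

lemma pair_with_1: "pair_with 1 g = g 0"
  by (simp add: pair_with_def)

lemma pair_with_linear: "pair_with ([:a, b:] * p) g = pair_with p (\<lambda>x. a * g x + b * g (Suc x))"
proof -
  have "[:a, b:] * p = Polynomial.smult a p + pCons 0 (Polynomial.smult b p)" by (simp add: smult_add_right)
  then have "pair_with ([:a, b:] * p) g = a * pair_with p g + b * pair_with p (\<lambda>x. g (Suc x))"
    by (simp add: pair_with_add pair_with_smult pair_with_pCons)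
  then show ?thesis by (simp add: pair_with_fun_add pair_with_fun_cmult)
qed

text \<open>The generating function of Krawtchouk polynomials. It serves twice: as a functional on
  sequences through \<open>pair_with\<close>, and with \<open>A = N - x\<close>,
  \<open>B = x\<close> as the weight of a particle at \<open>x\<close>.\<close>

definition kraw_poly :: "nat \<Rightarrow> nat \<Rightarrow> real poly" where
  "kraw_poly A B = [:1, 1:] ^ A * [:1, -1:] ^ B"

text \<open>The factor \<open>1 - u\<close> turns \<open>prefix_sum g\<close> into
  \<open>prefix_sum g x - prefix_sum g (Suc x) = - g x\<close>.\<close>

lemma pair_with_prefix_sum:
  "pair_with (kraw_poly A (Suc B)) (prefix_sum g) = - pair_with (kraw_poly A B) g"
proof -
  have "pair_with (kraw_poly A (Suc B)) (prefix_sum g) =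
      pair_with ([:1, -1:] * kraw_poly A B) (prefix_sum g)"
    by (simp add: kraw_poly_def algebra_simps)
  also have "\<dots> = pair_with (kraw_poly A B) (\<lambda>x. 1 * prefix_sum g x + (-1) * prefix_sum g (Suc x))"
    by (rule pair_with_linear)
  also have "\<dots> = pair_with (kraw_poly A B) (\<lambda>x. (-1) * g x)"
    by (simp add: prefix_sum_def)
  finally show ?thesis by (subst (asm) pair_with_fun_cmult) simp
qed

lemma pair_with_prefix_sum_funpow:
  "r \<le> B \<Longrightarrow> pair_with (kraw_poly A B) ((prefix_sum ^^ r) g) = (-1) ^ r * pair_with (kraw_poly A (B - r)) g"
proof (induction r arbitrary: B)
  case (Suc r)
  then obtain B' where B: "B = Suc B'" by (cases B) auto
  show ?case using Suc B by (simp add: pair_with_prefix_sum)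
qed simp

lemma pair_with_kraw_const_one:
  "pair_with (kraw_poly A B) (\<lambda>_. 1) = (if B = 0 then 2 ^ A else 0)"
proof -
  have *: "pair_with p (\<lambda>_. 1) = poly p 1" for p
    by (simp add: pair_with_def poly_altdef)
  show ?thesis by (simp add: * kraw_poly_def power_0_left)
qed

lemma pair_with_linear_power_fps:
  fixes z W :: "real fps"
  shows "pair_with ([:1, b:] ^ A * p) (\<lambda>x. fps_nth (z ^ x * W) j) =
    pair_with p (\<lambda>x. fps_nth (z ^ x * ((1 + fps_const b * z) ^ A * W)) j)"
proof (induction A arbitrary: W)
  case (Suc A)
  have "pair_with ([:1, b:] ^ Suc A * p) (\<lambda>x. fps_nth (z ^ x * W) j) =
    pair_with ([:1, b:] * ([:1, b:] ^ A * p)) (\<lambda>x. fps_nth (z ^ x * W) j)"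
    by (simp only: power_Suc mult.assoc)
  also have "\<dots> = pair_with ([:1, b:] ^ A * p) (\<lambda>x. fps_nth (z ^ x * ((1 + fps_const b * z) * W)) j)"
  proof -
    have "1 * fps_nth (z ^ x * W) j + b * fps_nth (z ^ Suc x * W) j =
        fps_nth (z ^ x * ((1 + fps_const b * z) * W)) j" for x
    proof -
      have "z ^ x * ((1 + fps_const b * z) * W) = z ^ x * W + fps_const b * (z ^ Suc x * W)"
        by (simp add: algebra_simps)
      then show ?thesis by simp
    qed
    then show ?thesis by (simp only: pair_with_linear)
  qed
  also have "\<dots> = pair_with p (\<lambda>x. fps_nth (z ^ x * ((1 + fps_const b * z) ^ A * ((1 + fps_const b * z) * W))) j)"
    by (rule Suc.IH)
  finally show ?case by (simp only: power_Suc2 mult.assoc)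
qed simp

text \<open>For a geometric sequence the pairing evaluates the polynomial at \<open>z\<close>. Here
  \<open>z\<close> is a power series and a coefficient is extracted afterwards, which replaces a
  contour integral by algebra.\<close>

lemma pair_with_kraw_fps:
  fixes z W :: "real fps"
  shows "pair_with (kraw_poly A B) (\<lambda>x. fps_nth (z ^ x * W) j) = fps_nth ((1 + z) ^ A * (1 - z) ^ B * W) j"
proof -
  have "pair_with ([:1, 1:] ^ A * ([:1, -1:] ^ B * 1)) (\<lambda>x. fps_nth (z ^ x * W) j) =
    fps_nth (z ^ 0 * ((1 + fps_const (-1) * z) ^ B * ((1 + fps_const 1 * z) ^ A * W))) j"
    by (simp only: pair_with_linear_power_fps pair_with_1)
  moreover have "fps_const (-1) = (-1 :: real fps)"
    by (metis fps_const_1_eq_1 fps_const_neg)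
  ultimately show ?thesis by (simp add: kraw_poly_def mult_ac)
qed

definition cayley :: "real fps" where
  "cayley = (1 - fps_X) * inverse (1 + fps_X)"

lemma inverse_one_plus_X: "inverse (1 + fps_X) * (1 + fps_X) = (1 :: real fps)"
  by (rule inverse_mult_eq_1) simp

lemma cayley_mult: "cayley * (1 + fps_X) = 1 - fps_X"
  by (simp add: cayley_def mult.assoc inverse_one_plus_X)

lemma one_plus_cayley: "1 + fps_const q * cayley =
    (fps_const (1 + q) + fps_const (1 - q) * fps_X) * inverse (1 + fps_X)"
proof -
  have "1 + fps_const q * cayley = (1 + fps_const q * cayley) * ((1 + fps_X) * inverse (1 + fps_X))"
    using inverse_one_plus_X by (simp add: mult.commute)
  also have "\<dots> = ((1 + fps_X) + fps_const q * (cayley * (1 + fps_X))) * inverse (1 + fps_X)"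
    by (simp add: algebra_simps)
  also have "(1 + fps_X) + fps_const q * (cayley * (1 + fps_X)) =
      (1 + fps_const q) + (1 - fps_const q) * fps_X"
    unfolding cayley_mult by (simp add: algebra_simps)
  also have "\<dots> = fps_const (1 + q) + fps_const (1 - q) * fps_X"
    by (simp flip: fps_const_add fps_const_sub)
  finally show ?thesis .
qed

lemma one_minus_cayley: "1 - fps_const q * cayley =
    (fps_const (1 - q) + fps_const (1 + q) * fps_X) * inverse (1 + fps_X)"
  using one_plus_cayley[of "-q"] by (simp flip: fps_const_neg)

text \<open>The dual functions are \<open>x \<mapsto> \<integral> z\<^bsup>x\<^esup> 2 z (1 + z)\<^bsup>-m\<^esup> (1 - z\<^sup>2)\<^bsup>-j-1\<^esup> dz\<close> around \<open>z = 1\<close>, up to a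
  constant. With this weight the pairing with \<open>kraw_poly (m + i) i\<close> becomes the residue of
  \<open>w\<^bsup>i-j-1\<^esup>\<close> for \<open>w = 1 - z\<^sup>2\<close>. The substitution \<open>z = (1 - t) / (1 + t)\<close> moves the pole to \<open>t = 0\<close>.\<close>

definition dual_fps :: "nat \<Rightarrow> nat \<Rightarrow> real fps" where
  "dual_fps m j = fps_const (1 / 2 ^ (m + 2 * j)) * (cayley * (1 + fps_X) ^ (m + 2 * j))"

definition dual_fn :: "nat \<Rightarrow> nat \<Rightarrow> nat \<Rightarrow> real" where
  "dual_fn m j x = fps_nth (cayley ^ x * dual_fps m j) j"

lemma power_inverse_cancel:
  assumes "a \<le> b"
  shows "inverse (1 + fps_X) ^ a * (1 + fps_X) ^ b = (1 + fps_X :: real fps) ^ (b - a)"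
proof -
  have "(1 + fps_X :: real fps) ^ b = (1 + fps_X) ^ a * (1 + fps_X) ^ (b - a)"
    using assms by (simp flip: power_add)
  moreover have "inverse (1 + fps_X) ^ a * (1 + fps_X) ^ a = (1 :: real fps)"
    by (simp only: inverse_one_plus_X power_one power_mult_distrib[symmetric])
  ultimately show ?thesis by (simp only: mult.assoc[symmetric] mult_1)
qed

lemma nth_one_plus_X_power: "fps_nth ((1 + fps_X) ^ N) i = real (N choose i)"
  by (simp add: fps_binomial_of_nat[symmetric] binomial_gbinomial)

text \<open>Under the substitution, \<open>1 + z\<close> and \<open>1 - z\<close> become
  \<open>2 / (1 + t)\<close> and \<open>2 t / (1 + t)\<close>. The functional thus contributes
  \<open>t^i\<close> and cancels \<open>m + 2 i\<close> of the factors \<open>1 + t\<close> in the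
  dual function. For \<open>j < i\<close> nothing is left in degree \<open>j\<close>; for
  \<open>j = i + d\<close> with \<open>d > 0\<close> there remains, up to a constant, the
  coefficient of degree \<open>d\<close> in \<open>(1 - t) (1 + t)^(2 d - 1)\<close>.\<close>

lemma pair_with_dual_fn:
  "pair_with (kraw_poly (m + i) i) (dual_fn m j) = (if i = j then 1 else 0)"
proof -
  let ?I = "inverse (1 + fps_X) :: real fps"
  have p: "1 + cayley = fps_const 2 * ?I" using one_plus_cayley[of 1] by simp
  have n: "1 - cayley = fps_const 2 * fps_X * ?I" using one_minus_cayley[of 1] by simp
  have prod: "(1 + cayley) ^ (m + i) * (1 - cayley) ^ i = fps_X ^ i * (fps_const (2 ^ (m + 2 * i)) * ?I ^ (m + 2 * i))"
  proof -
    have "(1 + cayley) ^ (m + i) * (1 - cayley) ^ i =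
        fps_const 2 ^ (m + i) * ?I ^ (m + i) * (fps_const 2 ^ i * fps_X ^ i * ?I ^ i)"
      unfolding p n by (simp only: power_mult_distrib)
    also have "\<dots> = fps_X ^ i * (fps_const 2 ^ (m + i + i) * ?I ^ (m + i + i))"
      by (simp only: power_add mult_ac)
    also have "m + i + i = m + 2 * i" by simp
    finally show ?thesis by (simp only: fps_const_power)
  qed
  have "pair_with (kraw_poly (m + i) i) (dual_fn m j) =
    fps_nth (fps_X ^ i * (fps_const (2 ^ (m + 2 * i)) * ?I ^ (m + 2 * i) * dual_fps m j)) j"
    unfolding dual_fn_def pair_with_kraw_fps prod by (simp add: mult.assoc)
  also have "\<dots> = (if i = j then 1 else 0)"
  proof (cases "j < i")
    case True
    then show ?thesis by (simp add: fps_X_power_mult_nth)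
  next
    case False
    define d where "d = j - i"
    have "fps_const (2 ^ (m + 2 * i)) * ?I ^ (m + 2 * i) * dual_fps m j =
        fps_const (2 ^ (m + 2 * i) / 2 ^ (m + 2 * j)) * (cayley * (?I ^ (m + 2 * i) * (1 + fps_X) ^ (m + 2 * j)))"
      by (simp add: dual_fps_def algebra_simps flip: fps_const_mult)
    also have "?I ^ (m + 2 * i) * (1 + fps_X) ^ (m + 2 * j) = (1 + fps_X) ^ (2 * d)"
      using False by (subst power_inverse_cancel) (auto simp: d_def algebra_simps)
    finally have e: "fps_nth (fps_X ^ i * (fps_const (2 ^ (m + 2 * i)) * ?I ^ (m + 2 * i) * dual_fps m j)) j =
        2 ^ (m + 2 * i) / 2 ^ (m + 2 * j) * fps_nth (cayley * (1 + fps_X) ^ (2 * d)) d"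
      using False by (simp add: fps_X_power_mult_nth d_def)
    show ?thesis
    proof (cases "d = 0")
      case True
      then have "i = j" using False by (simp add: d_def)
      then show ?thesis using e True by (simp add: cayley_def)
    next
      case d: False
      then obtain d' where d': "d = Suc d'" by (cases d) auto
      have "cayley * (1 + fps_X) ^ (2 * d) = (cayley * (1 + fps_X)) * (1 + fps_X) ^ (2 * d' + 1)"
        unfolding d' by (simp add: algebra_simps)
      also have "\<dots> = (1 + fps_X) ^ (2 * d' + 1) - fps_X * (1 + fps_X) ^ (2 * d' + 1)"
        by (simp only: cayley_mult left_diff_distrib mult_1)
      also have "fps_nth \<dots> d = real ((2 * d' + 1) choose Suc d') - real ((2 * d' + 1) choose d')"
        unfolding d' by (simp add: nth_one_plus_X_power del: power_Suc)
      \<comment> \<open>These are the two middle binomial coefficients of the odd number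
        \<open>2 d' + 1\<close>.\<close>
      also have "\<dots> = 0"
        using binomial_symmetric[of d' "2 * d' + 1"] by simp
      finally show ?thesis using e d False by (auto simp: d_def)
    qed
  qed
  finally show ?thesis .
qed

text \<open>The weight \<open>q ^ x\<close> replaces \<open>z\<close> by \<open>q z\<close>. As
  \<open>q\<close> is itself of the Cayley form, the factors become
  \<open>1 + q z = c (1 + a t) / (1 + t)\<close> and \<open>1 - q z = c (a + t) / (1 + t)\<close>
  with \<open>c = 2 / (1 + a)\<close>, and these powers of \<open>1 + t\<close> cancel against the
  dual function.\<close>

lemma pair_with_weighted_dual_fn:
  assumes "1 + a \<noteq> 0" "q = (1 - a) / (1 + a)"
  shows "pair_with (kraw_poly (m + j) j) (\<lambda>x. q ^ x * dual_fn m j x) =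
    fps_nth ((1 + fps_const a * fps_X) ^ (m + j) * (fps_const a + fps_X) ^ j * cayley) j / (1 + a) ^ (m + 2 * j)"
proof -
  let ?I = "inverse (1 + fps_X) :: real fps"
  define c where "c = 2 / (1 + a)"
  have q: "1 + q = c" "1 - q = c * a" using assms by (auto simp: c_def field_simps)
  have p: "1 + fps_const q * cayley = fps_const c * (1 + fps_const a * fps_X) * ?I"
    unfolding one_plus_cayley q by (simp add: algebra_simps)
  have n: "1 - fps_const q * cayley = fps_const c * (fps_const a + fps_X) * ?I"
    unfolding one_minus_cayley q by (simp add: algebra_simps)
  have "(\<lambda>x. q ^ x * dual_fn m j x) = (\<lambda>x. fps_nth ((fps_const q * cayley) ^ x * dual_fps m j) j)"
    unfolding dual_fn_def by (simp add: power_mult_distrib fps_const_power mult.assoc)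
  then have "pair_with (kraw_poly (m + j) j) (\<lambda>x. q ^ x * dual_fn m j x) =
    fps_nth ((1 + fps_const q * cayley) ^ (m + j) * (1 - fps_const q * cayley) ^ j * dual_fps m j) j"
    by (simp only: pair_with_kraw_fps)
  also have "(1 + fps_const q * cayley) ^ (m + j) * (1 - fps_const q * cayley) ^ j * dual_fps m j =
     fps_const c ^ (m + 2 * j) * fps_const (1 / 2 ^ (m + 2 * j)) * ((1 + fps_const a * fps_X) ^ (m + j) * (fps_const a + fps_X) ^ j * cayley *
      (?I ^ (m + 2 * j) * (1 + fps_X) ^ (m + 2 * j)))"
  proof -
    have e: "m + 2 * j = m + j + j" by simp
    show ?thesis
      unfolding p n dual_fps_def e by (simp only: power_mult_distrib power_add mult_ac)
  qed
  also have "?I ^ (m + 2 * j) * (1 + fps_X) ^ (m + 2 * j) = 1"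
    by (subst power_inverse_cancel) auto
  also have "fps_const c ^ (m + 2 * j) * fps_const (1 / 2 ^ (m + 2 * j)) = fps_const (1 / (1 + a) ^ (m + 2 * j))"
    by (simp add: c_def fps_const_power power_divide)
  finally show ?thesis by simp
qed

definition even_fps :: "real fps" where
  "even_fps = Abs_fps (\<lambda>i. if even i then 1 else 0)"

lemma even_fps_mult: "even_fps * (1 - fps_X ^ 2) = 1"
proof (rule fps_ext)
  fix i
  show "fps_nth (even_fps * (1 - fps_X ^ 2)) i = fps_nth 1 i"
    by (cases "i < 2")
      (auto simp: even_fps_def right_diff_distrib fps_X_power_mult_right_nth less_2_cases_iff)
qed

lemma cayley_eq: "cayley = (1 - fps_X) ^ 2 * even_fps"
proof -
  have "(1 - fps_X) ^ 2 * even_fps * (1 + fps_X) = (1 - fps_X) * (even_fps * (1 - fps_X ^ 2))"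
    by (simp add: algebra_simps power2_eq_square)
  also have "\<dots> = cayley * (1 + fps_X)" by (simp add: even_fps_mult cayley_mult)
  finally have "(1 - fps_X) ^ 2 * even_fps * ((1 + fps_X) * inverse (1 + fps_X)) = cayley * ((1 + fps_X) * inverse (1 + fps_X))"
    by (simp only: mult.assoc[symmetric])
  moreover have "(1 + fps_X) * inverse (1 + fps_X) = (1 :: real fps)"
    using inverse_one_plus_X by (simp only: mult.commute)
  ultimately show ?thesis by (simp only: mult_1_right)
qed

text \<open>Dividing by \<open>1 - t\<^sup>2\<close> turns the sum of the pairings over \<open>j < k\<close> into a telescoping one.\<close>

definition level_sum :: "real \<Rightarrow> nat \<Rightarrow> nat \<Rightarrow> real" where
  "level_sum a m k = fps_nth (fps_X * ((1 + fps_const a * fps_X) ^ (m + k) * (fps_const a + fps_X) ^ k * even_fps)) k"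

text \<open>With \<open>cayley\<close> written as \<open>(1 - t)^2 / (1 - t^2)\<close>, the identity
  \<open>(1 + a t) (a + t) - (1 + a)^2 t = a (1 - t)^2\<close> splits each term into two consecutive
  values of \<open>level_sum\<close>.\<close>

lemma level_sum_step:
  "a * fps_nth ((1 + fps_const a * fps_X) ^ (m + j) * (fps_const a + fps_X) ^ j * cayley) j =
   level_sum a m (Suc j) - (1 + a)\<^sup>2 * level_sum a m j"
proof -
  let ?E = "(1 + fps_const a * fps_X) ^ (m + j) * (fps_const a + fps_X) ^ j * even_fps"
  have quad: "(1 + fps_const a * fps_X) * (fps_const a + fps_X) - fps_const ((1 + a)\<^sup>2) * fps_X =
      fps_const a * (1 - fps_X) ^ 2"
    by (simp add: power2_eq_square algebra_simps flip: fps_const_add fps_const_mult)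
  have "fps_const a * ((1 + fps_const a * fps_X) ^ (m + j) * (fps_const a + fps_X) ^ j * cayley) =
     ?E * (fps_const a * (1 - fps_X) ^ 2)"
    unfolding cayley_eq by (simp only: mult_ac)
  also have "\<dots> = (1 + fps_const a * fps_X) * (fps_const a + fps_X) * ?E - fps_const ((1 + a)\<^sup>2) * (fps_X * ?E)"
    unfolding quad[symmetric] by (simp add: algebra_simps)
  finally have *: "fps_const a * ((1 + fps_const a * fps_X) ^ (m + j) * (fps_const a + fps_X) ^ j * cayley) = \<dots>" .
  have "level_sum a m (Suc j) = fps_nth ((1 + fps_const a * fps_X) * (fps_const a + fps_X) * ?E) j"
    by (simp add: level_sum_def mult_ac)
  then show ?thesis
    using arg_cong[OF *, of "\<lambda>f. fps_nth f j"] by (simp add: level_sum_def)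
qed

text \<open>After division of step \<open>j\<close> by \<open>(1 + a)^(m + 2 j)\<close>,
  \<open>level_sum_step\<close> telescopes. For \<open>m = n - k + 1\<close> the exponent
  \<open>m + 2 k - 2\<close> is \<open>n + k - 1\<close>, the power that clears the denominators of
  \<open>q ^ x\<close> over the columns of row \<open>k\<close>.\<close>

lemma sum_weighted_dual:
  assumes "a \<noteq> 0" "1 + a \<noteq> 0" "q = (1 - a) / (1 + a)" "k \<ge> 1" "m \<ge> 1"
  shows "(1 + a) ^ (m + 2 * k - 2) * (\<Sum>j<k. pair_with (kraw_poly (m + j) j) (\<lambda>x. q ^ x * dual_fn m j x)) =
     level_sum a m k / a"
proof -
  have "(1 + a) ^ (m + 2 * k) * (\<Sum>j<k. pair_with (kraw_poly (m + j) j) (\<lambda>x. q ^ x * dual_fn m j x)) =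
     (1 + a)\<^sup>2 * level_sum a m k / a" for k
  proof (induction k)
    case 0 then show ?case by (simp add: level_sum_def)
  next
    case (Suc k)
    let ?T = "\<lambda>j. pair_with (kraw_poly (m + j) j) (\<lambda>x. q ^ x * dual_fn m j x)"
    have e: "(1 + a) ^ (m + 2 * Suc k) = (1 + a)\<^sup>2 * (1 + a) ^ (m + 2 * k)"
      by (simp add: power2_eq_square)
    have "(1 + a) ^ (m + 2 * k) * ?T k =
       fps_nth ((1 + fps_const a * fps_X) ^ (m + k) * (fps_const a + fps_X) ^ k * cayley) k"
      using pair_with_weighted_dual_fn[OF assms(2,3), of m k] assms(2) by simp
    also have "\<dots> = (level_sum a m (Suc k) - (1 + a)\<^sup>2 * level_sum a m k) / a"
      using level_sum_step[of a m k] assms(1) by (simp add: field_simps)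
    finally have t: "(1 + a) ^ (m + 2 * k) * ?T k = (level_sum a m (Suc k) - (1 + a)\<^sup>2 * level_sum a m k) / a" .
    have "(1 + a) ^ (m + 2 * Suc k) * (\<Sum>j<Suc k. ?T j) =
       (1 + a)\<^sup>2 * ((1 + a) ^ (m + 2 * k) * (\<Sum>j<k. ?T j) + (1 + a) ^ (m + 2 * k) * ?T k)"
      unfolding e by (simp add: algebra_simps)
    also have "\<dots> = (1 + a)\<^sup>2 * level_sum a m (Suc k) / a"
      unfolding Suc.IH t using assms(1) by (simp add: field_simps)
    finally show ?case .
  qed
  from this[of k] have *: "(1 + a) ^ (m + 2 * k) * (\<Sum>j<k. pair_with (kraw_poly (m + j) j) (\<lambda>x. q ^ x * dual_fn m j x)) =
     (1 + a)\<^sup>2 * level_sum a m k / a" .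
  have "(1 + a) ^ (m + 2 * k) = (1 + a)\<^sup>2 * (1 + a) ^ (m + 2 * k - 2)"
  proof -
    have "m + 2 * k = 2 + (m + 2 * k - 2)" using assms(4) by simp
    then show ?thesis by (metis power_add)
  qed
  with * have "(1 + a)\<^sup>2 * ((1 + a) ^ (m + 2 * k - 2) * (\<Sum>j<k. pair_with (kraw_poly (m + j) j) (\<lambda>x. q ^ x * dual_fn m j x))) =
     (1 + a)\<^sup>2 * (level_sum a m k / a)" by simp
  then show ?thesis by (simp only: mult_left_cancel[OF power_not_zero[OF assms(2), of 2]])
qed

lemma level_sum_eq:
  "level_sum a m k = (\<Sum>c\<le>k. \<Sum>b\<le>m + k. if b < c \<and> odd (c - b)
     then real (k choose c) * real ((m + k) choose b) * a ^ (b + c) else 0)"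
proof -
  have e1: "(1 + fps_const a * fps_X) ^ (m + k) = (\<Sum>b\<le>m + k. fps_const (real ((m + k) choose b) * a ^ b) * fps_X ^ b)"
    by (subst add.commute, subst binomial_ring)
       (simp add: power_mult_distrib fps_const_power mult.assoc flip: fps_of_nat fps_const_mult)
  have e2: "(fps_const a + fps_X) ^ k = (\<Sum>c\<le>k. fps_const (real (k choose c) * a ^ c) * fps_X ^ (k - c))"
    by (subst binomial_ring) (simp add: fps_const_power mult.assoc flip: fps_of_nat fps_const_mult)
  have "fps_X * ((1 + fps_const a * fps_X) ^ (m + k) * (fps_const a + fps_X) ^ k * even_fps) =
    (\<Sum>c\<le>k. \<Sum>b\<le>m + k. fps_const (real (k choose c) * real ((m + k) choose b) * a ^ (b + c)) * (fps_X ^ (Suc b + (k - c)) * even_fps))"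
  proof -
    have "fps_X * ((1 + fps_const a * fps_X) ^ (m + k) * (fps_const a + fps_X) ^ k * even_fps) =
      (\<Sum>b\<le>m + k. \<Sum>c\<le>k. fps_X * ((fps_const (real ((m + k) choose b) * a ^ b) * fps_X ^ b) *
        (fps_const (real (k choose c) * a ^ c) * fps_X ^ (k - c)) * even_fps))"
      unfolding e1 e2 sum_product by (simp only: sum_distrib_left sum_distrib_right)
    also have "\<dots> = (\<Sum>b\<le>m + k. \<Sum>c\<le>k. fps_const (real (k choose c) * real ((m + k) choose b) * a ^ (b + c)) *
        (fps_X ^ (Suc b + (k - c)) * even_fps))"
      by (intro sum.cong refl) (simp only: power_add power_Suc fps_const_mult[symmetric] mult_ac add_Suc)
    finally show ?thesis by (subst sum.swap)
  qed
  then have "level_sum a m k = (\<Sum>c\<le>k. \<Sum>b\<le>m + k. real (k choose c) * real ((m + k) choose b) * a ^ (b + c) *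
     fps_nth (fps_X ^ (Suc b + (k - c)) * even_fps) k)"
    unfolding level_sum_def by (simp only: fps_sum_nth fps_mult_left_const_nth)
  also have "\<dots> = (\<Sum>c\<le>k. \<Sum>b\<le>m + k. if b < c \<and> odd (c - b)
     then real (k choose c) * real ((m + k) choose b) * a ^ (b + c) else 0)"
  proof (intro sum.cong refl)
    fix c b assume c: "c \<in> {..k}"
    \<comment> \<open>The remaining exponent is \<open>c - b - 1\<close>, and
      \<open>even_fps\<close>, which is \<open>1 / (1 - t^2)\<close>, has coefficient 1 exactly at
      the even exponents.\<close>
    have "fps_nth (fps_X ^ (Suc b + (k - c)) * even_fps) k = (if b < c \<and> odd (c - b) then 1 else 0)"
    proof (cases "b < c")
      case True
      then obtain e where e: "c = Suc (b + e)" using less_iff_Suc_add by auto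
      then have "k - (Suc b + (k - c)) = e" using c by auto
      then show ?thesis using c e by (auto simp: fps_X_power_mult_nth even_fps_def simp del: power_Suc)
    next
      case False
      then show ?thesis using c by (auto simp: fps_X_power_mult_nth simp del: power_Suc)
    qed
    then show "real (k choose c) * real ((m + k) choose b) * a ^ (b + c) * fps_nth (fps_X ^ (Suc b + (k - c)) * even_fps) k =
      (if b < c \<and> odd (c - b) then real (k choose c) * real ((m + k) choose b) * a ^ (b + c) else 0)"
      by simp
  qed
  finally show ?thesis .
qed

section \<open>The weight generating function of a level\<close>

lemma pair_with_monom: "pair_with (monom c e) g = c * g e"
proof -
  have "pair_with (monom c e) g = (\<Sum>x\<le>e. coeff (monom c e) x * g x)"
    by (rule pair_with_bound) (rule degree_monom_le)
  also have "\<dots> = (\<Sum>x\<le>e. if x = e then c * g e else 0)"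
    by (intro sum.cong) auto
  finally show ?thesis by simp
qed

text \<open>The product is \<open>(1 + u) (1 - u^2)^j\<close>, in which powers of \<open>u\<close>
  occur only in pairs \<open>u^(2 r) + u^(2 r + 1)\<close>: the pairs of columns of the bottom
  row.\<close>

lemma kraw_poly_pairs:
  "kraw_poly (Suc j) j = (\<Sum>r\<le>j. [:1, 1:] * monom (real (j choose r) * (-1) ^ r) (2 * r))"
proof -
  have e: "[:1, 1:] * [:1, -1:] = monom (-1) 2 + (1 :: real poly)"
    by (rule poly_eqI) (auto simp: coeff_pCons split: nat.split)
  have "kraw_poly (Suc j) j = [:1, 1:] * ([:1, 1:] * [:1, -1:]) ^ j"
    by (simp only: kraw_poly_def power_Suc power_mult_distrib mult.assoc)
  also have "\<dots> = [:1, 1:] * (\<Sum>r\<le>j. of_nat (j choose r) * monom (-1) 2 ^ r * 1 ^ (j - r))"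
    unfolding e by (subst binomial_ring) simp
  also have "\<dots> = (\<Sum>r\<le>j. [:1, 1:] * monom (real (j choose r) * (-1) ^ r) (2 * r))"
    unfolding sum_distrib_left
    by (intro sum.cong refl arg_cong2[where f="(*)"])
       (simp add: monom_power of_nat_poly smult_monom mult.commute)
  finally show ?thesis .
qed

lemma pair_with_kraw_pairs:
  "pair_with (kraw_poly (Suc j) j) g = (\<Sum>r\<le>j. real (j choose r) * (-1) ^ r * (g (2 * r) + g (2 * r + 1)))"
  unfolding kraw_poly_pairs
  by (subst pair_with_sum) (simp_all only: finite_atMost pair_with_linear pair_with_monom mult_1 Suc_eq_plus1)

definition pairs_matrix :: "nat \<Rightarrow> nat \<Rightarrow> real" where
  "pairs_matrix r j = real (j choose r) * (-1) ^ r"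

lemma dtm_pairs_matrix: "dtm n pairs_matrix \<noteq> 0"
  by (subst dtm_upper_triangular) (auto simp: pairs_matrix_def binomial_eq_0)

text \<open>The upper triangular \<open>pairs_matrix\<close> is the column operation from sums over
  single bottom pairs to pairings with \<open>kraw_poly\<close>. Its determinant is nonzero and
  cancels later.\<close>

lemma dtm_pairs_eq:
  "dtm n (\<lambda>i j. f i (2 * j) + f i (2 * j + 1)) * dtm n pairs_matrix =
   dtm n (\<lambda>i j. pair_with (kraw_poly (Suc j) j) (f i))"
  unfolding dtm_mult
proof (rule dtm_cong)
  fix i j assume j: "j < n"
  have "(\<Sum>r<n. (f i (2 * r) + f i (2 * r + 1)) * pairs_matrix r j) =
      (\<Sum>r\<le>j. (f i (2 * r) + f i (2 * r + 1)) * pairs_matrix r j)"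
    using j by (intro sum.mono_neutral_right) (auto simp: pairs_matrix_def binomial_eq_0)
  then show "(\<Sum>r<n. (f i (2 * r) + f i (2 * r + 1)) * pairs_matrix r j) = pair_with (kraw_poly (Suc j) j) (f i)"
    by (simp add: pair_with_kraw_pairs pairs_matrix_def mult.commute)
qed

lemma sum_rows_eq: "sum_rows i x = real (x choose i)"
proof (induction i arbitrary: x)
  case 0 then show ?case by (simp add: sum_rows_def)
next
  case (Suc i)
  have "sum_rows (Suc i) x = (\<Sum>y<x. sum_rows i y)" by (simp add: sum_rows_def prefix_sum_def)
  also have "\<dots> = (\<Sum>y<x. real (y choose i))" by (simp add: Suc)
  also have "\<dots> = real (x choose Suc i)" by (induction x) auto
  finally show ?case .
qed

text \<open>The constant term of \<open>cayley\<close> is 1, so its powers expand binomially in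
  \<open>cayley - 1\<close>, a multiple of \<open>t\<close>; the terms with \<open>l > j\<close> do
  not reach degree \<open>j\<close>. Hence \<open>dual_fn m j\<close> is a polynomial of degree at
  most \<open>j\<close> in \<open>x\<close>.\<close>

lemma dual_fn_expansion:
  assumes "j < k"
  shows "dual_fn m j x = (\<Sum>l<k. fps_nth ((cayley - 1) ^ l * dual_fps m j) j * sum_rows l x)"
proof -
  have s: "cayley - 1 = fps_X * (fps_const (-2) * inverse (1 + fps_X))"
    using one_minus_cayley[of 1] by (simp add: algebra_simps flip: fps_const_neg)
  have z: "fps_nth ((cayley - 1) ^ l * dual_fps m j) j = 0" if "l > j" for l
    unfolding s power_mult_distrib using that by (simp add: mult.assoc fps_X_power_mult_nth)
  have "cayley ^ x = ((cayley - 1) + 1) ^ x" by simp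
  also have "\<dots> = (\<Sum>l\<le>x. fps_const (real (x choose l)) * (cayley - 1) ^ l)"
    by (subst binomial_ring) (simp add: fps_of_nat)
  finally have "dual_fn m j x = (\<Sum>l\<le>x. real (x choose l) * fps_nth ((cayley - 1) ^ l * dual_fps m j) j)"
    by (simp add: dual_fn_def sum_distrib_right fps_sum_nth mult.assoc)
  also have "\<dots> = (\<Sum>l\<le>max x k. real (x choose l) * fps_nth ((cayley - 1) ^ l * dual_fps m j) j)"
    by (rule sum.mono_neutral_left) (auto simp: binomial_eq_0)
  also have "\<dots> = (\<Sum>l<k. real (x choose l) * fps_nth ((cayley - 1) ^ l * dual_fps m j) j)"
    using assms by (intro sum.mono_neutral_right) (auto simp: z)
  finally show ?thesis by (simp add: sum_rows_eq mult.commute)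
qed

text \<open>The change of rows is triangular with diagonal entries
  \<open>(-2)^j / 2^(m + 2 j)\<close>. The factor is kept abstract since it cancels in the
  normalised sums.\<close>

lemma config_det_sum_rows:
  obtains \<kappa> where "\<kappa> \<noteq> 0" "\<And>B. config_det k sum_rows B = \<kappa> * config_det k (dual_fn m) B"
proof -
  define T where "T j l = fps_nth ((cayley - 1) ^ l * dual_fps m j) j" for j l
  have s: "cayley - 1 = fps_X * (fps_const (-2) * inverse (1 + fps_X))"
    using one_minus_cayley[of 1] by (simp add: algebra_simps flip: fps_const_neg)
  have up: "T j l = 0" if "l > j" for j l
    unfolding T_def s power_mult_distrib using that by (simp add: mult.assoc fps_X_power_mult_nth)
  have diag: "T j j = (-2) ^ j / 2 ^ (m + 2 * j)" for j
    unfolding T_def s power_mult_distrib dual_fps_def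
    by (simp add: mult.assoc fps_X_power_mult_nth fps_power_zeroth fps_const_power cayley_def)
  have "dtm k T = (\<Prod>j<k. T j j)" by (rule dtm_lower_triangular) (use up in auto)
  then have nz: "dtm k T \<noteq> 0" by (simp add: diag)
  have "config_det k (dual_fn m) B = dtm k T * config_det k sum_rows B" for B
    unfolding config_det_def dtm_mult T_def by (rule dtm_cong) (rule dual_fn_expansion)
  then show thesis using nz by (intro that[of "1 / dtm k T"]) auto
qed

text \<open>Pushing down to the bottom row makes the matrix \<open>Q\<close> lower triangular: its
  first \<open>r\<close> rows come from the rows of ones, the others pair the dual functions with
  their functionals. A weight in row \<open>c\<close> changes only row \<open>r + c\<close>, where
  the new diagonal entry is the weighted pairing; all other constants cancel against the unweighted
  count \<open>N\<close>.\<close>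

lemma sum_base_patterns:
  assumes "1 \<le> k" "k \<le> n"
  defines "m \<equiv> n - k + 1"
  defines "N \<equiv> real (\<Sum>A\<in>base_configs n. card (patterns n A))"
  shows "N \<noteq> 0"
    and "(\<Sum>A\<in>base_configs n. \<Sum>X\<in>patterns n A. \<Sum>x\<in>X k. w x) =
      N * (\<Sum>c<k. pair_with (kraw_poly (m + c) c) (\<lambda>x. w x * dual_fn m c x))"
proof -
  define r where "r = n - k"
  have n: "n = k + r" "m = Suc r" using assms by (auto simp: r_def)
  obtain \<kappa> where \<kappa>: "\<kappa> \<noteq> 0" "\<And>B. config_det k sum_rows B = \<kappa> * config_det k (dual_fn m) B"
    using config_det_sum_rows[of k m] by blast
  define Q where "Q g i j = pair_with (kraw_poly (Suc j) j) ((push_rows ^^ r) g i)" for g i j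
  let ?D = "dtm n pairs_matrix"
  have Dnz: "?D \<noteq> 0" by (rule dtm_pairs_matrix)
  have base: "finite A" "card A = k + r" if "A \<in> base_configs n" for A
    using that n unfolding base_configs_eq transversals_def by auto
  have total: "(\<Sum>A\<in>base_configs n. \<Sum>X\<in>patterns n A. \<Phi> (X k)) * ?D = (\<Sum>c\<in>C. dtm n (Q (g c)))"
    if "\<And>B. finite B \<Longrightarrow> card B = k \<Longrightarrow> real (card (patterns k B)) * \<Phi> B = (\<Sum>c\<in>C. config_det k (g c) B)"
    for \<Phi> g and C :: "nat set"
  proof -
    have "(\<Sum>A\<in>base_configs n. \<Sum>X\<in>patterns n A. \<Phi> (X k)) =
      (\<Sum>A\<in>base_configs n. \<Sum>c\<in>C. config_det n ((push_rows ^^ r) (g c)) A)"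
      unfolding n(1) using base n(1) by (intro sum.cong refl sum_patterns_level that) auto
    also have "\<dots> = (\<Sum>c\<in>C. dtm n (\<lambda>i j. (push_rows ^^ r) (g c) i (2 * j) + (push_rows ^^ r) (g c) i (2 * j + 1)))"
      by (subst sum.swap) (simp only: sum_config_det_base)
    finally show ?thesis unfolding Q_def by (simp only: sum_distrib_right dtm_pairs_eq)
  qed
  \<comment> \<open>Each prefix sum removes one of the \<open>j\<close> factors
    \<open>1 - u\<close>, and a constant sequence is annihilated as long as one such factor is
    left.\<close>
  have Qlow: "Q g i j = (if i = j then (-1) ^ i * 2 ^ Suc i else 0)" if "i < r" "i \<le> j" for g i j
    using that by (simp add: Q_def push_rows_funpow pair_with_prefix_sum_funpow pair_with_kraw_const_one)
  have Qhigh: "Q g i j = (-1) ^ r * pair_with (kraw_poly (m + (j - r)) (j - r)) (g (i - r))"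
    if "r \<le> i" "r \<le> j" for g i j
    using that by (simp add: Q_def push_rows_funpow pair_with_prefix_sum_funpow n(2))
  let ?\<psi> = "dual_fn m"
  have Q0: "dtm n (Q ?\<psi>) \<noteq> 0"
  proof -
    have "dtm n (Q ?\<psi>) = (\<Prod>i<n. Q ?\<psi> i i)"
    proof (rule dtm_lower_triangular)
      fix i j assume "i < j" "j < n"
      then show "Q ?\<psi> i j = 0"
        using pair_with_dual_fn[of m "j - r" "i - r"] by (cases "i < r") (simp_all add: Qlow Qhigh)
    qed
    moreover have "Q ?\<psi> i i \<noteq> 0" for i
      using pair_with_dual_fn[of m "i - r" "i - r"] by (cases "i < r") (auto simp: Qlow Qhigh)
    ultimately show ?thesis by simp
  qed
  have weighted: "dtm n (Q (\<lambda>i x. if i = c then w x * ?\<psi> i x else ?\<psi> i x)) =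
      dtm n (Q ?\<psi>) * pair_with (kraw_poly (m + c) c) (\<lambda>x. w x * ?\<psi> c x)" (is "dtm n (Q ?g) = _")
    if "c < k" for c
  proof -
    have g_ne: "?g i = ?\<psi> i" if "i \<noteq> c" for i using that by auto
    have Q_ne: "Q ?g i j = Q ?\<psi> i j" if "i \<noteq> r + c" for i j
      using that by (cases "i < r") (auto simp: Q_def push_rows_funpow g_ne)
    \<comment> \<open>In the unweighted matrix, column \<open>r + c\<close> has only its diagonal
      entry: rows with index below \<open>r\<close> vanish there by triangularity, the others by
      biorthogonality.\<close>
    have col: "Q ?\<psi> i (r + c) = 0" if "i \<noteq> r + c" for i
      using that by (cases "i < r") (auto simp: Qlow Qhigh pair_with_dual_fn)
    have "dtm n (Q ?g) * Q ?\<psi> (r + c) (r + c) = dtm n (Q ?\<psi>) * Q ?g (r + c) (r + c)"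
      by (rule dtm_single_entry_column) (use that n Q_ne col in auto)
    then show ?thesis by (simp add: Qhigh pair_with_dual_fn)
  qed
  have NQ: "N * ?D = \<kappa> * dtm n (Q ?\<psi>)"
  proof -
    have "real (card (patterns k B)) * (1 / \<kappa>) = (\<Sum>c\<in>{0::nat}. config_det k ?\<psi> B)"
      if "finite B" "card B = k" for B
      using card_patterns[OF that] \<kappa> by simp
    from total[where \<Phi> = "\<lambda>_. 1 / \<kappa>" and C = "{0}" and g = "\<lambda>_. ?\<psi>", OF this]
    have "(\<Sum>A\<in>base_configs n. \<Sum>X\<in>patterns n A. 1 / \<kappa>) * ?D = dtm n (Q ?\<psi>)" by simp
    moreover have "(\<Sum>A\<in>base_configs n. \<Sum>X\<in>patterns n A. 1 / \<kappa>) = N / \<kappa>"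
      by (simp add: N_def sum_divide_distrib)
    ultimately have "N / \<kappa> * ?D = dtm n (Q ?\<psi>)" by simp
    then show ?thesis using \<kappa>(1) by (simp add: field_simps)
  qed
  then show "N \<noteq> 0" using Q0 \<kappa>(1) by auto
  have "real (card (patterns k B)) * ((\<Sum>x\<in>B. w x) / \<kappa>) =
      (\<Sum>c<k. config_det k (\<lambda>i x. if i = c then w x * ?\<psi> i x else ?\<psi> i x) B)"
    if B: "finite B" "card B = k" for B
  proof -
    have "(\<Sum>x\<in>B. w x) = (\<Sum>j<k. w (nth_elem B j))"
      using sum.reindex[OF nth_elem_inj[of B], of w] nth_elem_image[OF B(1)] B(2) by (simp add: o_def)
    then have "real (card (patterns k B)) * ((\<Sum>x\<in>B. w x) / \<kappa>) =
        (\<Sum>j<k. w (nth_elem B j)) * config_det k ?\<psi> B"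
      using card_patterns[OF B] \<kappa> by simp
    then show ?thesis
      unfolding config_det_def by (simp only: dtm_scaled_rows_eq_columns)
  qed
  from total[where \<Phi> = "\<lambda>B. (\<Sum>x\<in>B. w x) / \<kappa>" and C = "{..<k}", OF this]
  have "(\<Sum>A\<in>base_configs n. \<Sum>X\<in>patterns n A. (\<Sum>x\<in>X k. w x) / \<kappa>) * ?D =
    dtm n (Q ?\<psi>) * (\<Sum>c<k. pair_with (kraw_poly (m + c) c) (\<lambda>x. w x * ?\<psi> c x))"
    by (simp add: weighted sum_distrib_left)
  then have "(\<Sum>A\<in>base_configs n. \<Sum>X\<in>patterns n A. \<Sum>x\<in>X k. w x) * ?D =
    \<kappa> * dtm n (Q ?\<psi>) * (\<Sum>c<k. pair_with (kraw_poly (m + c) c) (\<lambda>x. w x * ?\<psi> c x))"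
    using \<kappa>(1) by (simp add: field_simps flip: sum_divide_distrib)
  also have "\<dots> = N * (\<Sum>c<k. pair_with (kraw_poly (m + c) c) (\<lambda>x. w x * ?\<psi> c x)) * ?D"
    using NQ by simp
  finally show "(\<Sum>A\<in>base_configs n. \<Sum>X\<in>patterns n A. \<Sum>x\<in>X k. w x) =
      N * (\<Sum>c<k. pair_with (kraw_poly (m + c) c) (\<lambda>x. w x * ?\<psi> c x))"
    using Dnz by simp
qed

text \<open>Every particle of row \<open>k\<close> lies strictly to the left of some particle of row
  \<open>k + 1\<close>, so the bound \<open>2 n - 1\<close> of the bottom row drops by one per row.
  It keeps the natural-number exponent \<open>n + k - 1 - x\<close> from being truncated.\<close>

lemma pattern_level_subset:
  assumes "A \<in> base_configs n" "X \<in> patterns n A" "1 \<le> k" "k \<le> n" "x \<in> X k"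
  shows "x \<le> n + k - 1"
  using assms(3-)
proof (induction "n - k" arbitrary: k x)
  case 0
  then have "x \<in> A" using assms(2) by (simp add: patterns_def)
  then show ?case using assms(1) 0 by (auto simp: base_configs_def)
next
  case (Suc d)
  have fin: "finite (X k)" "card (X k) = k" "finite (X (Suc k))" "card (X (Suc k)) = Suc k"
    and il: "interlaces (X (Suc k)) (X k)"
    using assms(2) Suc by (auto simp: patterns_def)
  obtain j where j: "j < k" "x = nth_elem (X k) j"
    using nth_elem_image[OF fin(1)] fin(2) Suc.prems(3) by auto
  then have "x < nth_elem (X (Suc k)) (Suc j)"
    using il interlaces_iff[OF fin(3,4,1,2)] by simp
  moreover have "nth_elem (X (Suc k)) (Suc j) \<in> X (Suc k)"
    using nth_elem_image[OF fin(3)] fin(4) j(1) by auto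
  then have "nth_elem (X (Suc k)) (Suc j) \<le> n + Suc k - 1"
    using Suc by (intro Suc.hyps(1)) auto
  ultimately show ?case using Suc by simp
qed

lemma sum_base_patterns_weighted:
  assumes "1 \<le> k" "k \<le> n" "a \<noteq> 0" "1 + a \<noteq> 0"
  shows "(\<Sum>A\<in>base_configs n. \<Sum>X\<in>patterns n A. \<Sum>x\<in>X k. (1 - a) ^ x * (1 + a) ^ (n + k - 1 - x)) =
    real (\<Sum>A\<in>base_configs n. card (patterns n A)) * (level_sum a (n - k + 1) k / a)"
proof -
  define m where "m = n - k + 1"
  define q where "q = (1 - a) / (1 + a)"
  have N: "n + k - 1 = m + 2 * k - 2" using assms by (simp add: m_def)
  have w: "(1 - a) ^ x * (1 + a) ^ (n + k - 1 - x) = (1 + a) ^ (n + k - 1) * q ^ x" if "x \<le> n + k - 1" for x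
  proof -
    have "(1 + a) ^ (n + k - 1) = (1 + a) ^ x * (1 + a) ^ (n + k - 1 - x)"
      using that by (metis le_add_diff_inverse power_add)
    then show ?thesis using assms(4) by (simp add: q_def power_divide)
  qed
  have "(\<Sum>A\<in>base_configs n. \<Sum>X\<in>patterns n A. \<Sum>x\<in>X k. (1 - a) ^ x * (1 + a) ^ (n + k - 1 - x)) =
     (\<Sum>A\<in>base_configs n. \<Sum>X\<in>patterns n A. \<Sum>x\<in>X k. (1 + a) ^ (n + k - 1) * q ^ x)"
    by (intro sum.cong refl w pattern_level_subset) (use assms in auto)
  also have "\<dots> = (1 + a) ^ (n + k - 1) * (\<Sum>A\<in>base_configs n. \<Sum>X\<in>patterns n A. \<Sum>x\<in>X k. q ^ x)"
    by (simp only: sum_distrib_left)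
  also have "\<dots> = real (\<Sum>A\<in>base_configs n. card (patterns n A)) *
      ((1 + a) ^ (m + 2 * k - 2) * (\<Sum>c<k. pair_with (kraw_poly (m + c) c) (\<lambda>x. q ^ x * dual_fn m c x)))"
    unfolding sum_base_patterns(2)[OF assms(1,2)] N m_def by simp
  also have "(1 + a) ^ (m + 2 * k - 2) * (\<Sum>c<k. pair_with (kraw_poly (m + c) c) (\<lambda>x. q ^ x * dual_fn m c x)) = level_sum a m k / a"
    by (rule sum_weighted_dual) (use assms in \<open>auto simp: q_def m_def\<close>)
  finally show ?thesis by (simp add: m_def)
qed

section \<open>The lattice and its dual\<close>

text \<open>Oblique coordinates, in which lattice points are integral, triangle centres are thirds
  and the sides of the region are lines with integral coefficients.\<close>

definition pt :: "real \<Rightarrow> real \<Rightarrow> plane" where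
  "pt s t = s *\<^sub>R vec_v + t *\<^sub>R vec_w"

lemma pt_eq: "pt s t = (s + t / 2, t * sqrt 3 / 2)"
  by (simp add: pt_def vec_v_def vec_w_def)

lemma pt_inject [simp]: "pt s t = pt s' t' \<longleftrightarrow> s = s' \<and> t = t'"
  by (auto simp: pt_eq)

lemma pt_add: "pt s t + pt s' t' = pt (s + s') (t + t')"
  and pt_diff: "pt s t - pt s' t' = pt (s - s') (t - t')"
  and pt_scale: "c *\<^sub>R pt s t = pt (c * s) (c * t)"
  by (auto simp: pt_eq field_simps)

lemma dist_pt: "(dist (pt s t) (pt s' t'))\<^sup>2 = (s - s')\<^sup>2 + (s - s') * (t - t') + (t - t')\<^sup>2"
proof -
  have "(t * sqrt 3 / 2 - t' * sqrt 3 / 2)\<^sup>2 = (t - t')\<^sup>2 * (sqrt 3)\<^sup>2 / 4"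
    by (simp add: power2_eq_square field_simps)
  then show ?thesis
    by (simp add: pt_eq dist_Pair_Pair dist_real_def) (simp add: power2_eq_square field_simps)
qed

lemma lattice_vertices_eq: "lattice_vertices = {pt (of_int a) (of_int b) |a b. True}"
  by (auto simp: lattice_vertices_def pt_def)

text \<open>The six units of the Eisenstein integers: completing the square in either variable
  bounds both coordinates by 1 in absolute value.\<close>

lemma eisenstein_norm_eq_1:
  fixes c d :: int
  assumes "c\<^sup>2 + c * d + d\<^sup>2 = 1"
  shows "(c, d) \<in> {(1, 0), (0, 1), (-1, 1), (-1, 0), (0, -1), (1, -1)}"
proof -
  have "(2 * c + d)\<^sup>2 + 3 * d\<^sup>2 = 4" "(2 * d + c)\<^sup>2 + 3 * c\<^sup>2 = 4"
    using assms by (auto simp: power2_eq_square algebra_simps)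
  then have "3 * d\<^sup>2 \<le> 4" "3 * c\<^sup>2 \<le> 4" using zero_le_power2[of "2 * c + d"] zero_le_power2[of "2 * d + c"] by linarith+
  then have "d\<^sup>2 < 2\<^sup>2" "c\<^sup>2 < 2\<^sup>2" by auto
  then have "\<bar>d\<bar> < 2" "\<bar>c\<bar> < 2" using power2_less_imp_less[of "\<bar>d\<bar>" 2] power2_less_imp_less[of "\<bar>c\<bar>" 2] by auto
  then have "c \<in> {-1, 0, 1}" "d \<in> {-1, 0, 1}" by auto
  then show ?thesis using assms by auto
qed

lemma lattice_adj_pt:
  "lattice_adj (pt (of_int a) (of_int b)) (pt (of_int c) (of_int d)) \<longleftrightarrow>
   (c - a, d - b) \<in> {(1, 0), (0, 1), (-1, 1), (-1, 0), (0, -1), (1, -1)}"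
proof -
  let ?p = "pt (real_of_int a) (real_of_int b)" and ?q = "pt (real_of_int c) (real_of_int d)"
  have "dist ?p ?q = 1 \<longleftrightarrow> (dist ?p ?q)\<^sup>2 = 1"
    by (simp add: power2_eq_1_iff) (metis zero_le_dist neg_0_le_iff_le not_one_le_zero)
  also have "\<dots> \<longleftrightarrow> real_of_int ((c - a)\<^sup>2 + (c - a) * (d - b) + (d - b)\<^sup>2) = 1"
    unfolding dist_pt by (simp add: power2_eq_square algebra_simps)
  also have "\<dots> \<longleftrightarrow> (c - a)\<^sup>2 + (c - a) * (d - b) + (d - b)\<^sup>2 = 1" by (simp only: of_int_eq_1_iff)
  also have "\<dots> \<longleftrightarrow> (c - a, d - b) \<in> {(1, 0), (0, 1), (-1, 1), (-1, 0), (0, -1), (1, -1)}"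
    using eisenstein_norm_eq_1[of "c - a" "d - b"] by (auto simp del: insert_iff)
  finally show ?thesis by (auto simp: lattice_adj_def lattice_vertices_eq)
qed

definition ipt :: "int \<Rightarrow> int \<Rightarrow> plane" where
  "ipt a b = pt (of_int a) (of_int b)"

lemma ipt_inject [simp]: "ipt a b = ipt c d \<longleftrightarrow> a = c \<and> b = d"
  by (simp add: ipt_def)

definition up_face :: "int \<Rightarrow> int \<Rightarrow> plane set" where
  "up_face a b = {ipt a b, ipt (a + 1) b, ipt a (b + 1)}"

definition down_face :: "int \<Rightarrow> int \<Rightarrow> plane set" where
  "down_face a b = {ipt (a + 1) b, ipt (a + 1) (b + 1), ipt a (b + 1)}"

definition up_centre :: "int \<Rightarrow> int \<Rightarrow> plane" where
  "up_centre a b = pt (of_int a + 1 / 3) (of_int b + 1 / 3)"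

definition down_centre :: "int \<Rightarrow> int \<Rightarrow> plane" where
  "down_centre a b = pt (of_int a + 2 / 3) (of_int b + 2 / 3)"

lemma face_centre_up: "face_centre (up_face a b) = up_centre a b"
  by (simp add: face_centre_def up_face_def ipt_def pt_add pt_scale up_centre_def)

lemma face_centre_down: "face_centre (down_face a b) = down_centre a b"
  by (simp add: face_centre_def down_face_def ipt_def pt_add pt_scale down_centre_def)

lemma up_centre_inject [simp]: "up_centre a b = up_centre c d \<longleftrightarrow> a = c \<and> b = d"
  by (simp add: up_centre_def)

lemma down_centre_inject [simp]: "down_centre a b = down_centre c d \<longleftrightarrow> a = c \<and> b = d"
  by (simp add: down_centre_def)

lemma up_centre_neq_down [simp]: "up_centre a b \<noteq> down_centre c d" "down_centre c d \<noteq> up_centre a b"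
proof -
  have "real_of_int a + 1 / 3 \<noteq> real_of_int c + 2 / 3"
  proof
    assume "real_of_int a + 1 / 3 = real_of_int c + 2 / 3"
    then have "3 * real_of_int a = 3 * real_of_int c + 1" by simp
    then have "3 * a = 3 * c + 1" by linarith
    then show False by presburger
  qed
  then show "up_centre a b \<noteq> down_centre c d" by (simp add: up_centre_def down_centre_def)
  then show "down_centre c d \<noteq> up_centre a b" by metis
qed

lemma lattice_adj_ipt:
  "lattice_adj (ipt a b) (ipt c d) \<longleftrightarrow>
   (c - a, d - b) \<in> {(1, 0), (0, 1), (-1, 1), (-1, 0), (0, -1), (1, -1)}"
  unfolding ipt_def by (rule lattice_adj_pt)

lemma lattice_adj_vertices: "lattice_adj x y \<Longrightarrow> \<exists>a b c d. x = ipt a b \<and> y = ipt c d"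
  by (auto simp: lattice_adj_def lattice_vertices_eq ipt_def)

text \<open>Two unit steps whose difference is again a unit step enclose an angle of 60 degrees: six
  triangles around a point, each in two orders.\<close>

lemma adjacent_steps_cases:
  fixes d e :: "int \<times> int"
  defines "S \<equiv> {(1, 0), (0, 1), (-1, 1), (-1, 0), (0, -1), (1, -1)} :: (int \<times> int) set"
  assumes "d \<in> S" "e \<in> S" "(fst e - fst d, snd e - snd d) \<in> S"
  shows "(d, e) \<in> {((1,0),(0,1)), ((0,1),(1,0)), ((0,1),(-1,1)), ((-1,1),(0,1)),
    ((-1,1),(-1,0)), ((-1,0),(-1,1)), ((-1,0),(0,-1)), ((0,-1),(-1,0)),
    ((0,-1),(1,-1)), ((1,-1),(0,-1)), ((1,-1),(1,0)), ((1,0),(1,-1))}"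
  using assms(2-4) unfolding S_def by (elim insertE emptyE) simp_all

lemma lattice_faces_eq: "lattice_faces = {up_face a b |a b. True} \<union> {down_face a b |a b. True}"
proof (intro equalityI subsetI)
  fix t assume "t \<in> lattice_faces"
  then obtain x y z where t: "t = {x, y, z}" and adj: "lattice_adj x y" "lattice_adj y z" "lattice_adj x z"
    by (auto simp: lattice_faces_def)
  obtain a b c d where xy: "x = ipt a b" "y = ipt c d" using lattice_adj_vertices[OF adj(1)] by blast
  obtain e f where z: "z = ipt e f" using lattice_adj_vertices[OF adj(3)] by blast
  have "((c - a, d - b), (e - a, f - b)) \<in> {((1,0),(0,1)), ((0,1),(1,0)), ((0,1),(-1,1)), ((-1,1),(0,1)),
    ((-1,1),(-1,0)), ((-1,0),(-1,1)), ((-1,0),(0,-1)), ((0,-1),(-1,0)),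
    ((0,-1),(1,-1)), ((1,-1),(0,-1)), ((1,-1),(1,0)), ((1,0),(1,-1))}"
  proof (rule adjacent_steps_cases)
    have e: "(e - a) - (c - a) = e - c" "(f - b) - (d - b) = f - d" by simp_all
    show "(fst (e - a, f - b) - fst (c - a, d - b), snd (e - a, f - b) - snd (c - a, d - b))
        \<in> {(1, 0), (0, 1), (-1, 1), (-1, 0), (0, -1), (1, -1)}"
      using adj(2) by (simp only: xy z lattice_adj_ipt fst_conv snd_conv e)
  qed (use adj in \<open>simp_all only: xy z lattice_adj_ipt\<close>)
  then obtain p q r u where cd: "c = a + p" "d = b + q" "e = a + r" "f = b + u"
    and steps: "((p, q), (r, u)) \<in> {((1,0),(0,1)), ((0,1),(1,0)), ((0,1),(-1,1)), ((-1,1),(0,1)),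
    ((-1,1),(-1,0)), ((-1,0),(-1,1)), ((-1,0),(0,-1)), ((0,-1),(-1,0)),
    ((0,-1),(1,-1)), ((1,-1),(0,-1)), ((1,-1),(1,0)), ((1,0),(1,-1))}"
    by (metis add_diff_cancel_left' add.commute diff_add_cancel)
  from steps have "(c = a + 1 \<and> d = b \<and> e = a \<and> f = b + 1 \<or> e = a + 1 \<and> f = b \<and> c = a \<and> d = b + 1) \<or>
     (c = a \<and> d = b + 1 \<and> e = a - 1 \<and> f = b + 1 \<or> e = a \<and> f = b + 1 \<and> c = a - 1 \<and> d = b + 1) \<or>
     (c = a - 1 \<and> d = b + 1 \<and> e = a - 1 \<and> f = b \<or> e = a - 1 \<and> f = b + 1 \<and> c = a - 1 \<and> d = b) \<or>
     (c = a - 1 \<and> d = b \<and> e = a \<and> f = b - 1 \<or> e = a - 1 \<and> f = b \<and> c = a \<and> d = b - 1) \<or>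
     (c = a \<and> d = b - 1 \<and> e = a + 1 \<and> f = b - 1 \<or> e = a \<and> f = b - 1 \<and> c = a + 1 \<and> d = b - 1) \<or>
     (c = a + 1 \<and> d = b - 1 \<and> e = a + 1 \<and> f = b \<or> e = a + 1 \<and> f = b - 1 \<and> c = a + 1 \<and> d = b)"
    unfolding cd by (elim insertE emptyE) simp_all
  then have "t = up_face a b \<or> t = down_face (a - 1) b \<or> t = up_face (a - 1) b \<or>
     t = down_face (a - 1) (b - 1) \<or> t = up_face a (b - 1) \<or> t = down_face a (b - 1)"
    unfolding t xy z by (elim disjE conjE) (simp_all add: up_face_def down_face_def insert_commute)
  then show "t \<in> {up_face a b |a b. True} \<union> {down_face a b |a b. True}" by blast
next
  fix t assume "t \<in> {up_face a b |a b. True} \<union> {down_face a b |a b. True}"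
  then show "t \<in> lattice_faces"
  proof (elim UnE CollectE exE conjE)
    fix a b assume t: "t = up_face a b"
    show ?thesis unfolding t up_face_def lattice_faces_def
      by (intro CollectI exI[of _ "ipt a b"] exI[of _ "ipt (a + 1) b"] exI[of _ "ipt a (b + 1)"])
         (simp add: lattice_adj_ipt)
  next
    fix a b assume t: "t = down_face a b"
    show ?thesis unfolding t down_face_def lattice_faces_def
      by (intro CollectI exI[of _ "ipt (a + 1) b"] exI[of _ "ipt (a + 1) (b + 1)"] exI[of _ "ipt a (b + 1)"])
         (simp add: lattice_adj_ipt)
  qed
qed

lemma dual_vertices_eq: "dual_vertices = {up_centre a b |a b. True} \<union> {down_centre a b |a b. True}"
  unfolding dual_vertices_def lattice_faces_eq image_Un
  by (auto simp: face_centre_up face_centre_down image_iff) (metis face_centre_up face_centre_down)+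

lemma mem_up_face: "ipt x y \<in> up_face a b \<longleftrightarrow> (x = a \<and> y = b) \<or> (x = a + 1 \<and> y = b) \<or> (x = a \<and> y = b + 1)"
  by (auto simp: up_face_def)

lemma mem_down_face: "ipt x y \<in> down_face a b \<longleftrightarrow> (x = a + 1 \<and> y = b) \<or> (x = a + 1 \<and> y = b + 1) \<or> (x = a \<and> y = b + 1)"
  by (auto simp: down_face_def)

text \<open>The first pair indexes an upward triangle, the second the downward triangle across its
  right, left or lower side.\<close>

definition dual_adj :: "int \<Rightarrow> int \<Rightarrow> int \<Rightarrow> int \<Rightarrow> bool" where
  "dual_adj a b c d \<longleftrightarrow> (c = a \<and> d = b) \<or> (c = a - 1 \<and> d = b) \<or> (c = a \<and> d = b - 1)"

lemma shared_up_up: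
  assumes "{ipt x y, ipt x' y'} \<subseteq> up_face a b \<inter> up_face c d" "(x, y) \<noteq> (x', y')"
  shows "a = c \<and> b = d"
proof -
  have "ipt x y \<in> up_face a b" "ipt x y \<in> up_face c d" "ipt x' y' \<in> up_face a b" "ipt x' y' \<in> up_face c d"
    using assms(1) by auto
  then show ?thesis using assms(2) unfolding mem_up_face by simp presburger
qed

lemma shared_down_down:
  assumes "{ipt x y, ipt x' y'} \<subseteq> down_face a b \<inter> down_face c d" "(x, y) \<noteq> (x', y')"
  shows "a = c \<and> b = d"
proof -
  have "ipt x y \<in> down_face a b" "ipt x y \<in> down_face c d" "ipt x' y' \<in> down_face a b" "ipt x' y' \<in> down_face c d"
    using assms(1) by auto
  then show ?thesis using assms(2) unfolding mem_down_face by simp presburger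
qed

lemma shared_up_down:
  assumes "{ipt x y, ipt x' y'} \<subseteq> up_face a b \<inter> down_face c d" "(x, y) \<noteq> (x', y')"
  shows "dual_adj a b c d"
proof -
  have "ipt x y \<in> up_face a b" "ipt x y \<in> down_face c d" "ipt x' y' \<in> up_face a b" "ipt x' y' \<in> down_face c d"
    using assms(1) by auto
  then show ?thesis using assms(2) unfolding mem_up_face mem_down_face dual_adj_def
    by simp presburger
qed

lemma dual_edges_eq: "dual_edges = {{up_centre a b, down_centre c d} |a b c d. dual_adj a b c d}"
proof (intro equalityI subsetI)
  fix e assume "e \<in> dual_edges"
  then obtain s t p q where e: "e = {face_centre s, face_centre t}"
    and st: "s \<in> lattice_faces" "t \<in> lattice_faces" "s \<noteq> t"
    and pq: "lattice_adj p q" "{p, q} \<subseteq> s \<inter> t"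
    unfolding dual_edges_def by blast
  obtain x y x' y' where pq': "p = ipt x y" "q = ipt x' y'" using lattice_adj_vertices[OF pq(1)] by blast
  have ne: "(x, y) \<noteq> (x', y')" using pq(1) by (auto simp: pq' lattice_adj_ipt)
  note sub = pq(2)[unfolded pq']
  from st(1,2) consider (uu) a b c d where "s = up_face a b" "t = up_face c d"
    | (ud) a b c d where "s = up_face a b" "t = down_face c d"
    | (du) a b c d where "s = down_face c d" "t = up_face a b"
    | (dd) a b c d where "s = down_face a b" "t = down_face c d"
    unfolding lattice_faces_eq by blast
  then show "e \<in> {{up_centre a b, down_centre c d} |a b c d. dual_adj a b c d}"
  proof cases
    case uu
    then show ?thesis using shared_up_up[OF sub[unfolded uu] ne] st(3) by simp
  next
    case ud
    have "dual_adj a b c d" by (rule shared_up_down[OF sub[unfolded ud] ne])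
    then show ?thesis unfolding e ud face_centre_up face_centre_down by blast
  next
    case du
    have "dual_adj a b c d" by (rule shared_up_down[OF sub[unfolded du Int_commute[of "down_face c d"]] ne])
    then show ?thesis unfolding e du face_centre_up face_centre_down by blast
  next
    case dd
    then show ?thesis using shared_down_down[OF sub[unfolded dd] ne] st(3) by simp
  qed
next
  fix e assume "e \<in> {{up_centre a b, down_centre c d} |a b c d. dual_adj a b c d}"
  then obtain a b c d where e: "e = {up_centre a b, down_centre c d}" and adj: "dual_adj a b c d" by blast
  have "\<exists>p q. lattice_adj p q \<and> {p, q} \<subseteq> up_face a b \<inter> down_face c d"
    using adj unfolding dual_adj_def
  proof (elim disjE)
    assume "c = a \<and> d = b"
    then show ?thesis
      by (intro exI[of _ "ipt (a + 1) b"] exI[of _ "ipt a (b + 1)"])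
         (simp add: mem_up_face mem_down_face lattice_adj_ipt)
  next
    assume "c = a - 1 \<and> d = b"
    then show ?thesis
      by (intro exI[of _ "ipt a b"] exI[of _ "ipt a (b + 1)"])
         (simp add: mem_up_face mem_down_face lattice_adj_ipt)
  next
    assume "c = a \<and> d = b - 1"
    then show ?thesis
      by (intro exI[of _ "ipt a b"] exI[of _ "ipt (a + 1) b"])
         (simp add: mem_up_face mem_down_face lattice_adj_ipt)
  qed
  moreover have "up_face a b \<noteq> down_face c d"
    using up_centre_neq_down(1)[of a b c d] by (metis face_centre_up face_centre_down)
  moreover have "up_face a b \<in> lattice_faces" "down_face c d \<in> lattice_faces"
    unfolding lattice_faces_eq by blast+
  ultimately show "e \<in> dual_edges"
    unfolding dual_edges_def e face_centre_up[symmetric] face_centre_down[symmetric]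
    by (intro CollectI exI[of _ "up_face a b"] exI[of _ "down_face c d"] conjI refl) simp_all
qed

text \<open>Bilinear interpolation: \<open>m\<close> moves along the sides from \<open>A\<close> to
  \<open>D\<close> and from \<open>B\<close> to \<open>C\<close>, and \<open>l\<close> between the
  two points reached.\<close>

lemma trapezoid_hull:
  assumes "0 \<le> l" "l \<le> (1::real)" "0 \<le> m" "m \<le> (1::real)"
  shows "(1 - l) *\<^sub>R ((1 - m) *\<^sub>R A + m *\<^sub>R D) + l *\<^sub>R ((1 - m) *\<^sub>R B + m *\<^sub>R C) \<in>
    convex hull {A, B, C, D :: 'a :: real_vector}"
proof -
  let ?H = "convex hull {A, B, C, D}"
  have in_H: "A \<in> ?H" "B \<in> ?H" "C \<in> ?H" "D \<in> ?H" by (auto intro: hull_inc)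
  have c: "convex ?H" by (rule convex_convex_hull)
  have "(1 - m) *\<^sub>R A + m *\<^sub>R D \<in> ?H" "(1 - m) *\<^sub>R B + m *\<^sub>R C \<in> ?H"
    using assms convexD[OF c in_H(1,4), of "1 - m" m] convexD[OF c in_H(2,3), of "1 - m" m] by simp_all
  then show ?thesis by (rule convexD[OF c]) (use assms in auto)
qed

lemma convex_pt_halfplane: "convex {pt s t |s t. c \<le> a * s + b * t}"
proof (rule convexI)
  fix p q :: plane and u v :: real
  assume "p \<in> {pt s t |s t. c \<le> a * s + b * t}" "q \<in> {pt s t |s t. c \<le> a * s + b * t}"
    and uv: "0 \<le> u" "0 \<le> v" "u + v = 1"
  then obtain s t s' t' where p: "p = pt s t" "c \<le> a * s + b * t" and q: "q = pt s' t'" "c \<le> a * s' + b * t'"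
    by blast
  have "c = u * c + v * c" using uv by (metis distrib_right mult_1)
  also have "\<dots> \<le> u * (a * s + b * t) + v * (a * s' + b * t')"
    using p q uv by (intro add_mono mult_left_mono) auto
  finally have "c \<le> a * (u * s + v * s') + b * (u * t + v * t')" by (simp add: algebra_simps)
  then show "u *\<^sub>R p + v *\<^sub>R q \<in> {pt s t |s t. c \<le> a * s + b * t}"
    unfolding p q pt_scale pt_add by blast
qed

lemma large_trapezoid_iff:
  assumes "n \<ge> 1"
  shows "pt s t \<in> large_trapezoid n \<longleftrightarrow> 0 \<le> t \<and> t \<le> n \<and> - real n \<le> s \<and> s + t \<le> n"
proof
  define H where "H a b c = {pt s t |s t. c \<le> a * s + b * t}" for a b c :: real
  have memH: "pt s t \<in> H a b c \<longleftrightarrow> c \<le> a * s + b * t" for s t a b c by (auto simp: H_def)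
  have hull: "large_trapezoid n = convex hull {pt n 0, pt 0 n, pt (-n) n, pt (-n) 0}"
    by (simp add: large_trapezoid_def pt_def algebra_simps)
  have sub: "large_trapezoid n \<subseteq> H 0 1 0 \<inter> H 0 (-1) (-n) \<inter> H 1 0 (-n) \<inter> H (-1) (-1) (-n)"
    unfolding hull
    by (intro hull_minimal convex_Int; (unfold H_def, rule convex_pt_halfplane)?) (simp add: memH)
  then show "0 \<le> t \<and> t \<le> n \<and> - real n \<le> s \<and> s + t \<le> n" if "pt s t \<in> large_trapezoid n"
    using subsetD[OF sub that] by (simp add: memH)
next
  assume a: "0 \<le> t \<and> t \<le> n \<and> - real n \<le> s \<and> s + t \<le> n"
  have hull: "large_trapezoid n = convex hull {pt (-n) 0, pt n 0, pt 0 n, pt (-n) n}"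
    by (simp add: large_trapezoid_def pt_def algebra_simps insert_commute)
  define m where "m = t / n"
  have n0: "real n > 0" using assms by simp
  have d: "2 * n - t > 0" using a n0 by linarith
  \<comment> \<open>At height \<open>t\<close> the trapezoid reaches from \<open>s = - n\<close> to
    \<open>s = n - t\<close>, a segment of length \<open>2 n - t\<close>.\<close>
  define l where "l = (s + n) / (2 * n - t)"
  have m: "0 \<le> m" "m \<le> 1" "m * n = t" using a n0 by (auto simp: m_def)
  have l: "0 \<le> l" "l \<le> 1" "l * (2 * n - t) = s + n" using a d by (auto simp: l_def)
  have "pt s t = (1 - l) *\<^sub>R ((1 - m) *\<^sub>R pt (-n) 0 + m *\<^sub>R pt (-n) n) + l *\<^sub>R ((1 - m) *\<^sub>R pt n 0 + m *\<^sub>R pt 0 n)"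
  proof -
    have "s = (1 - l) * (-n) + l * (n - m * n)" using l(3) m(3) by (simp add: algebra_simps)
    then show ?thesis unfolding pt_scale pt_add using m(3) by (simp add: algebra_simps)
  qed
  then show "pt s t \<in> large_trapezoid n" unfolding hull using trapezoid_hull[OF l(1,2) m(1,2)] by metis
qed

lemma small_trapezoid_iff:
  fixes n i :: nat
  defines "c \<equiv> 2 * real i - real n + 1"
  shows "pt s t \<in> small_trapezoid n i \<longleftrightarrow> -1 \<le> t \<and> t \<le> 0 \<and> c - 1 \<le> s + t \<and> s \<le> c + 1"
proof
  define H where "H a b c = {pt s t |s t. c \<le> a * s + b * t}" for a b c :: real
  have memH: "pt s t \<in> H a b c \<longleftrightarrow> c \<le> a * s + b * t" for s t a b c by (auto simp: H_def)
  have hull: "small_trapezoid n i = convex hull {pt (c + 1) 0, pt (c - 1) 0, pt c (-1), pt (c + 1) (-1)}"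
    by (simp add: small_trapezoid_def pt_eq vec_v_def vec_w_def c_def Let_def field_simps)
  have sub: "small_trapezoid n i \<subseteq> H 0 1 (-1) \<inter> H 0 (-1) 0 \<inter> H 1 1 (c - 1) \<inter> H (-1) 0 (- c - 1)"
    unfolding hull
    by (intro hull_minimal convex_Int; (unfold H_def, rule convex_pt_halfplane)?) (simp add: memH)
  then show "-1 \<le> t \<and> t \<le> 0 \<and> c - 1 \<le> s + t \<and> s \<le> c + 1" if "pt s t \<in> small_trapezoid n i"
    using subsetD[OF sub that] by (simp add: memH)
next
  assume a: "-1 \<le> t \<and> t \<le> 0 \<and> c - 1 \<le> s + t \<and> s \<le> c + 1"
  have hull: "small_trapezoid n i = convex hull {pt (c - 1) 0, pt (c + 1) 0, pt (c + 1) (-1), pt c (-1)}"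
    by (simp add: small_trapezoid_def pt_eq vec_v_def vec_w_def c_def Let_def field_simps insert_commute)
  \<comment> \<open>At height \<open>t\<close> the small trapezoid reaches from
    \<open>s = c - 1 - t\<close> to \<open>s = c + 1\<close>.\<close>
  define l where "l = (s - (c - 1) + t) / (2 + t)"
  have d: "2 + t > 0" using a by linarith
  have l: "0 \<le> l" "l \<le> 1" "l * (2 + t) = s - (c - 1) + t" using a d by (auto simp: l_def)
  have "pt s t = (1 - l) *\<^sub>R ((1 - (-t)) *\<^sub>R pt (c - 1) 0 + (-t) *\<^sub>R pt c (-1)) + l *\<^sub>R ((1 - (-t)) *\<^sub>R pt (c + 1) 0 + (-t) *\<^sub>R pt (c + 1) (-1))"
  proof -
    have "s = (1 - l) * (c - 1 - t) + l * (c + 1)" using l(3) by (simp add: algebra_simps)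
    then show ?thesis unfolding pt_scale pt_add by (simp add: algebra_simps)
  qed
  then show "pt s t \<in> small_trapezoid n i"
    unfolding hull using trapezoid_hull[OF l(1,2), of "-t"] a by (metis neg_0_le_iff_le neg_le_iff_le minus_minus)
qed

section \<open>The half-hexagon graph in row coordinates\<close>

lemma up_centre_in_region:
  assumes "n \<ge> 1"
  shows "up_centre a b \<in> half_hexagon_region n \<longleftrightarrow>
    (0 \<le> b \<and> b < int n \<and> - int n \<le> a \<and> a + b < int n) \<or> (b = -1 \<and> (\<exists>i<n. a = 2 * int i - int n + 1))"
proof -
  have large: "up_centre a b \<in> large_trapezoid n \<longleftrightarrow> 0 \<le> b \<and> b < int n \<and> - int n \<le> a \<and> a + b < int n"
  proof -
    \<comment> \<open>Multiplying by 3 makes all bounds integral; the residues modulo 3 then turn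
      the weak inequalities for centres into the stated ones.\<close>
    have "up_centre a b \<in> large_trapezoid n \<longleftrightarrow> 0 \<le> real_of_int (3 * b + 1) \<and> real_of_int (3 * b + 1) \<le> of_int (3 * int n) \<and>
        of_int (- 3 * int n) \<le> real_of_int (3 * a + 1) \<and> real_of_int (3 * a + 3 * b + 2) \<le> of_int (3 * int n)"
      unfolding up_centre_def large_trapezoid_iff[OF assms] by (auto simp: field_simps)
    then show ?thesis unfolding of_int_le_iff of_int_0_le_iff by presburger
  qed
  have small: "up_centre a b \<in> small_trapezoid n i \<longleftrightarrow> b = -1 \<and> a = 2 * int i - int n + 1" for i
  proof -
    have "up_centre a b \<in> small_trapezoid n i \<longleftrightarrow> of_int (-3) \<le> real_of_int (3 * b + 1) \<and> real_of_int (3 * b + 1) \<le> of_int 0 \<and>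
        of_int (3 * (2 * int i - int n)) \<le> real_of_int (3 * a + 3 * b + 2) \<and>
        real_of_int (3 * a + 1) \<le> of_int (3 * (2 * int i - int n + 2))"
      unfolding up_centre_def small_trapezoid_iff by (auto simp: field_simps)
    then show ?thesis unfolding of_int_le_iff by presburger
  qed
  show ?thesis unfolding half_hexagon_region_def using large small by auto
qed

lemma down_centre_in_region:
  assumes "n \<ge> 1"
  shows "down_centre a b \<in> half_hexagon_region n \<longleftrightarrow>
    (0 \<le> b \<and> b < int n \<and> - int n \<le> a \<and> a + b + 1 < int n) \<or> (b = -1 \<and> - int n \<le> a \<and> a < int n)"
proof -
  have large: "down_centre a b \<in> large_trapezoid n \<longleftrightarrow> 0 \<le> b \<and> b < int n \<and> - int n \<le> a \<and> a + b + 1 < int n"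
  proof -
    have "down_centre a b \<in> large_trapezoid n \<longleftrightarrow> 0 \<le> real_of_int (3 * b + 2) \<and> real_of_int (3 * b + 2) \<le> of_int (3 * int n) \<and>
        of_int (- 3 * int n) \<le> real_of_int (3 * a + 2) \<and> real_of_int (3 * a + 3 * b + 4) \<le> of_int (3 * int n)"
      unfolding down_centre_def large_trapezoid_iff[OF assms] by (auto simp: field_simps)
    then show ?thesis unfolding of_int_le_iff of_int_0_le_iff by presburger
  qed
  have small: "down_centre a b \<in> small_trapezoid n i \<longleftrightarrow>
      b = -1 \<and> (a = 2 * int i - int n \<or> a = 2 * int i - int n + 1)" for i
  proof -
    have "down_centre a b \<in> small_trapezoid n i \<longleftrightarrow> of_int (-3) \<le> real_of_int (3 * b + 2) \<and> real_of_int (3 * b + 2) \<le> of_int 0 \<and>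
        of_int (3 * (2 * int i - int n)) \<le> real_of_int (3 * a + 3 * b + 4) \<and>
        real_of_int (3 * a + 2) \<le> of_int (3 * (2 * int i - int n + 2))"
      unfolding down_centre_def small_trapezoid_iff by (auto simp: field_simps)
    then show ?thesis unfolding of_int_le_iff by presburger
  qed
  have "(\<exists>i<n. a = 2 * int i - int n \<or> a = 2 * int i - int n + 1) \<longleftrightarrow> - int n \<le> a \<and> a < int n"
  proof
    assume a: "- int n \<le> a \<and> a < int n"
    define j where "j = (a + int n) div 2"
    have "0 \<le> j \<and> j < int n \<and> (a = 2 * j - int n \<or> a = 2 * j - int n + 1)"
      using a unfolding j_def by presburger
    then have "nat j < n" "a = 2 * int (nat j) - int n \<or> a = 2 * int (nat j) - int n + 1" by auto
    then show "\<exists>i<n. a = 2 * int i - int n \<or> a = 2 * int i - int n + 1" by blast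
  qed auto
  then show ?thesis unfolding half_hexagon_region_def using large small by auto
qed

text \<open>Rows are counted from the top and columns from the left, so that row \<open>k\<close> with \<open>1 \<le> k \<le> n\<close> has
  \<open>n + k\<close> upward and \<open>n + k - 1\<close> downward triangles; row \<open>n + 1\<close> consists of the small trapezoids.\<close>

definition up_vertex :: "nat \<Rightarrow> nat \<Rightarrow> nat \<Rightarrow> plane" where
  "up_vertex n k x = up_centre (int x - int n) (int n - int k)"

definition down_vertex :: "nat \<Rightarrow> nat \<Rightarrow> nat \<Rightarrow> plane" where
  "down_vertex n k x = down_centre (int x - int n) (int n - int k)"

text \<open>In row \<open>n + 1\<close> each small trapezoid has one upward triangle, in the odd
  column, between its two downward ones. It absorbs one of these, so the other is matched from
  above; this is the origin of \<open>base_configs\<close>.\<close>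

definition up_index :: "nat \<Rightarrow> nat \<Rightarrow> nat \<Rightarrow> bool" where
  "up_index n k x \<longleftrightarrow> (1 \<le> k \<and> k \<le> n \<and> x < n + k) \<or> (k = Suc n \<and> odd x \<and> x < 2 * n)"

definition down_index :: "nat \<Rightarrow> nat \<Rightarrow> nat \<Rightarrow> bool" where
  "down_index n k x \<longleftrightarrow> (1 \<le> k \<and> k \<le> n \<and> Suc x < n + k) \<or> (k = Suc n \<and> x < 2 * n)"

lemma vertex_inject [simp]:
  "up_vertex n k x = up_vertex n k' x' \<longleftrightarrow> k = k' \<and> x = x'"
  "down_vertex n k x = down_vertex n k' x' \<longleftrightarrow> k = k' \<and> x = x'"
  "up_vertex n k x \<noteq> down_vertex n k' x'" "down_vertex n k' x' \<noteq> up_vertex n k x"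
  by (auto simp: up_vertex_def down_vertex_def)

lemma up_centre_in_vertices:
  assumes "n \<ge> 1"
  shows "up_centre a b \<in> half_hexagon_vertices n \<longleftrightarrow> (\<exists>k x. up_centre a b = up_vertex n k x \<and> up_index n k x)"
proof -
  have "up_centre a b \<in> half_hexagon_vertices n \<longleftrightarrow> up_centre a b \<in> half_hexagon_region n"
    unfolding half_hexagon_vertices_def dual_vertices_eq by blast
  also have "\<dots> \<longleftrightarrow> (\<exists>k x. up_centre a b = up_vertex n k x \<and> up_index n k x)"
  proof
    assume "up_centre a b \<in> half_hexagon_region n"
    then have c: "(0 \<le> b \<and> b < int n \<and> - int n \<le> a \<and> a + b < int n) \<or> (b = -1 \<and> (\<exists>i<n. a = 2 * int i - int n + 1))"
      by (simp add: up_centre_in_region[OF assms])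
    then have e: "a = int (nat (a + int n)) - int n" "b = int n - int (nat (int n - b))" by auto
    have "up_index n (nat (int n - b)) (nat (a + int n))"
      using c by (auto simp: up_index_def nat_add_distrib nat_mult_distrib)
    then show "\<exists>k x. up_centre a b = up_vertex n k x \<and> up_index n k x"
      using e unfolding up_vertex_def by (metis)
  next
    assume "\<exists>k x. up_centre a b = up_vertex n k x \<and> up_index n k x"
    then obtain k x where kx: "a = int x - int n" "b = int n - int k" "up_index n k x"
      by (auto simp: up_vertex_def)
    have "\<exists>i<n. int x - int n = 2 * int i - int n + 1" if "odd x" "x < 2 * n"
      using that by (intro exI[of _ "x div 2"]) presburger
    then show "up_centre a b \<in> half_hexagon_region n"
      using kx by (auto simp: up_centre_in_region[OF assms] up_index_def)
  qed
  finally show ?thesis .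
qed

lemma down_centre_in_vertices:
  assumes "n \<ge> 1"
  shows "down_centre a b \<in> half_hexagon_vertices n \<longleftrightarrow> (\<exists>k x. down_centre a b = down_vertex n k x \<and> down_index n k x)"
proof -
  have "down_centre a b \<in> half_hexagon_vertices n \<longleftrightarrow> down_centre a b \<in> half_hexagon_region n"
    unfolding half_hexagon_vertices_def dual_vertices_eq by blast
  also have "\<dots> \<longleftrightarrow> (\<exists>k x. down_centre a b = down_vertex n k x \<and> down_index n k x)"
  proof
    assume "down_centre a b \<in> half_hexagon_region n"
    then have c: "(0 \<le> b \<and> b < int n \<and> - int n \<le> a \<and> a + b + 1 < int n) \<or> (b = -1 \<and> - int n \<le> a \<and> a < int n)"
      by (simp add: down_centre_in_region[OF assms])
    then have e: "a = int (nat (a + int n)) - int n" "b = int n - int (nat (int n - b))" by auto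
    have "down_index n (nat (int n - b)) (nat (a + int n))"
      using c by (auto simp: down_index_def)
    then show "\<exists>k x. down_centre a b = down_vertex n k x \<and> down_index n k x"
      using e unfolding down_vertex_def by (metis)
  next
    assume "\<exists>k x. down_centre a b = down_vertex n k x \<and> down_index n k x"
    then show "down_centre a b \<in> half_hexagon_region n"
      by (auto simp: down_centre_in_region[OF assms] down_index_def down_vertex_def)
  qed
  finally show ?thesis .
qed

lemma half_hexagon_vertices_eq:
  assumes "n \<ge> 1"
  shows "half_hexagon_vertices n =
    {up_vertex n k x |k x. up_index n k x} \<union> {down_vertex n k x |k x. down_index n k x}"
proof (intro equalityI subsetI)
  fix p assume p: "p \<in> half_hexagon_vertices n"
  then have "p \<in> dual_vertices" by (simp add: half_hexagon_vertices_def)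
  then consider a b where "p = up_centre a b" | a b where "p = down_centre a b"
    unfolding dual_vertices_eq by blast
  then show "p \<in> {up_vertex n k x |k x. up_index n k x} \<union> {down_vertex n k x |k x. down_index n k x}"
    using p up_centre_in_vertices[OF assms] down_centre_in_vertices[OF assms] by cases auto
next
  fix p assume "p \<in> {up_vertex n k x |k x. up_index n k x} \<union> {down_vertex n k x |k x. down_index n k x}"
  then show "p \<in> half_hexagon_vertices n"
  proof (elim UnE CollectE exE conjE)
    fix k x assume "p = up_vertex n k x" "up_index n k x"
    then show ?thesis
      using up_centre_in_vertices[OF assms, of "int x - int n" "int n - int k"] unfolding up_vertex_def by blast
  next
    fix k x assume "p = down_vertex n k x" "down_index n k x"
    then show ?thesis
      using down_centre_in_vertices[OF assms, of "int x - int n" "int n - int k"] unfolding down_vertex_def by blast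
  qed
qed

definition right_edge :: "nat \<Rightarrow> nat \<Rightarrow> nat \<Rightarrow> plane set" where
  "right_edge n k x = {up_vertex n k x, down_vertex n k x}"

text \<open>An edge is named by the side of the upward triangle on which its downward end lies. Left
  edges carry the column of the downward end, whence \<open>Suc x\<close>.\<close>

definition left_edge :: "nat \<Rightarrow> nat \<Rightarrow> nat \<Rightarrow> plane set" where
  "left_edge n k x = {up_vertex n k (Suc x), down_vertex n k x}"

definition vert_edge :: "nat \<Rightarrow> nat \<Rightarrow> nat \<Rightarrow> plane set" where
  "vert_edge n k x = {up_vertex n k x, down_vertex n (Suc k) x}"

lemma edge_inject [simp]:
  "right_edge n k x = right_edge n k' x' \<longleftrightarrow> k = k' \<and> x = x'"
  "left_edge n k x = left_edge n k' x' \<longleftrightarrow> k = k' \<and> x = x'"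
  "vert_edge n k x = vert_edge n k' x' \<longleftrightarrow> k = k' \<and> x = x'"
  "right_edge n k x \<noteq> left_edge n k' x'" "left_edge n k' x' \<noteq> right_edge n k x"
  "right_edge n k x \<noteq> vert_edge n k' x'" "vert_edge n k' x' \<noteq> right_edge n k x"
  "left_edge n k x \<noteq> vert_edge n k' x'" "vert_edge n k' x' \<noteq> left_edge n k x"
  by (auto simp: right_edge_def left_edge_def vert_edge_def doubleton_eq_iff)

lemma half_hexagon_edges_eq:
  assumes "n \<ge> 1"
  shows "half_hexagon_edges n =
    {right_edge n k x |k x. up_index n k x \<and> down_index n k x} \<union>
    {left_edge n k x |k x. up_index n k (Suc x) \<and> down_index n k x} \<union>
    {vert_edge n k x |k x. up_index n k x \<and> down_index n (Suc k) x}" (is "_ = ?R")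
proof (intro equalityI subsetI)
  fix e assume "e \<in> half_hexagon_edges n"
  then obtain a b c d where e: "e = {up_centre a b, down_centre c d}" and adj: "dual_adj a b c d"
    and mem: "up_centre a b \<in> half_hexagon_vertices n" "down_centre c d \<in> half_hexagon_vertices n"
    unfolding half_hexagon_edges_def dual_edges_eq by blast
  obtain k x where u: "up_centre a b = up_vertex n k x" "up_index n k x"
    using mem(1) up_centre_in_vertices[OF assms] by blast
  obtain k' x' where d: "down_centre c d = down_vertex n k' x'" "down_index n k' x'"
    using mem(2) down_centre_in_vertices[OF assms] by blast
  have ab: "a = int x - int n" "b = int n - int k" "c = int x' - int n" "d = int n - int k'"
    using u(1) d(1) by (auto simp: up_vertex_def down_vertex_def)
  have "(k' = k \<and> x' = x) \<or> (k' = k \<and> x = Suc x') \<or> (k' = Suc k \<and> x' = x)"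
    using adj unfolding dual_adj_def ab by auto
  then show "e \<in> ?R"
    using u(2) d(2) unfolding e u(1) d(1) right_edge_def left_edge_def vert_edge_def by blast
next
  fix e assume "e \<in> ?R"
  moreover have "{up_vertex n k x, down_vertex n k' x'} \<in> half_hexagon_edges n"
    if "up_index n k x" "down_index n k' x'" "(k' = k \<and> x' = x) \<or> (k' = k \<and> x = Suc x') \<or> (k' = Suc k \<and> x' = x)"
    for k x k' x'
  proof -
    have "dual_adj (int x - int n) (int n - int k) (int x' - int n) (int n - int k')"
      using that(3) by (auto simp: dual_adj_def)
    then have "{up_vertex n k x, down_vertex n k' x'} \<in> dual_edges"
      unfolding dual_edges_eq up_vertex_def down_vertex_def by blast
    moreover have "up_vertex n k x \<in> half_hexagon_vertices n" "down_vertex n k' x' \<in> half_hexagon_vertices n"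
      unfolding half_hexagon_vertices_eq[OF assms] using that by blast+
    ultimately show ?thesis by (simp add: half_hexagon_edges_def)
  qed
  ultimately show "e \<in> half_hexagon_edges n"
    unfolding right_edge_def left_edge_def vert_edge_def by blast
qed

definition exactly_one :: "bool \<Rightarrow> bool \<Rightarrow> bool \<Rightarrow> bool" where
  "exactly_one p q r \<longleftrightarrow> (p \<or> q \<or> r) \<and> \<not> (p \<and> q) \<and> \<not> (p \<and> r) \<and> \<not> (q \<and> r)"

text \<open>The matching conditions for three Boolean families of edges. The guards
  \<open>1 \<le> x\<close> and \<open>1 \<le> k\<close> exclude the edges that truncated subtraction
  would produce at the border.\<close>

definition consistent :: "nat \<Rightarrow> (nat \<Rightarrow> nat \<Rightarrow> bool) \<Rightarrow> (nat \<Rightarrow> nat \<Rightarrow> bool) \<Rightarrow> (nat \<Rightarrow> nat \<Rightarrow> bool) \<Rightarrow> bool" where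
  "consistent n r l v \<longleftrightarrow>
     (\<forall>k x. r k x \<longrightarrow> up_index n k x \<and> down_index n k x) \<and>
     (\<forall>k x. l k x \<longrightarrow> up_index n k (Suc x) \<and> down_index n k x) \<and>
     (\<forall>k x. v k x \<longrightarrow> up_index n k x \<and> down_index n (Suc k) x) \<and>
     (\<forall>k x. up_index n k x \<longrightarrow> exactly_one (r k x) (1 \<le> x \<and> l k (x - 1)) (v k x)) \<and>
     (\<forall>k x. down_index n k x \<longrightarrow> exactly_one (r k x) (l k x) (1 \<le> k \<and> v (k - 1) x))"

definition edge_set :: "nat \<Rightarrow> (nat \<Rightarrow> nat \<Rightarrow> bool) \<Rightarrow> (nat \<Rightarrow> nat \<Rightarrow> bool) \<Rightarrow> (nat \<Rightarrow> nat \<Rightarrow> bool) \<Rightarrow> plane set set" where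
  "edge_set n r l v = {right_edge n k x |k x. r k x} \<union> {left_edge n k x |k x. l k x} \<union> {vert_edge n k x |k x. v k x}"

lemma mem_edge_set [simp]:
  "right_edge n k x \<in> edge_set n r l v \<longleftrightarrow> r k x"
  "left_edge n k x \<in> edge_set n r l v \<longleftrightarrow> l k x"
  "vert_edge n k x \<in> edge_set n r l v \<longleftrightarrow> v k x"
  by (auto simp: edge_set_def)

lemma edge_set_subset_iff:
  "edge_set n r l v \<subseteq> edge_set n r' l' v' \<longleftrightarrow>
    (\<forall>k x. r k x \<longrightarrow> r' k x) \<and> (\<forall>k x. l k x \<longrightarrow> l' k x) \<and> (\<forall>k x. v k x \<longrightarrow> v' k x)"
proof
  assume sub: "edge_set n r l v \<subseteq> edge_set n r' l' v'"
  show "(\<forall>k x. r k x \<longrightarrow> r' k x) \<and> (\<forall>k x. l k x \<longrightarrow> l' k x) \<and> (\<forall>k x. v k x \<longrightarrow> v' k x)"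
    using subsetD[OF sub] mem_edge_set[of n] by metis
qed (unfold edge_set_def, blast)

lemma vertex_mem_edge:
  "up_vertex n k x \<in> right_edge n k' x' \<longleftrightarrow> k' = k \<and> x' = x"
  "up_vertex n k x \<in> left_edge n k' x' \<longleftrightarrow> k' = k \<and> x = Suc x'"
  "up_vertex n k x \<in> vert_edge n k' x' \<longleftrightarrow> k' = k \<and> x' = x"
  "down_vertex n k x \<in> right_edge n k' x' \<longleftrightarrow> k' = k \<and> x' = x"
  "down_vertex n k x \<in> left_edge n k' x' \<longleftrightarrow> k' = k \<and> x' = x"
  "down_vertex n k x \<in> vert_edge n k' x' \<longleftrightarrow> k = Suc k' \<and> x' = x"
  by (auto simp: right_edge_def left_edge_def vert_edge_def)

lemma ex1_three_alternatives:
  assumes "a \<noteq> b" "a \<noteq> c" "b \<noteq> c"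
  shows "(\<exists>!e. (e = a \<and> p) \<or> (e = b \<and> q) \<or> (e = c \<and> s)) \<longleftrightarrow> exactly_one p q s"
  using assms unfolding exactly_one_def by (cases p; cases q; cases s; simp) auto

lemma ex1_edge_at_up:
  "(\<exists>!e. e \<in> edge_set n r l v \<and> up_vertex n k x \<in> e) \<longleftrightarrow> exactly_one (r k x) (1 \<le> x \<and> l k (x - 1)) (v k x)"
proof -
  have at: "e \<in> edge_set n r l v \<and> up_vertex n k x \<in> e \<longleftrightarrow>
     (e = right_edge n k x \<and> r k x) \<or> (e = left_edge n k (x - 1) \<and> 1 \<le> x \<and> l k (x - 1)) \<or> (e = vert_edge n k x \<and> v k x)" for e
  proof -
    have "e \<in> edge_set n r l v \<and> up_vertex n k x \<in> e \<longleftrightarrow>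
      (\<exists>k' x'. e = right_edge n k' x' \<and> r k' x' \<and> up_vertex n k x \<in> right_edge n k' x') \<or>
      (\<exists>k' x'. e = left_edge n k' x' \<and> l k' x' \<and> up_vertex n k x \<in> left_edge n k' x') \<or>
      (\<exists>k' x'. e = vert_edge n k' x' \<and> v k' x' \<and> up_vertex n k x \<in> vert_edge n k' x')"
      unfolding edge_set_def by blast
    then show ?thesis unfolding vertex_mem_edge by (cases x) auto
  qed
  show ?thesis unfolding at by (rule ex1_three_alternatives) simp_all
qed

lemma ex1_edge_at_down:
  "(\<exists>!e. e \<in> edge_set n r l v \<and> down_vertex n k x \<in> e) \<longleftrightarrow> exactly_one (r k x) (l k x) (1 \<le> k \<and> v (k - 1) x)"
proof -
  have at: "e \<in> edge_set n r l v \<and> down_vertex n k x \<in> e \<longleftrightarrow>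
     (e = right_edge n k x \<and> r k x) \<or> (e = left_edge n k x \<and> l k x) \<or> (e = vert_edge n (k - 1) x \<and> 1 \<le> k \<and> v (k - 1) x)" for e
  proof -
    have "e \<in> edge_set n r l v \<and> down_vertex n k x \<in> e \<longleftrightarrow>
      (\<exists>k' x'. e = right_edge n k' x' \<and> r k' x' \<and> down_vertex n k x \<in> right_edge n k' x') \<or>
      (\<exists>k' x'. e = left_edge n k' x' \<and> l k' x' \<and> down_vertex n k x \<in> left_edge n k' x') \<or>
      (\<exists>k' x'. e = vert_edge n k' x' \<and> v k' x' \<and> down_vertex n k x \<in> vert_edge n k' x')"
      unfolding edge_set_def by blast
    then show ?thesis unfolding vertex_mem_edge by (cases k) auto
  qed
  show ?thesis unfolding at by (rule ex1_three_alternatives) simp_all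
qed

definition matchings :: "nat \<Rightarrow> plane set set set" where
  "matchings n = perfect_matchings (half_hexagon_vertices n) (half_hexagon_edges n)"

lemma edge_set_matching_iff:
  assumes "n \<ge> 1"
  shows "edge_set n r l v \<in> matchings n \<longleftrightarrow> consistent n r l v"
proof -
  have sub: "edge_set n r l v \<subseteq> half_hexagon_edges n \<longleftrightarrow>
     (\<forall>k x. r k x \<longrightarrow> up_index n k x \<and> down_index n k x) \<and>
     (\<forall>k x. l k x \<longrightarrow> up_index n k (Suc x) \<and> down_index n k x) \<and>
     (\<forall>k x. v k x \<longrightarrow> up_index n k x \<and> down_index n (Suc k) x)"
    unfolding half_hexagon_edges_eq[OF assms, folded edge_set_def] by (rule edge_set_subset_iff)
  have cover: "(\<forall>p\<in>half_hexagon_vertices n. \<exists>!e. e \<in> edge_set n r l v \<and> p \<in> e) \<longleftrightarrow>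
     (\<forall>k x. up_index n k x \<longrightarrow> (\<exists>!e. e \<in> edge_set n r l v \<and> up_vertex n k x \<in> e)) \<and>
     (\<forall>k x. down_index n k x \<longrightarrow> (\<exists>!e. e \<in> edge_set n r l v \<and> down_vertex n k x \<in> e))"
    unfolding half_hexagon_vertices_eq[OF assms] by blast
  show ?thesis
    unfolding matchings_def perfect_matchings_def consistent_def mem_Collect_eq sub cover
      ex1_edge_at_up ex1_edge_at_down by blast
qed

lemma matching_eq_edge_set:
  assumes "n \<ge> 1" "M \<in> matchings n"
  shows "M = edge_set n (\<lambda>k x. right_edge n k x \<in> M) (\<lambda>k x. left_edge n k x \<in> M) (\<lambda>k x. vert_edge n k x \<in> M)"
proof -
  have "M \<subseteq> half_hexagon_edges n" using assms(2) by (simp add: matchings_def perfect_matchings_def)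
  then show ?thesis unfolding half_hexagon_edges_eq[OF assms(1)] edge_set_def by blast
qed

lemma matching_consistent:
  assumes "n \<ge> 1" "M \<in> matchings n"
  shows "consistent n (\<lambda>k x. right_edge n k x \<in> M) (\<lambda>k x. left_edge n k x \<in> M) (\<lambda>k x. vert_edge n k x \<in> M)"
  using edge_set_matching_iff[OF assms(1)] matching_eq_edge_set[OF assms] assms(2) by metis

section \<open>Matchings as patterns\<close>

text \<open>Scanning row \<open>k\<close> from the left, the edge at column \<open>x\<close> is forced by the difference of the numbers
  of particles of rows \<open>k\<close> and \<open>k - 1\<close> seen so far, which is always \<open>0\<close> or \<open>1\<close>.\<close>

definition left_formula :: "nat \<Rightarrow> (nat \<Rightarrow> nat set) \<Rightarrow> nat \<Rightarrow> nat \<Rightarrow> bool" where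
  "left_formula n X k x \<longleftrightarrow>
     (1 \<le> k \<and> k \<le> n \<and> Suc x < n + k \<and> card (X k \<inter> {..<Suc x}) = Suc (card (X (k - 1) \<inter> {..<Suc x}))) \<or>
     (k = Suc n \<and> even x \<and> x < 2 * n \<and> x \<notin> X n)"

definition right_formula :: "nat \<Rightarrow> (nat \<Rightarrow> nat set) \<Rightarrow> nat \<Rightarrow> nat \<Rightarrow> bool" where
  "right_formula n X k x \<longleftrightarrow>
     (1 \<le> k \<and> k \<le> n \<and> Suc x < n + k \<and> x \<notin> X k \<and> card (X k \<inter> {..<x}) = card (X (k - 1) \<inter> {..<x})) \<or>
     (k = Suc n \<and> odd x \<and> x < 2 * n \<and> x \<notin> X n)"

definition level_sets :: "nat \<Rightarrow> (nat \<Rightarrow> nat \<Rightarrow> bool) \<Rightarrow> nat \<Rightarrow> nat set" where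
  "level_sets n v k = (if k \<le> n then {x. v k x} else {})"

lemma card_Int_lessThan_Suc:
  "card (A \<inter> {..<Suc x}) = card (A \<inter> {..<x}) + (if x \<in> A then 1 else 0)"
proof -
  have "A \<inter> {..<Suc x} = (if x \<in> A then insert x (A \<inter> {..<x}) else A \<inter> {..<x})"
    by (auto simp: less_Suc_eq)
  then show ?thesis by simp
qed

lemma consistentD:
  assumes "consistent n r l v"
  shows "r k x \<Longrightarrow> up_index n k x" "r k x \<Longrightarrow> down_index n k x"
    and "l k x \<Longrightarrow> up_index n k (Suc x)" "l k x \<Longrightarrow> down_index n k x"
    and "v k x \<Longrightarrow> up_index n k x" "v k x \<Longrightarrow> down_index n (Suc k) x"
    and "up_index n k x \<Longrightarrow> exactly_one (r k x) (1 \<le> x \<and> l k (x - 1)) (v k x)"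
    and "down_index n k x \<Longrightarrow> exactly_one (r k x) (l k x) (1 \<le> k \<and> v (k - 1) x)"
  using assms unfolding consistent_def by blast+

text \<open>The edges at the upward and the downward triangle of a column determine how the surplus
  of row \<open>k\<close> over row \<open>k - 1\<close> changes there. A surplus of one before
  column \<open>x\<close> means that the upward triangle at \<open>x\<close> is matched to its
  left.\<close>

lemma consistent_row:
  assumes c: "consistent n r l v" and k: "1 \<le> k" "k \<le> n"
  defines "X \<equiv> level_sets n v"
  shows "x < n + k \<Longrightarrow> card (X k \<inter> {..<x}) = card (X (k - 1) \<inter> {..<x}) + (if 1 \<le> x \<and> l k (x - 1) then 1 else 0)"
proof (induction x)
  case 0 then show ?case by simp
next
  case (Suc x)
  have mem: "x \<in> X k \<longleftrightarrow> v k x" "x \<in> X (k - 1) \<longleftrightarrow> v (k - 1) x"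
    using k by (auto simp: X_def level_sets_def)
  have "up_index n k x" "down_index n k x" using Suc.prems k by (auto simp: up_index_def down_index_def)
  then have "exactly_one (r k x) (1 \<le> x \<and> l k (x - 1)) (v k x)" "exactly_one (r k x) (l k x) (1 \<le> k \<and> v (k - 1) x)"
    by (simp_all only: consistentD(7,8)[OF c])
  then show ?case
    using Suc mem k unfolding card_Int_lessThan_Suc exactly_one_def by auto
qed

lemma consistent_left:
  assumes c: "consistent n r l v"
  shows "l k x \<longleftrightarrow> left_formula n (level_sets n v) k x"
proof -
  have bounds: "up_index n k (Suc x)" "down_index n k x" if "l k x" using consistentD[OF c] that by blast+
  consider "1 \<le> k \<and> k \<le> n" | "k = Suc n" | "k = 0 \<or> k > Suc n" by linarith
  then show ?thesis
  proof cases
    case 1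
    show ?thesis
    proof (cases "Suc x < n + k")
      case True
      then show ?thesis using consistent_row[OF c, of k "Suc x"] 1 by (auto simp: left_formula_def)
    next
      case False
      then show ?thesis using bounds 1 by (auto simp: left_formula_def down_index_def)
    qed
  next
    case 2
    show ?thesis
    proof (cases "even x \<and> x < 2 * n")
      case True
      then have "n \<ge> 1" "down_index n (Suc n) x" by (auto simp: down_index_def)
      then have "exactly_one (r (Suc n) x) (l (Suc n) x) (v n x)" using consistentD(8)[OF c, of "Suc n" x] by simp
      moreover have "\<not> r (Suc n) x" using consistentD(1)[OF c, of "Suc n" x] True by (auto simp: up_index_def)
      ultimately show ?thesis using 2 True by (auto simp: left_formula_def level_sets_def exactly_one_def)
    next
      case False
      then show ?thesis using bounds 2 by (auto simp: left_formula_def up_index_def)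
    qed
  next
    case 3
    then show ?thesis using bounds by (auto simp: left_formula_def up_index_def)
  qed
qed

lemma consistent_right:
  assumes c: "consistent n r l v"
  shows "r k x \<longleftrightarrow> right_formula n (level_sets n v) k x"
proof -
  have bounds: "up_index n k x" "down_index n k x" if "r k x" using consistentD[OF c] that by blast+
  consider "1 \<le> k \<and> k \<le> n" | "k = Suc n" | "k = 0 \<or> k > Suc n" by linarith
  then show ?thesis
  proof cases
    case 1
    show ?thesis
    proof (cases "Suc x < n + k")
      case True
      then have "up_index n k x" using 1 by (auto simp: up_index_def)
      then have "exactly_one (r k x) (1 \<le> x \<and> l k (x - 1)) (v k x)" by (rule consistentD(7)[OF c])
      moreover have "x \<in> level_sets n v k \<longleftrightarrow> v k x" using 1 by (simp add: level_sets_def)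
      ultimately show ?thesis using consistent_row[OF c, of k x] 1 True
        by (auto simp: right_formula_def exactly_one_def split: if_splits)
    next
      case False
      then show ?thesis using bounds 1 by (auto simp: right_formula_def down_index_def)
    qed
  next
    case 2
    show ?thesis
    proof (cases "odd x \<and> x < 2 * n")
      case True
      then have "n \<ge> 1" "down_index n (Suc n) x" by (auto simp: down_index_def)
      then have "exactly_one (r (Suc n) x) (l (Suc n) x) (v n x)" using consistentD(8)[OF c, of "Suc n" x] by simp
      moreover have "\<not> l (Suc n) x" using consistentD(3)[OF c, of "Suc n" x] True by (auto simp: up_index_def)
      ultimately show ?thesis using 2 True by (auto simp: right_formula_def level_sets_def exactly_one_def)
    next
      case False
      then show ?thesis using bounds 2 by (auto simp: right_formula_def up_index_def)
    qed
  next
    case 3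
    then show ?thesis using bounds by (auto simp: right_formula_def up_index_def)
  qed
qed

lemma consistent_level_bound:
  assumes "consistent n r l v" "k \<le> n"
  shows "level_sets n v k \<subseteq> {..<n + k}"
proof
  fix x assume "x \<in> level_sets n v k"
  then have "v k x" using assms(2) by (simp add: level_sets_def)
  then have "up_index n k x" by (rule consistentD(5)[OF assms(1)])
  then show "x \<in> {..<n + k}" using assms(2) by (auto simp: up_index_def)
qed

lemma consistent_interlaces:
  assumes c: "consistent n r l v" and k: "1 \<le> k" "k \<le> n"
  defines "X \<equiv> level_sets n v"
  shows "interlaces (X k) (X (k - 1))" "card (X k) = Suc (card (X (k - 1)))"
proof -
  have mem: "x \<in> X k \<longleftrightarrow> v k x" for x using k by (auto simp: X_def level_sets_def)
  have row: "card (X k \<inter> {..<x}) = card (X (k - 1) \<inter> {..<x}) + (if 1 \<le> x \<and> l k (x - 1) then 1 else 0)"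
    if "x < n + k" for x
    using consistent_row[OF c k] that by (simp add: X_def)
  have ex: "exactly_one (r k x) (1 \<le> x \<and> l k (x - 1)) (v k x)" if "x < n + k" for x
  proof -
    have "up_index n k x" using that k by (auto simp: up_index_def)
    then show ?thesis by (rule consistentD(7)[OF c])
  qed
  have sub: "X k \<subseteq> {..<n + k}" "X (k - 1) \<subseteq> {..<n + (k - 1)}"
    unfolding X_def using consistent_level_bound[OF c, of k] consistent_level_bound[OF c, of "k - 1"] k by simp_all
  \<comment> \<open>The last upward triangle of the row has no right neighbour, so it is matched
    downwards or to its left; in either case row \<open>k\<close> ends with a surplus of
    one.\<close>
  have top: "card (X k \<inter> {..<n + k}) = Suc (card (X (k - 1) \<inter> {..<n + k - 1}))"
  proof -
    have "\<not> r k (n + k - 1)" using consistentD(2)[OF c, of k "n + k - 1"] k by (auto simp: down_index_def)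
    then have "(if 1 \<le> n + k - 1 \<and> l k (n + k - 1 - 1) then 1 else 0) + (if v k (n + k - 1) then 1 else 0) = (1::nat)"
      using ex[of "n + k - 1"] k by (auto simp: exactly_one_def)
    moreover have "card (X k \<inter> {..<n + k}) = card (X k \<inter> {..<n + k - 1}) + (if v k (n + k - 1) then 1 else 0)"
      using card_Int_lessThan_Suc[of "X k" "n + k - 1"] k mem by simp
    ultimately show ?thesis using row[of "n + k - 1"] k by simp
  qed
  have full: "X k \<inter> {..<x} = X k" if "x \<ge> n + k" for x using sub(1) that by auto
  have full': "X (k - 1) \<inter> {..<x} = X (k - 1)" if "x \<ge> n + k - 1" for x using sub(2) that k by auto
  show card: "card (X k) = Suc (card (X (k - 1)))"
    using top full[of "n + k"] full'[of "n + k - 1"] by simp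
  show "interlaces (X k) (X (k - 1))" unfolding interlaces_def
  proof (intro allI)
    fix x
    show "card (X k \<inter> {..x}) \<le> Suc (card (X (k - 1) \<inter> {..<x})) \<and> card (X (k - 1) \<inter> {..<x}) \<le> card (X k \<inter> {..<x})"
    proof (cases "x < n + k")
      case True
      then show ?thesis
        using row[OF True] ex[OF True] mem[of x] card_Int_lessThan_Suc[of "X k" x]
        by (auto simp: exactly_one_def lessThan_Suc_atMost[symmetric])
    next
      case False
      then have "X k \<inter> {..x} = X k" "X k \<inter> {..<x} = X k" "X (k - 1) \<inter> {..<x} = X (k - 1)"
        using full[of x] full[of "Suc x"] full'[of x] by (auto simp: lessThan_Suc_atMost)
      then show ?thesis using card by simp
    qed
  qed
qed

text \<open>The upward triangle in column \<open>2 j + 1\<close> of row \<open>n + 1\<close> is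
  adjacent only to the downward triangles in columns \<open>2 j\<close> and \<open>2 j + 1\<close>.
  It covers one of them, and the other must be covered by a vertical edge.\<close>

lemma consistent_base:
  assumes c: "consistent n r l v"
  shows "level_sets n v n \<in> base_configs n"
proof -
  have "level_sets n v n \<subseteq> {..<2 * n}" using consistent_level_bound[OF c, of n] by (simp add: mult_2)
  moreover have "(2 * j \<in> level_sets n v n) \<noteq> (2 * j + 1 \<in> level_sets n v n)" if j: "j < n" for j
  proof -
    have "up_index n (Suc n) (2 * j + 1)" using j by (auto simp: up_index_def)
    then have u: "exactly_one (r (Suc n) (2 * j + 1)) (l (Suc n) (2 * j)) (v (Suc n) (2 * j + 1))"
      using consistentD(7)[OF c, of "Suc n" "2 * j + 1"] by simp
    have "\<not> v (Suc n) (2 * j + 1)" using consistentD(6)[OF c, of "Suc n" "2 * j + 1"] by (auto simp: down_index_def)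
    then have "r (Suc n) (2 * j + 1) \<noteq> l (Suc n) (2 * j)" using u by (auto simp: exactly_one_def)
    then show ?thesis
      using j by (auto simp: consistent_right[OF c] consistent_left[OF c] right_formula_def left_formula_def)
  qed
  ultimately show ?thesis by (simp add: base_configs_def)
qed

lemma consistent_patterns:
  assumes c: "consistent n r l v"
  shows "level_sets n v \<in> patterns n (level_sets n v n)"
proof -
  have card: "card (level_sets n v k) = k" if "k \<le> n" for k
    using that
  proof (induction k)
    case 0
    have "level_sets n v 0 = {}" using consistentD(5)[OF c, of 0] by (auto simp: level_sets_def up_index_def)
    then show ?case by simp
  next
    case (Suc k)
    then show ?case using consistent_interlaces(2)[OF c, of "Suc k"] by simp
  qed
  have "finite (level_sets n v k)" if "k \<le> n" for k
    using consistent_level_bound[OF c that] by (rule finite_subset) simp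
  moreover have "interlaces (level_sets n v (Suc j)) (level_sets n v j)" if "j < n" for j
    using consistent_interlaces(1)[OF c, of "Suc j"] that by simp
  moreover have "level_sets n v j = {}" if "j > n" for j using that by (simp add: level_sets_def)
  ultimately show ?thesis using card by (simp add: patterns_def)
qed

definition vert_formula :: "nat \<Rightarrow> (nat \<Rightarrow> nat set) \<Rightarrow> nat \<Rightarrow> nat \<Rightarrow> bool" where
  "vert_formula n X k x \<longleftrightarrow> k \<le> n \<and> x \<in> X k"

lemma patterns_row_cases:
  assumes A: "A \<in> base_configs n" "X \<in> patterns n A" and k: "1 \<le> k" "k \<le> n"
  shows "X k \<subseteq> {..<n + k}" "X (k - 1) \<subseteq> {..<n + k - 1}"
    and "card (X (k - 1) \<inter> {..<x}) \<le> card (X k \<inter> {..<x})"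
    and "card (X k \<inter> {..<Suc x}) \<le> Suc (card (X (k - 1) \<inter> {..<x}))"
    and "card (X k) = k" "card (X (k - 1)) = k - 1"
proof -
  show "X k \<subseteq> {..<n + k}" using pattern_level_subset[OF A k] k by fastforce
  show "X (k - 1) \<subseteq> {..<n + k - 1}"
  proof (cases "k = 1")
    case True then show ?thesis using A(2) by (auto simp: patterns_def)
  next
    case False
    then show ?thesis using pattern_level_subset[OF A, of "k - 1"] k by fastforce
  qed
  have "k - 1 < n" using k by simp
  then have "interlaces (X (Suc (k - 1))) (X (k - 1))"
    using A(2) unfolding patterns_def by blast
  then have il: "interlaces (X k) (X (k - 1))" using k by simp
  show "card (X (k - 1) \<inter> {..<x}) \<le> card (X k \<inter> {..<x})" using il by (simp add: interlaces_def)
  show "card (X k \<inter> {..<Suc x}) \<le> Suc (card (X (k - 1) \<inter> {..<x}))"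
    using il by (simp add: interlaces_def lessThan_Suc_atMost)
  show "card (X k) = k" "card (X (k - 1)) = k - 1" using A(2) k by (auto simp: patterns_def)
qed

text \<open>Interlacing keeps the surplus of row \<open>k\<close> over row \<open>k - 1\<close> in
  \<open>{0, 1}\<close>, so surplus and particles single out one edge at each triangle. The last
  column works because row \<open>k\<close> has exactly one particle more.\<close>

lemma patterns_consistent:
  assumes A: "A \<in> base_configs n" "X \<in> patterns n A" and n: "n \<ge> 1"
  shows "consistent n (right_formula n X) (left_formula n X) (vert_formula n X)"
proof -
  have Xn: "X n = A" using A(2) by (simp add: patterns_def)
  have X0: "X 0 = {}" using A(2) by (auto simp: patterns_def)
  have pair: "(2 * j \<in> X n) \<noteq> (2 * j + 1 \<in> X n)" if "j < n" for j
    using A(1) that Xn by (simp add: base_configs_def)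
  have bound: "x < n + k \<and> 1 \<le> k" if "x \<in> X k" "k \<le> n" for k x
    using that X0 patterns_row_cases(1)[OF A, of k] by (cases "k = 0") auto
  have up: "exactly_one (right_formula n X k x) (1 \<le> x \<and> left_formula n X k (x - 1)) (vert_formula n X k x)"
    if "up_index n k x" for k x
  proof (cases "k \<le> n")
    case True
    then have k: "1 \<le> k" "k \<le> n" "x < n + k" using that by (auto simp: up_index_def)
    have L: "1 \<le> x \<and> left_formula n X k (x - 1) \<longleftrightarrow> card (X k \<inter> {..<x}) = Suc (card (X (k - 1) \<inter> {..<x}))"
    proof (cases x)
      case (Suc y) then show ?thesis using k by (auto simp: left_formula_def)
    qed simp
    note row = patterns_row_cases[OF A k(1,2)]
    have V: "vert_formula n X k x \<longleftrightarrow> x \<in> X k" using k by (simp add: vert_formula_def)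
    show ?thesis
    proof (cases "Suc x < n + k")
      case True
      then have R: "right_formula n X k x \<longleftrightarrow> x \<notin> X k \<and> card (X k \<inter> {..<x}) = card (X (k - 1) \<inter> {..<x})"
        using k by (auto simp: right_formula_def)
      show ?thesis using row(3)[of x] row(4)[of x] card_Int_lessThan_Suc[of "X k" x]
        unfolding exactly_one_def R L V by (auto split: if_splits)
    next
      case False
      then have x: "Suc x = n + k" using k by simp
      then have R: "\<not> right_formula n X k x" using k by (auto simp: right_formula_def)
      have "X k \<inter> {..<Suc x} = X k" "X (k - 1) \<inter> {..<x} = X (k - 1)" using row(1,2) x by auto
      then have "card (X k \<inter> {..<Suc x}) = Suc (card (X (k - 1) \<inter> {..<x}))" using row(5,6) k by simp
      then show ?thesis using R card_Int_lessThan_Suc[of "X k" x]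
        unfolding exactly_one_def L V by (auto split: if_splits)
    qed
  next
    case False
    then have k: "k = Suc n" "odd x" "x < 2 * n" using that by (auto simp: up_index_def)
    then obtain j where j: "x = 2 * j + 1" by (auto elim: oddE)
    then show ?thesis using k pair[of j]
      by (auto simp: exactly_one_def right_formula_def left_formula_def vert_formula_def)
  qed
  have down: "exactly_one (right_formula n X k x) (left_formula n X k x) (1 \<le> k \<and> vert_formula n X (k - 1) x)"
    if "down_index n k x" for k x
  proof (cases "k \<le> n")
    case True
    then have k: "1 \<le> k" "k \<le> n" "Suc x < n + k" using that by (auto simp: down_index_def)
    note row = patterns_row_cases[OF A k(1,2)]
    have R: "right_formula n X k x \<longleftrightarrow> x \<notin> X k \<and> card (X k \<inter> {..<x}) = card (X (k - 1) \<inter> {..<x})"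
      and L: "left_formula n X k x \<longleftrightarrow> card (X k \<inter> {..<Suc x}) = Suc (card (X (k - 1) \<inter> {..<Suc x}))"
      and V: "1 \<le> k \<and> vert_formula n X (k - 1) x \<longleftrightarrow> x \<in> X (k - 1)"
      using k by (auto simp: right_formula_def left_formula_def vert_formula_def)
    show ?thesis
      using row(3)[of x] row(3)[of "Suc x"] row(4)[of x] row(4)[of "Suc x"]
        card_Int_lessThan_Suc[of "X k" x] card_Int_lessThan_Suc[of "X (k - 1)" x]
      unfolding exactly_one_def R L V by (auto split: if_splits)
  next
    case False
    then have k: "k = Suc n" "x < 2 * n" using that by (auto simp: down_index_def)
    then show ?thesis
      by (auto simp: exactly_one_def right_formula_def left_formula_def vert_formula_def)
  qed
  have "up_index n k x \<and> down_index n k x" if "right_formula n X k x" for k x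
    using that by (auto simp: right_formula_def up_index_def down_index_def)
  moreover have "up_index n k (Suc x) \<and> down_index n k x" if "left_formula n X k x" for k x
  proof -
    have "x \<noteq> 2 * n - 1" if "even x" using that n by presburger
    then show ?thesis using that by (auto simp: left_formula_def up_index_def down_index_def)
  qed
  moreover have "up_index n k x \<and> down_index n (Suc k) x" if "vert_formula n X k x" for k x
    using that bound[of x k] by (auto simp: vert_formula_def up_index_def down_index_def)
  ultimately show ?thesis using up down unfolding consistent_def by simp
qed

definition matching_levels :: "nat \<Rightarrow> plane set set \<Rightarrow> nat \<Rightarrow> nat set" where
  "matching_levels n M = level_sets n (\<lambda>k x. vert_edge n k x \<in> M)"

definition matching_of :: "nat \<Rightarrow> (nat \<Rightarrow> nat set) \<Rightarrow> plane set set" where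
  "matching_of n X = edge_set n (right_formula n X) (left_formula n X) (vert_formula n X)"

lemma matching_edges:
  assumes "n \<ge> 1" "M \<in> matchings n"
  shows "right_edge n k x \<in> M \<longleftrightarrow> right_formula n (matching_levels n M) k x"
    and "left_edge n k x \<in> M \<longleftrightarrow> left_formula n (matching_levels n M) k x"
    and "vert_edge n k x \<in> M \<longleftrightarrow> vert_formula n (matching_levels n M) k x"
proof -
  note c = matching_consistent[OF assms]
  show "right_edge n k x \<in> M \<longleftrightarrow> right_formula n (matching_levels n M) k x"
    using consistent_right[OF c] by (simp add: matching_levels_def)
  show "left_edge n k x \<in> M \<longleftrightarrow> left_formula n (matching_levels n M) k x"
    using consistent_left[OF c] by (simp add: matching_levels_def)
  have "k \<le> n" if "vert_edge n k x \<in> M"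
    using consistentD(6)[OF c, of k x] that by (auto simp: down_index_def)
  then show "vert_edge n k x \<in> M \<longleftrightarrow> vert_formula n (matching_levels n M) k x"
    by (auto simp: matching_levels_def level_sets_def vert_formula_def)
qed

definition all_patterns :: "nat \<Rightarrow> (nat \<Rightarrow> nat set) set" where
  "all_patterns n = (\<Union>A\<in>base_configs n. patterns n A)"

lemma bij_betw_matchings_patterns:
  assumes "n \<ge> 1"
  shows "bij_betw (matching_levels n) (matchings n) (all_patterns n)"
proof (rule bij_betw_byWitness[where f' = "matching_of n"])
  show "\<forall>M\<in>matchings n. matching_of n (matching_levels n M) = M"
  proof
    fix M assume M: "M \<in> matchings n"
    show "matching_of n (matching_levels n M) = M"
      by (subst (2) matching_eq_edge_set[OF assms M]) (simp add: matching_of_def matching_edges[OF assms M])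
  qed
  show "\<forall>X\<in>all_patterns n. matching_levels n (matching_of n X) = X"
  proof
    fix X assume "X \<in> all_patterns n"
    then have "X k = {}" if "k > n" for k using that by (auto simp: all_patterns_def patterns_def)
    then show "matching_levels n (matching_of n X) = X"
      by (auto simp: fun_eq_iff matching_levels_def matching_of_def level_sets_def vert_formula_def)
  qed
  show "matching_levels n ` matchings n \<subseteq> all_patterns n"
    using consistent_base[OF matching_consistent[OF assms]] consistent_patterns[OF matching_consistent[OF assms]]
    by (auto simp: all_patterns_def matching_levels_def)
  show "matching_of n ` all_patterns n \<subseteq> matchings n"
    using patterns_consistent[OF _ _ assms]
    by (auto simp: all_patterns_def matching_of_def edge_set_matching_iff[OF assms])
qed

lemma base_configs_finite: "finite (base_configs n)"
  by (rule finite_subset[of _ "Pow {..<2 * n}"]) (auto simp: base_configs_def)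

lemma base_configs_card:
  assumes "A \<in> base_configs n"
  shows "finite A" "card A = n"
  using assms unfolding base_configs_eq transversals_def by auto

lemma sum_all_patterns: "(\<Sum>X\<in>all_patterns n. f X) = (\<Sum>A\<in>base_configs n. \<Sum>X\<in>patterns n A. f X)"
  unfolding all_patterns_def
  by (rule sum.UNION_disjoint)
     (use base_configs_finite finite_patterns base_configs_card in \<open>auto simp: patterns_def\<close>)

lemma finite_all_patterns: "finite (all_patterns n)"
  unfolding all_patterns_def using base_configs_finite finite_patterns base_configs_card by blast

lemma finite_matchings: "n \<ge> 1 \<Longrightarrow> finite (matchings n)"
  using bij_betw_finite[OF bij_betw_matchings_patterns] finite_all_patterns by blast

lemma matchings_nonempty:
  assumes "n \<ge> 1"
  shows "matchings n \<noteq> {}"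
proof
  assume "matchings n = {}"
  then have "all_patterns n = {}" using bij_betw_matchings_patterns[OF assms] by (auto simp: bij_betw_def)
  then have "real (\<Sum>A\<in>base_configs n. card (patterns n A)) = 0"
    unfolding of_nat_eq_0_iff by (auto simp: all_patterns_def)
  then show False using sum_base_patterns(1)[of 1 n] assms by simp
qed

lemma expectation_random_matching:
  assumes "n \<ge> 1"
  shows "measure_pmf.expectation (random_matching n) f = (\<Sum>M\<in>matchings n. f M) / real (card (matchings n))"
  unfolding random_matching_def matchings_def[symmetric]
  by (rule integral_pmf_of_set) (use finite_matchings matchings_nonempty assms in auto)

theorem expectation_level_weight:
  assumes "1 \<le> k" "k \<le> n" "a \<noteq> 0" "1 + a \<noteq> 0"
  shows "measure_pmf.expectation (random_matching n)
      (\<lambda>M. \<Sum>x\<in>matching_levels n M k. (1 - a) ^ x * (1 + a) ^ (n + k - 1 - x)) =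
    level_sum a (n - k + 1) k / a"
proof -
  have n: "n \<ge> 1" using assms by simp
  let ?w = "\<lambda>x. (1 - a) ^ x * (1 + a) ^ (n + k - 1 - x)"
  have "(\<Sum>M\<in>matchings n. \<Sum>x\<in>matching_levels n M k. ?w x) = (\<Sum>X\<in>all_patterns n. \<Sum>x\<in>X k. ?w x)"
    by (rule sum.reindex_bij_betw[OF bij_betw_matchings_patterns[OF n]])
  also have "\<dots> = real (\<Sum>A\<in>base_configs n. card (patterns n A)) * (level_sum a (n - k + 1) k / a)"
    unfolding sum_all_patterns by (rule sum_base_patterns_weighted[OF assms])
  also have "(\<Sum>A\<in>base_configs n. card (patterns n A)) = card (all_patterns n)"
    using sum_all_patterns[of "\<lambda>_. 1::nat" n] by simp
  also have "\<dots> = card (matchings n)"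
    using bij_betw_same_card[OF bij_betw_matchings_patterns[OF n]] by simp
  finally have *: "(\<Sum>M\<in>matchings n. \<Sum>x\<in>matching_levels n M k. ?w x) =
      real (card (matchings n)) * (level_sum a (n - k + 1) k / a)" .
  have "card (matchings n) \<noteq> 0" using finite_matchings[OF n] matchings_nonempty[OF n] by simp
  then show ?thesis unfolding expectation_random_matching[OF n] * by simp
qed

section \<open>Tail bound for the extreme particles\<close>

lemma level_sum_divide:
  assumes "a \<noteq> 0"
  shows "level_sum a m k / a = (\<Sum>c\<le>k. \<Sum>b\<le>m + k. if b < c \<and> odd (c - b)
     then real (k choose c) * real ((m + k) choose b) * a ^ (b + c - 1) else 0)"
  unfolding level_sum_eq sum_divide_distrib
proof (intro sum.cong refl)
  fix b c
  have "a ^ (b + c) / a = a ^ (b + c - 1)" if "b < c"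
    using that assms by (cases "b + c") auto
  then show "(if b < c \<and> odd (c - b) then real (k choose c) * real ((m + k) choose b) * a ^ (b + c) else 0) / a =
    (if b < c \<and> odd (c - b) then real (k choose c) * real ((m + k) choose b) * a ^ (b + c - 1) else 0)"
    by (simp add: times_divide_eq_right[symmetric] del: times_divide_eq_right)
qed

text \<open>Only even exponents \<open>b + c - 1\<close> occur, so the quotient is even in
  \<open>a\<close>. This reflects the left-right symmetry of a level and lets one estimate serve
  both tails.\<close>

lemma level_sum_abs:
  assumes "a \<noteq> 0"
  shows "level_sum a m k / a = level_sum \<bar>a\<bar> m k / \<bar>a\<bar>"
proof -
  have "a ^ (b + c - 1) = \<bar>a\<bar> ^ (b + c - 1)" if "b < c" "odd (c - b)" for b c :: nat
    using that by (intro power_even_abs[symmetric]) presburger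
  moreover have "\<bar>a\<bar> \<noteq> 0" using assms by simp
  ultimately show ?thesis
    unfolding level_sum_divide[OF assms] level_sum_divide[OF \<open>\<bar>a\<bar> \<noteq> 0\<close>]
    by (intro sum.cong refl) auto
qed

text \<open>Only terms with \<open>b < c\<close> occur, and for them
  \<open>1 / \<tau>^(c - b)\<close> is at least 1. Inserting this factor and dropping the side
  conditions leaves a product of two binomial sums with a free parameter
  \<open>\<tau>\<close>.\<close>

lemma level_sum_le:
  assumes "a > 0" "0 < \<tau>" "\<tau> \<le> 1"
  shows "level_sum a m k \<le> (1 + a * \<tau>) ^ (m + k) * (1 + a / \<tau>) ^ k"
proof -
  have "level_sum a m k \<le> (\<Sum>c\<le>k. \<Sum>b\<le>m + k. real (k choose c) * (a / \<tau>) ^ c * (real ((m + k) choose b) * (a * \<tau>) ^ b))"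
    unfolding level_sum_eq
  proof (intro sum_mono)
    fix c b
    show "(if b < c \<and> odd (c - b) then real (k choose c) * real ((m + k) choose b) * a ^ (b + c) else 0)
      \<le> real (k choose c) * (a / \<tau>) ^ c * (real ((m + k) choose b) * (a * \<tau>) ^ b)"
    proof (cases "b < c")
      case True
      have "a ^ (b + c) * 1 \<le> a ^ (b + c) * (1 / \<tau> ^ (c - b))"
        using assms by (intro mult_left_mono) (auto simp: field_simps power_le_one)
      also have "1 / \<tau> ^ (c - b) = \<tau> ^ b / \<tau> ^ c"
        using True assms by (simp add: power_diff)
      also have "a ^ (b + c) * (\<tau> ^ b / \<tau> ^ c) = (a / \<tau>) ^ c * (a * \<tau>) ^ b"
        by (simp add: power_add power_divide power_mult_distrib)
      finally have "real (k choose c) * real ((m + k) choose b) * a ^ (b + c) \<le>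
        real (k choose c) * real ((m + k) choose b) * ((a / \<tau>) ^ c * (a * \<tau>) ^ b)"
        by (intro mult_left_mono) auto
      then show ?thesis using assms by (auto simp: mult_ac)
    next
      case False then show ?thesis using assms by simp
    qed
  qed
  also have "\<dots> = (1 + a / \<tau>) ^ k * (1 + a * \<tau>) ^ (m + k)"
    using binomial_ring[of "a / \<tau>" 1 k] binomial_ring[of "a * \<tau>" 1 "m + k"]
    by (simp add: sum_product add.commute)
  finally show ?thesis by (simp add: mult.commute)
qed

lemma one_plus_ge_exp:
  fixes a :: real
  assumes "\<bar>a\<bar> \<le> 1 / 2"
  shows "exp (a - a\<^sup>2) \<le> 1 + a"
proof -
  have "a - a\<^sup>2 \<le> ln (1 + a)"
  proof (cases "a \<ge> 0")
    case True then show ?thesis using ln_one_plus_pos_lower_bound[of a] assms by simp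
  next
    case False
    have "1 / (1 + a) \<le> exp (a\<^sup>2 - a)"
    proof -
      \<comment> \<open>For negative \<open>a\<close> the number \<open>a^2 - a\<close> is positive,
        so the exponential dominates its quadratic Taylor polynomial and the claim becomes a
        polynomial inequality.\<close>
      have "1 \<le> (1 + a) * (1 + (a\<^sup>2 - a) + (a\<^sup>2 - a)\<^sup>2 / 2)"
      proof -
        have e: "(1 + a) * (1 + (a\<^sup>2 - a) + (a\<^sup>2 - a)\<^sup>2 / 2) - 1 = a\<^sup>2 * (1 + a - a\<^sup>2 + a ^ 3) / 2"
          by (simp add: power2_eq_square power3_eq_cube field_simps)
        have "a\<^sup>2 \<le> 1 / 4" using assms power_mono[of "\<bar>a\<bar>" "1/2" 2] by (simp add: power2_eq_square)
        moreover have "\<bar>a ^ 3\<bar> \<le> 1 / 8" using assms power_mono[of "\<bar>a\<bar>" "1/2" 3] unfolding power_abs by (simp add: power_divide)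
        ultimately have "0 \<le> 1 + a - a\<^sup>2 + a ^ 3" using assms by linarith
        then have "0 \<le> a\<^sup>2 * (1 + a - a\<^sup>2 + a ^ 3) / 2" by simp
        then show ?thesis using e by linarith
      qed
      moreover have "1 + (a\<^sup>2 - a) + (a\<^sup>2 - a)\<^sup>2 / 2 \<le> exp (a\<^sup>2 - a)"
        using False by (intro exp_lower_Taylor_quadratic) (smt (verit) zero_le_power2)
      ultimately have "1 \<le> (1 + a) * exp (a\<^sup>2 - a)"
        using assms by (smt (verit) mult_left_mono abs_le_iff field_sum_of_halves)
      then show ?thesis using assms by (simp add: field_simps abs_le_iff)
    qed
    moreover have "0 < 1 / (1 + a)" using assms by (simp add: abs_le_iff)
    ultimately have "ln (1 / (1 + a)) \<le> ln (exp (a\<^sup>2 - a))" by (intro ln_mono) auto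
    moreover have "1 + a \<noteq> 0" using assms by (auto simp: abs_le_iff)
    ultimately show ?thesis by (simp add: ln_div)
  qed
  moreover have "0 < 1 + a" using assms by (simp add: abs_le_iff)
  ultimately show ?thesis by (metis exp_le_cancel_iff exp_ln)
qed

lemma weight_lower_bound:
  fixes a :: real
  assumes "\<bar>a\<bar> \<le> 1 / 2" "x \<le> N"
  shows "exp (a * (real N - 2 * real x) - a\<^sup>2 * real N) \<le> (1 - a) ^ x * (1 + a) ^ (N - x)"
proof -
  have "exp (a * (real N - 2 * real x) - a\<^sup>2 * real N) = exp (real x * (- a - a\<^sup>2)) * exp (real (N - x) * (a - a\<^sup>2))"
    using assms(2) by (simp add: of_nat_diff algebra_simps flip: exp_add)
  also have "\<dots> = exp (- a - a\<^sup>2) ^ x * exp (a - a\<^sup>2) ^ (N - x)" by (simp only: exp_of_nat_mult)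
  also have "\<dots> \<le> (1 - a) ^ x * (1 + a) ^ (N - x)"
    using one_plus_ge_exp[of a] one_plus_ge_exp[of "-a"] assms(1)
    by (intro mult_mono power_mono) (auto simp: abs_le_iff)
  finally show ?thesis .
qed

lemma one_plus_power_le_exp:
  fixes x :: real assumes "x \<ge> 0" shows "(1 + x) ^ n \<le> exp (real n * x)"
proof -
  have "(1 + x) ^ n \<le> exp x ^ n" using assms by (intro power_mono exp_ge_add_one_self) auto
  then show ?thesis by (simp add: exp_of_nat_mult)
qed

lemma matching_levels_pattern:
  assumes "n \<ge> 1" "M \<in> matchings n"
  shows "\<exists>A\<in>base_configs n. matching_levels n M \<in> patterns n A"
  using bij_betwE[OF bij_betw_matchings_patterns[OF assms(1)]] assms(2) by (auto simp: all_patterns_def)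

lemma matching_levels_facts:
  assumes "M \<in> matchings n" "1 \<le> k" "k \<le> n"
  shows "finite (matching_levels n M k)" "card (matching_levels n M k) = k"
    and "x \<in> matching_levels n M k \<Longrightarrow> x \<le> n + k - 1"
proof -
  obtain A where A: "A \<in> base_configs n" "matching_levels n M \<in> patterns n A"
    using matching_levels_pattern[of n M] assms by auto
  show "finite (matching_levels n M k)" "card (matching_levels n M k) = k" using A(2) assms by (auto simp: patterns_def)
  show "x \<in> matching_levels n M k \<Longrightarrow> x \<le> n + k - 1" using pattern_level_subset[OF A assms(2,3)] by simp
qed

lemma set_pmf_random_matching: "n \<ge> 1 \<Longrightarrow> set_pmf (random_matching n) = matchings n"
  unfolding random_matching_def matchings_def[symmetric]
  using finite_matchings matchings_nonempty by (simp add: set_pmf_of_set)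

lemma integrable_random_matching:
  fixes f :: "plane set set \<Rightarrow> real"
  assumes "n \<ge> 1"
  shows "integrable (measure_pmf (random_matching n)) f"
  by (rule integrable_measure_pmf_finite) (simp add: set_pmf_random_matching[OF assms] finite_matchings[OF assms])

text \<open>Markov's inequality for the sum of the weights, which is at least \<open>t\<close> as
  soon as one particle lies beyond the threshold. The sign of \<open>a\<close> selects the
  tail.\<close>

lemma edge_particle_tail:
  assumes k: "1 \<le> k" "k \<le> n" and \<delta>: "0 < \<delta>" "\<delta> \<le> 2" and s: "s = 1 \<or> s = (-1::real)"
  shows "measure_pmf.prob (random_matching n)
     {M. \<exists>x\<in>matching_levels n M k. s * (real (n + k - 1) - 2 * real x) \<ge> 2 * sqrt (real k * real n) + \<delta> * real n}
     \<le> 4 / \<delta> * exp 1 * exp (- \<delta>\<^sup>2 * real n / 8)"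
proof -
  \<comment> \<open>With \<open>N \<le> 2 n\<close> the final exponent is at most
    \<open>n (2 a^2 - \<bar>a\<bar> \<delta>)\<close> up to a constant, which is smallest at
    \<open>\<bar>a\<bar> = \<delta> / 4\<close>; then \<open>\<delta> \<le> 2\<close> gives the
    bound \<open>1 / 2\<close> needed for the weight.\<close>
  define a where "a = s * \<delta> / 4"
  define N where "N = n + k - 1"
  have n: "n \<ge> 1" using k by simp
  have a: "\<bar>a\<bar> = \<delta> / 4" "a \<noteq> 0" "1 + a \<noteq> 0" "\<bar>a\<bar> \<le> 1 / 2" using s \<delta> by (auto simp: a_def)
  let ?w = "\<lambda>x. (1 - a) ^ x * (1 + a) ^ (N - x)"
  let ?y = "2 * sqrt (real k * real n) + \<delta> * real n"
  let ?E = "{M. \<exists>x\<in>matching_levels n M k. s * (real N - 2 * real x) \<ge> ?y}"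
  have wpos: "?w x \<ge> 0" for x using a(4) by (auto simp: abs_le_iff)
  define t where "t = exp (\<bar>a\<bar> * ?y - a\<^sup>2 * real N)"
  have "t > 0" by (simp add: t_def)
  have "t * indicator ?E M \<le> (\<Sum>x\<in>matching_levels n M k. ?w x)" if M: "M \<in> matchings n" for M
  proof (cases "M \<in> ?E")
    case True
    then obtain x where x: "x \<in> matching_levels n M k" "s * (real N - 2 * real x) \<ge> ?y" by blast
    note facts = matching_levels_facts[OF M k]
    have "\<bar>a\<bar> * ?y \<le> \<bar>a\<bar> * (s * (real N - 2 * real x))" using x(2) by (intro mult_left_mono) auto
    also have "\<dots> = a * (real N - 2 * real x)" using s \<delta> by (auto simp: a_def)
    finally have "t \<le> exp (a * (real N - 2 * real x) - a\<^sup>2 * real N)" by (simp add: t_def)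
    also have "\<dots> \<le> ?w x" by (rule weight_lower_bound) (use a facts(3)[OF x(1)] in \<open>auto simp: N_def\<close>)
    also have "\<dots> \<le> (\<Sum>x\<in>matching_levels n M k. ?w x)"
      by (rule member_le_sum) (use x facts wpos in auto)
    finally show ?thesis using True by simp
  next
    case False
    then show ?thesis using wpos by (simp add: sum_nonneg)
  qed
  then have "measure_pmf.expectation (random_matching n) (\<lambda>M. t * indicator ?E M) \<le>
      measure_pmf.expectation (random_matching n) (\<lambda>M. \<Sum>x\<in>matching_levels n M k. ?w x)"
    by (intro integral_mono_AE integrable_random_matching[OF n] AE_pmfI) (simp add: set_pmf_random_matching[OF n])
  then have "t * measure_pmf.prob (random_matching n) ?E \<le> level_sum a (n - k + 1) k / a"
    using expectation_level_weight[OF k a(2,3)] by (simp add: N_def)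
  also have "\<dots> \<le> exp (\<bar>a\<bar> * (2 * sqrt (real k * real n) + 1)) / \<bar>a\<bar>"
  proof -
    \<comment> \<open>This choice minimises \<open>n \<tau> + k / \<tau>\<close>.\<close>
    define \<tau> where "\<tau> = sqrt (real k / real n)"
    have \<tau>: "0 < \<tau>" "\<tau> \<le> 1" using k by (auto simp: \<tau>_def)
    have t1: "real n * \<tau> = sqrt (real k * real n)"
      using k by (simp add: \<tau>_def real_sqrt_divide real_sqrt_mult field_simps)
    have t2: "real k / \<tau> = sqrt (real k * real n)"
    proof -
      have "\<tau> * sqrt (real k * real n) = real k" using k by (simp add: \<tau>_def flip: real_sqrt_mult)
      then show ?thesis using \<tau> by (simp add: field_simps)
    qed
    have "level_sum \<bar>a\<bar> (n - k + 1) k \<le> (1 + \<bar>a\<bar> * \<tau>) ^ (n - k + 1 + k) * (1 + \<bar>a\<bar> / \<tau>) ^ k"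
      by (rule level_sum_le) (use a \<tau> in auto)
    also have "n - k + 1 + k = Suc n" using k by simp
    also have "(1 + \<bar>a\<bar> * \<tau>) ^ Suc n * (1 + \<bar>a\<bar> / \<tau>) ^ k \<le> exp (real (Suc n) * (\<bar>a\<bar> * \<tau>)) * exp (real k * (\<bar>a\<bar> / \<tau>))"
      using \<tau> by (intro mult_mono one_plus_power_le_exp) auto
    also have "\<dots> = exp (\<bar>a\<bar> * (real n * \<tau> + \<tau> + real k / \<tau>))" by (simp add: algebra_simps flip: exp_add)
    also have "\<dots> \<le> exp (\<bar>a\<bar> * (2 * sqrt (real k * real n) + 1))"
      using \<tau> a unfolding t1 t2 exp_le_cancel_iff by (intro mult_left_mono) auto
    finally show ?thesis unfolding level_sum_abs[OF a(2)] by (rule divide_right_mono) simp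
  qed
  finally have "measure_pmf.prob (random_matching n) ?E \<le> exp (\<bar>a\<bar> * (2 * sqrt (real k * real n) + 1)) / \<bar>a\<bar> / t"
    using \<open>t > 0\<close> by (subst pos_le_divide_eq) (simp_all only: mult.commute)
  also have "\<dots> = 1 / \<bar>a\<bar> * exp (\<bar>a\<bar> - \<bar>a\<bar> * \<delta> * real n + a\<^sup>2 * real N)"
  proof -
    have "exp (\<bar>a\<bar> * (2 * sqrt (real k * real n) + 1)) / \<bar>a\<bar> / t =
        1 / \<bar>a\<bar> * exp (\<bar>a\<bar> * (2 * sqrt (real k * real n) + 1) - (\<bar>a\<bar> * ?y - a\<^sup>2 * real N))"
      by (simp add: t_def exp_diff)
    also have "\<bar>a\<bar> * (2 * sqrt (real k * real n) + 1) - (\<bar>a\<bar> * ?y - a\<^sup>2 * real N) =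
        \<bar>a\<bar> - \<bar>a\<bar> * \<delta> * real n + a\<^sup>2 * real N"
      by (simp add: algebra_simps)
    finally show ?thesis .
  qed
  also have "\<dots> \<le> 4 / \<delta> * exp (1 - \<delta>\<^sup>2 * real n / 8)"
  proof -
    have a2: "a\<^sup>2 = \<delta>\<^sup>2 / 16" using s by (auto simp: a_def power2_eq_square)
    have "real N \<le> 2 * real n" using k by (simp add: N_def)
    then have "\<delta>\<^sup>2 / 16 * real N \<le> \<delta>\<^sup>2 / 16 * (2 * real n)" by (intro mult_left_mono) auto
    moreover have "\<delta>\<^sup>2 / 16 * (2 * real n) = \<delta>\<^sup>2 * real n / 8" by simp
    moreover have "\<delta> / 4 * \<delta> * real n = \<delta>\<^sup>2 * real n / 4" by (simp add: power2_eq_square)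
    ultimately have "\<bar>a\<bar> - \<bar>a\<bar> * \<delta> * real n + a\<^sup>2 * real N \<le> 1 - \<delta>\<^sup>2 * real n / 8"
      using \<delta> unfolding a2 a(1) by linarith
    then show ?thesis unfolding a(1) using \<delta> by (simp add: divide_right_mono)
  qed
  also have "\<dots> = 4 / \<delta> * exp 1 * exp (- \<delta>\<^sup>2 * real n / 8)" by (simp only: mult.assoc exp_add[symmetric]) simp
  finally show ?thesis by (simp add: N_def)
qed

text \<open>The coefficient of \<open>a^p\<close> in the weight
  \<open>(1 - a)^x (1 + a)^(N - x)\<close>, a Krawtchouk polynomial in \<open>x\<close>.\<close>

definition kraw :: "nat \<Rightarrow> nat \<Rightarrow> nat \<Rightarrow> real" where
  "kraw N p x = coeff (kraw_poly (N - x) x) p"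

text \<open>The logarithmic derivative of \<open>(1 + u)^A (1 - u)^B\<close>, cleared of
  denominators. Comparing coefficients gives a three-term recursion, which avoids explicit
  alternating sums.\<close>

lemma kraw_poly_ode: "[:1, 0, -1:] * pderiv (kraw_poly A B) = [:real A - real B, - (real A + real B):] * kraw_poly A B"
proof -
  have 1: "[:1, b:] * pderiv ([:1, b:] ^ A) = Polynomial.smult (real A * b) ([:1, b:] ^ A)" for b :: real and A
  proof (cases A)
    case (Suc m)
    then show ?thesis by (simp only: pderiv_power_Suc) (simp add: pderiv_pCons mult.assoc mult.commute[of b])
  qed simp
  have q: "[:1, 0, -1:] = [:1, 1:] * [:1, -1 :: real:]" by simp
  have "[:1, 0, -1:] * pderiv (kraw_poly A B) =
     [:1, -1:] * ([:1, 1:] * pderiv ([:1, 1:] ^ A)) * [:1, -1:] ^ B + [:1, 1:] * [:1, 1:] ^ A * ([:1, -1:] * pderiv ([:1, -1:] ^ B))"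
    unfolding q kraw_poly_def pderiv_mult by (simp only: algebra_simps)
  also have "\<dots> = (Polynomial.smult (real A) [:1, -1:] - Polynomial.smult (real B) [:1, 1:]) * kraw_poly A B"
    unfolding 1 kraw_poly_def by (simp only: algebra_simps mult_smult_left mult_smult_right) simp
  also have "Polynomial.smult (real A) [:1, -1:] - Polynomial.smult (real B) [:1, 1:] = [:real A - real B, - (real A + real B):]"
    by simp
  finally show ?thesis .
qed

lemma kraw_recursion:
  assumes "x \<le> N"
  shows "kraw N 0 x = 1" "kraw N 1 x = real N - 2 * real x"
    and "real (p + 2) * kraw N (p + 2) x = (real N - 2 * real x) * kraw N (p + 1) x - (real N - real p) * kraw N p x"
proof -
  let ?f = "kraw_poly (N - x) x"
  note ode = kraw_poly_ode[of "N - x" x]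
  have Y: "real (N - x) - real x = real N - 2 * real x" "real (N - x) + real x = real N"
    using assms by (auto simp: of_nat_diff)
  have l: "coeff ([:1, 0, -1:] * pderiv ?f) p = coeff (pderiv ?f) p - (if p < 2 then 0 else coeff (pderiv ?f) (p - 2))" for p
    by (cases p; cases "p - 1") (auto simp: numeral_2_eq_2)
  have r: "coeff ([:c, d:] * ?f) p = c * coeff ?f p + (if p = 0 then 0 else d * coeff ?f (p - 1))" for c d p
    by (cases p) auto
  show 0: "kraw N 0 x = 1" by (simp add: kraw_def kraw_poly_def coeff_mult_0 coeff_0_power)
  show "kraw N 1 x = real N - 2 * real x"
    using arg_cong[OF ode, of "\<lambda>p. coeff p 0"] 0 unfolding l r Y by (simp add: coeff_pderiv kraw_def)
  show "real (p + 2) * kraw N (p + 2) x = (real N - 2 * real x) * kraw N (p + 1) x - (real N - real p) * kraw N p x"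
    using arg_cong[OF ode, of "\<lambda>q. coeff q (p + 1)"] unfolding l r Y
    by (cases p) (auto simp: coeff_pderiv kraw_def algebra_simps numeral_2_eq_2)
qed

section \<open>Moments of a level\<close>

text \<open>In the recursion the first term builds up \<open>(N - 2 x)^p / p!\<close>, while the
  second is of order \<open>n\<close> times a Krawtchouk polynomial of degree \<open>p - 2\<close>
  and hence smaller by a factor \<open>n\<close>. The error is uniform in \<open>x\<close>.\<close>

lemma kraw_approx:
  "\<exists>C\<ge>0. \<forall>n N x. 1 \<le> n \<longrightarrow> N \<le> 2 * n \<longrightarrow> x \<le> N \<longrightarrow>
     \<bar>kraw N p x - (real N - 2 * real x) ^ p / fact p\<bar> \<le> C * real n ^ p / real n"
proof (induction p rule: less_induct)
  case (less p)
  consider "p = 0" | "p = 1" | q where "p = q + 2"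
    by (metis One_nat_def add_2_eq_Suc' not0_implies_Suc)
  then show ?case
  proof cases
    case 1
    then show ?thesis by (intro exI[of _ 0]) (auto simp: kraw_recursion(1))
  next
    case 2
    then show ?thesis using kraw_recursion(2) by (intro exI[of _ 0]) auto
  next
    case (3 q)
    obtain C0 where C0: "C0 \<ge> 0" "\<And>n N x. 1 \<le> n \<Longrightarrow> N \<le> 2 * n \<Longrightarrow> x \<le> N \<Longrightarrow>
       \<bar>kraw N q x - (real N - 2 * real x) ^ q / fact q\<bar> \<le> C0 * real n ^ q / real n"
      using less.IH[of q] 3 by auto
    obtain C1 where C1: "C1 \<ge> 0" "\<And>n N x. 1 \<le> n \<Longrightarrow> N \<le> 2 * n \<Longrightarrow> x \<le> N \<Longrightarrow>
       \<bar>kraw N (q + 1) x - (real N - 2 * real x) ^ (q + 1) / fact (q + 1)\<bar> \<le> C1 * real n ^ (q + 1) / real n"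
      using less.IH[of "q + 1"] 3 by auto
    define C where "C = 2 * C1 + (2 + real q) * (2 ^ q + C0)"
    have "\<bar>kraw N p x - (real N - 2 * real x) ^ p / fact p\<bar> \<le> C * real n ^ p / real n"
      if n: "1 \<le> n" and N: "N \<le> 2 * n" and x: "x \<le> N" for n N x
    proof -
      define Y where "Y = real N - 2 * real x"
      have n0: "real n \<ge> 1" using n by simp
      have Y: "\<bar>Y\<bar> \<le> 2 * real n" using N x by (auto simp: Y_def)
      define d where "d = kraw N (q + 1) x - Y ^ (q + 1) / fact (q + 1)"
      have d: "\<bar>d\<bar> \<le> C1 * real n ^ q" using C1(2)[OF n N x] n0 by (simp add: d_def Y_def)
      have k: "\<bar>kraw N q x\<bar> \<le> (2 ^ q + C0) * real n ^ q"
      proof -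
        have "\<bar>Y ^ q / fact q\<bar> \<le> \<bar>Y\<bar> ^ q" using mult_left_mono[OF fact_ge_1, of "\<bar>Y\<bar> ^ q" q] by (simp add: power_abs divide_le_eq)
        also have "\<dots> \<le> (2 * real n) ^ q" using Y by (intro power_mono) auto
        finally have 1: "\<bar>Y ^ q / fact q\<bar> \<le> 2 ^ q * real n ^ q" by (simp add: power_mult_distrib)
        have "C0 * real n ^ q / real n \<le> C0 * real n ^ q"
          using mult_left_mono[of 1 "real n" "C0 * real n ^ q"] n0 C0(1) by (simp add: divide_le_eq)
        then have "\<bar>kraw N q x - Y ^ q / fact q\<bar> \<le> C0 * real n ^ q"
          using C0(2)[OF n N x] by (simp add: Y_def)
        with 1 have "\<bar>kraw N q x\<bar> \<le> C0 * real n ^ q + 2 ^ q * real n ^ q" by linarith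
        then show ?thesis by (simp add: algebra_simps)
      qed
      have "kraw N p x - Y ^ p / fact p = (Y * d - (real N - real q) * kraw N q x) / real (q + 2)"
      proof -
        have "real (q + 2) * kraw N p x = Y * (d + Y ^ (q + 1) / fact (q + 1)) - (real N - real q) * kraw N q x"
          using kraw_recursion(3)[OF x, of q] 3 by (simp add: d_def Y_def)
        moreover have "real (q + 2) * (Y ^ p / fact p) = Y * (Y ^ (q + 1) / fact (q + 1))"
        proof -
          have f: "(fact (q + 2) :: real) = real (q + 2) * fact (q + 1)" by (simp add: algebra_simps)
          have "Y ^ (q + 2) = Y * Y ^ (q + 1)" by simp
          moreover have "real (q + 2) \<noteq> 0" by linarith
          moreover have "c * (u / (c * v)) = u / v" if "c \<noteq> 0" for c u v :: real using that by simp
          ultimately show ?thesis unfolding 3 f by (simp only: times_divide_eq_right)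
        qed
        ultimately have "real (q + 2) * (kraw N p x - Y ^ p / fact p) = Y * d - (real N - real q) * kraw N q x"
          by (simp add: right_diff_distrib distrib_left)
        then show ?thesis by (metis add_2_eq_Suc' nonzero_mult_div_cancel_left of_nat_eq_0_iff Zero_neq_Suc)
      qed
      also have "\<bar>\<dots>\<bar> \<le> \<bar>Y * d - (real N - real q) * kraw N q x\<bar>"
        using mult_left_mono[of 1 "2 + real q" "\<bar>Y * d - (real N - real q) * kraw N q x\<bar>"]
        by (simp add: abs_divide divide_le_eq add.commute)
      also have "\<dots> \<le> \<bar>Y\<bar> * \<bar>d\<bar> + \<bar>real N - real q\<bar> * \<bar>kraw N q x\<bar>"
        by (metis abs_triangle_ineq4 abs_mult)
      also have "\<dots> \<le> (2 * real n) * (C1 * real n ^ q) + ((2 + real q) * real n) * ((2 ^ q + C0) * real n ^ q)"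
      proof -
        have "\<bar>real N - real q\<bar> \<le> 2 * real n + real q" using N by linarith
        also have "\<dots> \<le> (2 + real q) * real n" using n0 mult_left_mono[of 1 "real n" "real q"] by (simp add: algebra_simps)
        finally show ?thesis using Y d k C1(1) C0(1) by (intro add_mono mult_mono) auto
      qed
      also have "\<dots> = C * real n ^ p / real n" using n0 3 by (simp add: C_def field_simps)
      finally show ?thesis by (simp add: Y_def)
    qed
    moreover have "C \<ge> 0" using C0(1) C1(1) by (simp add: C_def)
    ultimately show ?thesis by blast
  qed
qed

text \<open>The coefficient of \<open>a^p\<close> in \<open>level_sum a (n - k + 1) k / a\<close>;
  it vanishes for odd \<open>p\<close> by the parity of \<open>c - b\<close>.\<close>

definition level_moment :: "nat \<Rightarrow> nat \<Rightarrow> nat \<Rightarrow> real" where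
  "level_moment n k p = (\<Sum>c\<le>k. \<Sum>b\<le>Suc n. if b + c = Suc p \<and> b < c \<and> odd (c - b)
     then real (k choose c) * real (Suc n choose b) else 0)"

lemma poly_eq_if_agree:
  fixes p q :: "real poly"
  assumes "finite S" "\<And>a. a \<notin> S \<Longrightarrow> poly p a = poly q a"
  shows "p = q"
proof (rule ccontr)
  assume "p \<noteq> q"
  then have "p - q \<noteq> 0" by simp
  then have "finite {a. poly (p - q) a = 0}" by (rule poly_roots_finite)
  moreover have "UNIV \<subseteq> S \<union> {a. poly (p - q) a = 0}" using assms(2) by auto
  ultimately have "finite (UNIV :: real set)" using assms(1) finite_subset by blast
  then show False using infinite_UNIV_char_0 by blast
qed

text \<open>Both sides of \<open>expectation_level_weight\<close>, multiplied by \<open>a\<close>,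
  are polynomials in \<open>a\<close> that agree except possibly at 0 and -1, so their coefficients
  agree. The factor \<open>a\<close> is the \<open>pCons 0\<close> on the left.\<close>

lemma expectation_kraw:
  assumes k: "1 \<le> k" "k \<le> n"
  shows "measure_pmf.expectation (random_matching n) (\<lambda>M. \<Sum>x\<in>matching_levels n M k. kraw (n + k - 1) p x) = level_moment n k p"
proof -
  have n: "n \<ge> 1" using k by simp
  let ?N = "n + k - 1" and ?c = "1 / real (card (matchings n))"
  define P where "P = Polynomial.smult ?c (\<Sum>M\<in>matchings n. \<Sum>x\<in>matching_levels n M k. kraw_poly (?N - x) x)"
  define Q where "Q = (\<Sum>c\<le>k. \<Sum>b\<le>Suc n. if b < c \<and> odd (c - b)
     then monom (real (k choose c) * real (Suc n choose b)) (b + c) else 0)"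
  have agree: "poly (pCons 0 P) a = poly Q a" if "a \<notin> {0, -1}" for a
  proof -
    have a: "a \<noteq> 0" "1 + a \<noteq> 0" using that by auto
    have "poly P a = measure_pmf.expectation (random_matching n)
      (\<lambda>M. \<Sum>x\<in>matching_levels n M k. (1 - a) ^ x * (1 + a) ^ (n + k - 1 - x))"
      unfolding expectation_random_matching[OF n] P_def
      by (simp add: poly_sum kraw_poly_def mult.commute)
    also have "\<dots> = level_sum a (n - k + 1) k / a" by (rule expectation_level_weight[OF k a])
    finally have "poly (pCons 0 P) a = level_sum a (n - k + 1) k" using a by simp
    also have "n - k + 1 + k = Suc n" using k by simp
    then have "level_sum a (n - k + 1) k = poly Q a"
      unfolding level_sum_eq Q_def poly_sum
      by (intro sum.cong) (auto simp: poly_monom)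
    finally show ?thesis .
  qed
  have "pCons 0 P = Q" by (rule poly_eq_if_agree[where S = "{0, -1}", OF _ agree]) simp_all
  then have "coeff P p = coeff Q (Suc p)" by (metis coeff_pCons_Suc)
  moreover have "coeff P p = measure_pmf.expectation (random_matching n) (\<lambda>M. \<Sum>x\<in>matching_levels n M k. kraw ?N p x)"
    unfolding expectation_random_matching[OF n] P_def by (simp add: coeff_sum kraw_def)
  moreover have "coeff Q (Suc p) = level_moment n k p"
    unfolding Q_def level_moment_def coeff_sum by (intro sum.cong refl) auto
  ultimately show ?thesis by simp
qed

lemma level_moment_odd:
  assumes "odd p" shows "level_moment n k p = 0"
  unfolding level_moment_def
proof (intro sum.neutral ballI)
  fix c b
  show "(if b + c = Suc p \<and> b < c \<and> odd (c - b) then real (k choose c) * real (Suc n choose b) else 0) = 0"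
  proof -
    have "\<not> (b + c = Suc p \<and> b < c \<and> odd (c - b))"
    proof
      assume a: "b + c = Suc p \<and> b < c \<and> odd (c - b)"
      then have "even (c + b)" using assms by (simp add: add.commute)
      then show False using a by (simp add: even_diff_nat)
    qed
    then show ?thesis by (rule if_not_P)
  qed
qed

lemma level_moment_even:
  assumes "k \<le> n"
  shows "level_moment n k (2 * l) = (\<Sum>b\<le>l. real (k choose (2 * l + 1 - b)) * real (Suc n choose b))"
proof -
  let ?L = "2 * l + 1"
  have "level_moment n k (2 * l) = (\<Sum>c\<le>k. \<Sum>b\<le>Suc n. if c = ?L - b \<and> b \<le> l then real (k choose c) * real (Suc n choose b) else 0)"
    unfolding level_moment_def
  proof (intro sum.cong refl)
    fix c b
    have "b + c = Suc (2 * l) \<and> b < c \<and> odd (c - b) \<longleftrightarrow> c = ?L - b \<and> b \<le> l"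
    proof
      assume "c = ?L - b \<and> b \<le> l"
      moreover from this obtain d where "l = b + d" using le_Suc_ex by blast
      ultimately show "b + c = Suc (2 * l) \<and> b < c \<and> odd (c - b)" by simp
    qed auto
    then show "(if b + c = Suc (2 * l) \<and> b < c \<and> odd (c - b) then real (k choose c) * real (Suc n choose b) else 0) =
      (if c = ?L - b \<and> b \<le> l then real (k choose c) * real (Suc n choose b) else 0)" by simp
  qed
  also have "\<dots> = (\<Sum>b\<le>Suc n. \<Sum>c\<le>k. if c = ?L - b then (if b \<le> l then real (k choose (?L - b)) * real (Suc n choose b) else 0) else 0)"
    by (subst sum.swap) (intro sum.cong refl, auto)
  also have "\<dots> = (\<Sum>b\<le>Suc n. if b \<le> l then real (k choose (?L - b)) * real (Suc n choose b) else 0)"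
    by (intro sum.cong refl) (auto simp: sum.delta binomial_eq_0)
  also have "\<dots> = (\<Sum>b\<le>max l (Suc n). if b \<le> l then real (k choose (?L - b)) * real (Suc n choose b) else 0)"
    by (rule sum.mono_neutral_left) (auto simp: binomial_eq_0)
  also have "\<dots> = (\<Sum>b\<le>l. if b \<le> l then real (k choose (?L - b)) * real (Suc n choose b) else 0)"
    by (rule sum.mono_neutral_right) auto
  finally show ?thesis by simp
qed

lemma tendsto_binomial_scaled:
  assumes "filterlim N at_top sequentially" "(\<lambda>i. real (k i) / real (N i)) \<longlonglongrightarrow> \<kappa>"
  shows "(\<lambda>i. real (k i choose c) / real (N i) ^ c) \<longlonglongrightarrow> \<kappa> ^ c / fact c"
proof (induction c)
  case 0 then show ?case by simp
next
  case (Suc c)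
  have inv: "(\<lambda>i. real c / real (N i)) \<longlonglongrightarrow> 0"
    using assms(1) by (intro tendsto_divide_0[OF tendsto_const])
      (auto intro: filterlim_at_top_imp_at_infinity filterlim_compose[OF filterlim_real_sequentially])
  have "(\<lambda>i. (real (k i choose c) / real (N i) ^ c) * (real (k i) / real (N i) - real c / real (N i)) / real (Suc c))
    \<longlonglongrightarrow> \<kappa> ^ c / fact c * (\<kappa> - 0) / real (Suc c)"
    by (intro tendsto_intros Suc assms inv) auto
  moreover
  have "real (k choose Suc c) = real (k choose c) * (real k - real c) / real (Suc c)" for k
  proof (cases "c \<le> k")
    case True
    have "Suc c * (k choose Suc c) = (k - c) * (k choose c)"
      using binomial_absorb_comp[of k c] binomial_absorption[of c k] by simp
    then have "real (Suc c) * real (k choose Suc c) = (real k - real c) * real (k choose c)"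
      using True by (metis of_nat_diff of_nat_mult)
    then show ?thesis by (simp add: field_simps del: of_nat_Suc)
  qed (simp add: binomial_eq_0)
  then have "(real (k i choose c) / real (N i) ^ c) * (real (k i) / real (N i) - real c / real (N i)) / real (Suc c) =
      real (k i choose Suc c) / real (N i) ^ Suc c" for i
    by (simp add: diff_divide_distrib[symmetric] mult.commute)
  moreover have "\<kappa> ^ c / fact c * (\<kappa> - 0) / real (Suc c) = \<kappa> ^ Suc c / fact (Suc c)"
    by (simp add: field_simps)
  ultimately show ?case by simp
qed

lemma tendsto_level_moment:
  assumes N: "filterlim N at_top sequentially" and k: "\<And>i. k i \<le> N i"
    and lim: "(\<lambda>i. real (k i) / real (N i)) \<longlonglongrightarrow> \<kappa>"
  shows "(\<lambda>i. level_moment (N i) (k i) (2 * l) / real (N i) ^ (2 * l + 1)) \<longlonglongrightarrow>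
    (\<Sum>b\<le>l. \<kappa> ^ (2 * l + 1 - b) / (fact (2 * l + 1 - b) * fact b))"
proof -
  have inv: "(\<lambda>i. 1 / real (N i)) \<longlonglongrightarrow> 0"
    using N by (intro tendsto_divide_0[OF tendsto_const])
      (auto intro: filterlim_at_top_imp_at_infinity filterlim_compose[OF filterlim_real_sequentially])
  have pos: "\<forall>\<^sub>F i in sequentially. 1 \<le> N i" using N by (simp add: filterlim_at_top)
  have one: "(\<lambda>i. real (Suc (N i)) / real (N i)) \<longlonglongrightarrow> 1"
  proof (rule Lim_transform_eventually)
    show "(\<lambda>i. 1 + 1 / real (N i)) \<longlonglongrightarrow> 1" using tendsto_add[OF tendsto_const inv, of 1] by simp
    show "\<forall>\<^sub>F i in sequentially. 1 + 1 / real (N i) = real (Suc (N i)) / real (N i)"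
      using pos by eventually_elim (simp add: field_simps)
  qed
  have "(\<lambda>i. \<Sum>b\<le>l. (real (k i choose (2 * l + 1 - b)) / real (N i) ^ (2 * l + 1 - b)) * (real (Suc (N i) choose b) / real (N i) ^ b))
    \<longlonglongrightarrow> (\<Sum>b\<le>l. (\<kappa> ^ (2 * l + 1 - b) / fact (2 * l + 1 - b)) * (1 ^ b / fact b))"
    by (intro tendsto_sum tendsto_mult tendsto_binomial_scaled N lim one)
  moreover have "(\<Sum>b\<le>l. (real (k i choose (2 * l + 1 - b)) / real (N i) ^ (2 * l + 1 - b)) * (real (Suc (N i) choose b) / real (N i) ^ b)) =
     level_moment (N i) (k i) (2 * l) / real (N i) ^ (2 * l + 1)" for i
    unfolding level_moment_even[OF k] sum_divide_distrib
  proof (intro sum.cong refl)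
    fix b assume "b \<in> {..l}"
    then have "real (N i) ^ (2 * l + 1) = real (N i) ^ (2 * l + 1 - b) * real (N i) ^ b"
      by (subst power_add[symmetric]) simp
    then show "(real (k i choose (2 * l + 1 - b)) / real (N i) ^ (2 * l + 1 - b)) * (real (Suc (N i) choose b) / real (N i) ^ b) =
      real (k i choose (2 * l + 1 - b)) * real (Suc (N i) choose b) / real (N i) ^ (2 * l + 1)" by simp
  qed
  ultimately show ?thesis by simp
qed

text \<open>Integration of \<open>f\<close> against the expected particle density of row
  \<open>k\<close>. The rescaled positions lie in \<open>[-2, 2]\<close> and neighbouring sites are
  \<open>2 / n\<close> apart, so full occupation has density \<open>1 / 2\<close> in this
  variable.\<close>

definition scaled_level_mean :: "nat \<Rightarrow> nat \<Rightarrow> (real \<Rightarrow> real) \<Rightarrow> real" where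
  "scaled_level_mean n k f = measure_pmf.expectation (random_matching n)
     (\<lambda>M. \<Sum>x\<in>matching_levels n M k. f ((real (n + k - 1) - 2 * real x) / real n)) / real n"

text \<open>The limit of \<open>p! level_moment n k p / n^(p + 1)\<close> for \<open>k / n\<close>
  tending to \<open>\<kappa>\<close>; a binomial coefficient of \<open>n + 1\<close> over
  \<open>b\<close> behaves like \<open>n^b / b!\<close>.\<close>

definition limit_moment :: "real \<Rightarrow> nat \<Rightarrow> real" where
  "limit_moment \<kappa> p = (if odd p then 0 else
     fact p * (\<Sum>b\<le>p div 2. \<kappa> ^ (p + 1 - b) / (fact (p + 1 - b) * fact b)))"

lemma scaled_level_mean_abs_le:
  assumes k: "1 \<le> k" "k \<le> n" and f: "\<And>y. \<bar>y\<bar> \<le> 2 \<Longrightarrow> \<bar>f y\<bar> \<le> e"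
  shows "\<bar>scaled_level_mean n k f\<bar> \<le> e"
proof -
  have n: "n \<ge> 1" using k by simp
  have e: "e \<ge> 0" using f[of 0] by linarith
  have "\<bar>\<Sum>x\<in>matching_levels n M k. f ((real (n + k - 1) - 2 * real x) / real n)\<bar> \<le> real n * e"
    if M: "M \<in> matchings n" for M
  proof -
    note facts = matching_levels_facts[OF M k]
    have "\<bar>\<Sum>x\<in>matching_levels n M k. f ((real (n + k - 1) - 2 * real x) / real n)\<bar> \<le> (\<Sum>x\<in>matching_levels n M k. e)"
    proof (rule sum_abs[THEN order_trans], rule sum_mono, rule f)
      fix x assume "x \<in> matching_levels n M k"
      then have "x \<le> n + k - 1" by (rule facts(3))
      then have "real x \<le> real (n + k - 1)" by (simp only: of_nat_le_iff)
      moreover have "real (n + k - 1) \<le> 2 * real n" using k by simp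
      ultimately show "\<bar>(real (n + k - 1) - 2 * real x) / real n\<bar> \<le> 2"
        using n by (simp add: abs_le_iff divide_le_eq le_divide_eq)
    qed
    also have "\<dots> \<le> real n * e" using facts(2) k e by (simp add: mult_right_mono)
    finally show ?thesis .
  qed
  then have "\<bar>\<Sum>M\<in>matchings n. \<Sum>x\<in>matching_levels n M k. f ((real (n + k - 1) - 2 * real x) / real n)\<bar>
      \<le> (\<Sum>M\<in>matchings n. real n * e)"
    by (intro order_trans[OF sum_abs sum_mono])
  moreover have "card (matchings n) > 0" using finite_matchings[OF n] matchings_nonempty[OF n] by (simp add: card_gt_0_iff)
  ultimately show ?thesis
    using n unfolding scaled_level_mean_def expectation_random_matching[OF n]
    by (simp add: abs_divide divide_le_eq mult_ac)
qed

lemma scaled_level_mean_diff: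
  assumes "n \<ge> 1"
  shows "scaled_level_mean n k (\<lambda>y. f y - g y) = scaled_level_mean n k f - scaled_level_mean n k g"
  unfolding scaled_level_mean_def sum_subtractf
  by (simp add: integrable_random_matching[OF assms] diff_divide_distrib)

lemma scaled_level_mean_poly:
  assumes "n \<ge> 1"
  shows "scaled_level_mean n k (\<lambda>y. \<Sum>i\<le>d. c i * y ^ i) = (\<Sum>i\<le>d. c i * scaled_level_mean n k (\<lambda>y. y ^ i))"
  unfolding scaled_level_mean_def
  by (subst sum.swap) (simp add: integrable_random_matching[OF assms] sum_distrib_left[symmetric] sum_divide_distrib)

text \<open>For every particle \<open>y^p\<close> differs from \<open>p! kraw / n^p\<close> by
  \<open>O(1 / n)\<close>, and at most \<open>n\<close> particles enter with weight
  \<open>1 / n\<close>; the expected Krawtchouk sums are known exactly.\<close>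

lemma scaled_level_mean_power_limit:
  assumes N: "filterlim N at_top sequentially" and k: "\<And>i. 1 \<le> k i" "\<And>i. k i \<le> N i"
    and lim: "(\<lambda>i. real (k i) / real (N i)) \<longlonglongrightarrow> \<kappa>"
  shows "(\<lambda>i. scaled_level_mean (N i) (k i) (\<lambda>y. y ^ p)) \<longlonglongrightarrow> limit_moment \<kappa> p"
proof -
  obtain C where C: "C \<ge> 0" "\<And>n N x. 1 \<le> n \<Longrightarrow> N \<le> 2 * n \<Longrightarrow> x \<le> N \<Longrightarrow>
     \<bar>kraw N p x - (real N - 2 * real x) ^ p / fact p\<bar> \<le> C * real n ^ p / real n"
    using kraw_approx[of p] by blast
  have N1: "1 \<le> N i" for i using k[of i] by linarith
  have main: "(\<lambda>i. fact p * (level_moment (N i) (k i) p / real (N i) ^ (p + 1))) \<longlonglongrightarrow> limit_moment \<kappa> p"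
  proof (cases "odd p")
    case True then show ?thesis by (simp add: level_moment_odd limit_moment_def)
  next
    case False
    then obtain l where l: "p = 2 * l" by (auto elim: evenE)
    show ?thesis unfolding l limit_moment_def
      using tendsto_mult[OF tendsto_const tendsto_level_moment[OF N k(2) lim, of l], of "fact (2 * l)"] by simp
  qed
  have bound: "\<bar>scaled_level_mean (N i) (k i) (\<lambda>y. y ^ p) - fact p * (level_moment (N i) (k i) p / real (N i) ^ (p + 1))\<bar>
      \<le> fact p * C / real (N i)" for i
  proof -
    let ?n = "N i" and ?k = "k i"
    let ?L = "?n + ?k - 1"
    have n0: "real ?n > 0" using N1[of i] by simp
    have "fact p * (level_moment ?n ?k p / real ?n ^ (p + 1)) =
       measure_pmf.expectation (random_matching ?n) (\<lambda>M. \<Sum>x\<in>matching_levels ?n M ?k. fact p / real ?n ^ p * kraw ?L p x) / real ?n"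
      unfolding expectation_kraw[OF k, symmetric] sum_distrib_left[symmetric] using n0 by simp
    then have "scaled_level_mean ?n ?k (\<lambda>y. y ^ p) - fact p * (level_moment ?n ?k p / real ?n ^ (p + 1)) =
       measure_pmf.expectation (random_matching ?n) (\<lambda>M. \<Sum>x\<in>matching_levels ?n M ?k.
          ((real ?L - 2 * real x) / real ?n) ^ p - fact p / real ?n ^ p * kraw ?L p x) / real ?n"
      unfolding scaled_level_mean_def sum_subtractf by (simp add: integrable_random_matching[OF N1] diff_divide_distrib)
    also have "\<dots> = (\<Sum>M\<in>matchings ?n. \<Sum>x\<in>matching_levels ?n M ?k.
          ((real ?L - 2 * real x) / real ?n) ^ p - fact p / real ?n ^ p * kraw ?L p x) / real (card (matchings ?n)) / real ?n"
      unfolding expectation_random_matching[OF N1] ..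
    finally have eq: "scaled_level_mean ?n ?k (\<lambda>y. y ^ p) - fact p * (level_moment ?n ?k p / real ?n ^ (p + 1)) = \<dots>" .
    have "\<bar>\<Sum>M\<in>matchings ?n. \<Sum>x\<in>matching_levels ?n M ?k.
          ((real ?L - 2 * real x) / real ?n) ^ p - fact p / real ?n ^ p * kraw ?L p x\<bar> \<le>
        (\<Sum>M\<in>matchings ?n. \<Sum>x\<in>matching_levels ?n M ?k. fact p * C / real ?n)"
    proof (rule sum_abs[THEN order_trans], rule sum_mono, rule sum_abs[THEN order_trans], rule sum_mono)
      fix M x assume M: "M \<in> matchings ?n" and x: "x \<in> matching_levels ?n M ?k"
      have "x \<le> ?L" by (rule matching_levels_facts(3)[OF M k x])
      moreover have "?L \<le> 2 * ?n" using k[of i] by linarith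
      ultimately have b: "\<bar>kraw ?L p x - (real ?L - 2 * real x) ^ p / fact p\<bar> \<le> C * real ?n ^ p / real ?n"
        using C(2)[OF N1] by blast
      have "\<bar>((real ?L - 2 * real x) / real ?n) ^ p - fact p / real ?n ^ p * kraw ?L p x\<bar> =
         fact p / real ?n ^ p * \<bar>kraw ?L p x - (real ?L - 2 * real x) ^ p / fact p\<bar>"
      proof -
        have "((real ?L - 2 * real x) / real ?n) ^ p - fact p / real ?n ^ p * kraw ?L p x =
           - (fact p / real ?n ^ p * (kraw ?L p x - (real ?L - 2 * real x) ^ p / fact p))"
          by (simp add: power_divide right_diff_distrib)
        then show ?thesis by (simp add: abs_mult)
      qed
      also have "\<dots> \<le> fact p / real ?n ^ p * (C * real ?n ^ p / real ?n)"
        using b by (intro mult_left_mono) auto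
      also have "\<dots> = fact p * C / real ?n" using n0 by simp
      finally show "\<bar>((real ?L - 2 * real x) / real ?n) ^ p - fact p / real ?n ^ p * kraw ?L p x\<bar> \<le> fact p * C / real ?n" .
    qed
    also have "\<dots> = real (card (matchings ?n)) * (real ?k * (fact p * C / real ?n))"
      using matching_levels_facts(2)[OF _ k[of i]] by simp
    also have "\<dots> \<le> real (card (matchings ?n)) * (real ?n * (fact p * C / real ?n))"
      using k[of i] C(1) by (intro mult_left_mono mult_right_mono) auto
    finally have b: "\<bar>\<Sum>M\<in>matchings ?n. \<Sum>x\<in>matching_levels ?n M ?k.
          ((real ?L - 2 * real x) / real ?n) ^ p - fact p / real ?n ^ p * kraw ?L p x\<bar> \<le> real (card (matchings ?n)) * (fact p * C)"
      using n0 by simp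
    have "card (matchings ?n) > 0" using finite_matchings[OF N1] matchings_nonempty[OF N1] by (simp add: card_gt_0_iff)
    then show ?thesis unfolding eq abs_divide
      using b n0 by (simp add: divide_le_eq mult_ac)
  qed
  have "(\<lambda>i. fact p * C / real (N i)) \<longlonglongrightarrow> 0"
    using N by (intro tendsto_divide_0[OF tendsto_const])
      (auto intro: filterlim_at_top_imp_at_infinity filterlim_compose[OF filterlim_real_sequentially])
  then have "(\<lambda>i. scaled_level_mean (N i) (k i) (\<lambda>y. y ^ p) - fact p * (level_moment (N i) (k i) p / real (N i) ^ (p + 1))) \<longlonglongrightarrow> 0"
    by (rule Lim_null_comparison[rotated]) (use bound in auto)
  from tendsto_add[OF this main] show ?thesis by simp
qed

section \<open>The limiting density\<close>

definition sym_integral :: "(real \<Rightarrow> real) \<Rightarrow> real \<Rightarrow> real" where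
  "sym_integral f Y = integral {-Y..Y} f"

lemma integrable_on_continuous_UNIV:
  fixes f :: "real \<Rightarrow> real"
  assumes "continuous_on UNIV f" shows "f integrable_on {a..b}"
  by (rule integrable_continuous_real) (rule continuous_on_subset[OF assms], simp)

text \<open>The integral over a moving symmetric interval is a difference of two values of one
  antiderivative, whence continuity in \<open>Y\<close>. The base point -3 lies to the left of all
  intervals in use, because \<open>chord\<close> is at most 2.\<close>

lemma sym_integral_eq:
  assumes "continuous_on UNIV f" "0 \<le> Y" "Y \<le> 3"
  shows "sym_integral f Y = integral {-3..Y} f - integral {-3..-Y} f"
  using Henstock_Kurzweil_Integration.integral_combine[of "-3" "-Y" Y f] integrable_on_continuous_UNIV[OF assms(1)] assms
  by (simp add: sym_integral_def)

lemma continuous_sym_integral: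
  assumes "continuous_on UNIV f"
  shows "continuous_on {0..3} (sym_integral f)"
proof -
  have F: "continuous_on {-3..3} (\<lambda>x. integral {-3..x} f)"
    by (rule indefinite_integral_continuous_1) (rule integrable_on_continuous_UNIV[OF assms])
  have "continuous_on {0..3} (\<lambda>Y. integral {-3..Y} f - integral {-3..-Y} f)"
    by (intro continuous_on_diff continuous_on_subset[OF F] continuous_on_compose2[OF F] continuous_intros) auto
  then show ?thesis by (rule continuous_on_eq) (use sym_integral_eq[OF assms] in auto)
qed

lemma sym_integral_diff:
  assumes "continuous_on UNIV f" "continuous_on UNIV g"
  shows "sym_integral (\<lambda>u. f u - g u) Y = sym_integral f Y - sym_integral g Y"
  unfolding sym_integral_def
  by (rule Henstock_Kurzweil_Integration.integral_diff) (use assms integrable_on_continuous_UNIV in auto)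

lemma sym_integral_power:
  assumes "Y \<ge> 0"
  shows "sym_integral (\<lambda>u. u ^ p) Y = (if odd p then 0 else 2 * Y ^ (p + 1) / (real p + 1))"
proof -
  have "((\<lambda>u. u ^ p) has_integral (Y ^ (p + 1) / (real p + 1) - (-Y) ^ (p + 1) / (real p + 1))) {-Y..Y}"
  proof (rule fundamental_theorem_of_calculus)
    show "((\<lambda>u. u ^ (p + 1) / (real p + 1)) has_vector_derivative u ^ p) (at u within {-Y..Y})" for u :: real
    proof -
      have "1 + real p \<noteq> 0" by linarith
      then show ?thesis
        using DERIV_cdivide[OF DERIV_pow[of "p + 1" u "{-Y..Y}"], of "real p + 1"]
        by (simp add: add.commute has_real_derivative_iff_has_vector_derivative[symmetric])
    qed
  qed (use assms in simp)
  then have "sym_integral (\<lambda>u. u ^ p) Y = Y ^ (p + 1) / (real p + 1) - (-Y) ^ (p + 1) / (real p + 1)"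
    unfolding sym_integral_def by (rule integral_unique)
  then show ?thesis by (auto simp: power_minus_odd power_minus_even)
qed

lemma sym_integral_abs_le:
  assumes "continuous_on UNIV f" "0 \<le> Y" "\<And>u. \<bar>u\<bar> \<le> Y \<Longrightarrow> \<bar>f u\<bar> \<le> e"
  shows "\<bar>sym_integral f Y\<bar> \<le> 2 * Y * e"
proof -
  have "norm (integral {-Y..Y} f) \<le> e * (Y - (-Y))"
    by (rule integral_bound) (use assms continuous_on_subset[OF assms(1)] in auto)
  then show ?thesis by (simp add: sym_integral_def mult_ac)
qed

lemma sym_integral_bump_le:
  assumes "continuous_on UNIV f" "0 \<le> Y" "h \<ge> 0" "\<And>u. 0 \<le> f u" "\<And>u. f u \<le> 1" "\<And>u. \<bar>u - c\<bar> \<ge> h \<Longrightarrow> f u = 0"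
  shows "sym_integral f Y \<le> 2 * h"
proof -
  have "f = (\<lambda>x. if x \<in> {c - h..c + h} then f x else 0)" using assms(6) by (auto simp: fun_eq_iff abs_if)
  then have "sym_integral f Y = integral ({c - h..c + h} \<inter> {-Y..Y}) f"
    unfolding sym_integral_def by (metis integral_restrict_Int)
  also have "{c - h..c + h} \<inter> {-Y..Y} = {max (c - h) (-Y)..min (c + h) Y}" by auto
  also have "integral {max (c - h) (-Y)..min (c + h) Y} f \<le> 2 * h"
  proof (cases "max (c - h) (-Y) \<le> min (c + h) Y")
    case True
    then have "norm (integral {max (c - h) (-Y)..min (c + h) Y} f) \<le> 1 * (min (c + h) Y - max (c - h) (-Y))"
      by (intro integral_bound) (use assms continuous_on_subset[OF assms(1)] in auto)
    then show ?thesis by auto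
  next
    case False then show ?thesis using assms(3) by simp
  qed
  finally show ?thesis .
qed

definition chord :: "real \<Rightarrow> real \<Rightarrow> real" where
  "chord \<kappa> \<phi> = 2 * sqrt \<kappa> * cos \<phi>"

text \<open>The denominator is chosen so that multiplying the integrand by the square of the chord
  reproduces it with factor \<open>(1 + \<kappa>)^2\<close> up to a pure power of the chord; the
  limits of the particle moments obey a recursion with the same factor. It is at least
  \<open>(1 - \<kappa>)^2\<close>.\<close>

definition chord_weight :: "real \<Rightarrow> real \<Rightarrow> real" where
  "chord_weight \<kappa> \<phi> = chord \<kappa> \<phi> / ((1 + \<kappa>)\<^sup>2 - (chord \<kappa> \<phi>)\<^sup>2)"

text \<open>The limiting particle density in row \<open>\<kappa> n\<close>, as a functional on test functions of the position
  \<open>(n + k - 1 - 2 x) / n\<close>. It is a mixture of multiples of the uniform distributions on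
  \<open>{-y..y}\<close>, where \<open>y = 2 \<surd>\<kappa> cos \<phi>\<close>.\<close>

definition limit_functional :: "real \<Rightarrow> (real \<Rightarrow> real) \<Rightarrow> real" where
  "limit_functional \<kappa> f = (1 - \<kappa>) / (2 * pi) *
     integral {0..pi/2} (\<lambda>\<phi>. chord_weight \<kappa> \<phi> * sym_integral f (chord \<kappa> \<phi>))"

context
  fixes \<kappa> :: real
  assumes \<kappa>: "0 < \<kappa>" "\<kappa> < 1"
begin

lemma chord_square: "(chord \<kappa> \<phi>)\<^sup>2 = 4 * \<kappa> * (cos \<phi>)\<^sup>2"
  using \<kappa> by (simp add: chord_def power_mult_distrib)

lemma chord_square_le: "(chord \<kappa> \<phi>)\<^sup>2 \<le> 4 * \<kappa>"
  using \<kappa> by (simp add: chord_square abs_square_le_1)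

lemma chord_denominator: "(1 - \<kappa>)\<^sup>2 \<le> (1 + \<kappa>)\<^sup>2 - (chord \<kappa> \<phi>)\<^sup>2" "0 < (1 - \<kappa>)\<^sup>2"
    "0 < (1 + \<kappa>)\<^sup>2 - (chord \<kappa> \<phi>)\<^sup>2"
proof -
  show 1: "(1 - \<kappa>)\<^sup>2 \<le> (1 + \<kappa>)\<^sup>2 - (chord \<kappa> \<phi>)\<^sup>2"
    using chord_square_le[of \<phi>] by (simp add: power2_eq_square algebra_simps)
  show 2: "0 < (1 - \<kappa>)\<^sup>2" using \<kappa> by simp
  show "0 < (1 + \<kappa>)\<^sup>2 - (chord \<kappa> \<phi>)\<^sup>2" using 1 2 by linarith
qed

lemma chord_nonneg: "0 \<le> \<phi> \<Longrightarrow> \<phi> \<le> pi / 2 \<Longrightarrow> 0 \<le> chord \<kappa> \<phi>"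
  using \<kappa> by (simp add: chord_def cos_ge_zero)

lemma chord_le: "chord \<kappa> \<phi> \<le> 2"
proof -
  have "(chord \<kappa> \<phi>)\<^sup>2 \<le> 2\<^sup>2" using chord_square_le[of \<phi>] \<kappa> by simp
  then show ?thesis using power2_le_imp_le[of "chord \<kappa> \<phi>" 2] by simp
qed

lemma continuous_arc: "continuous_on A (chord \<kappa>)"
  unfolding chord_def by (intro continuous_intros)

lemma continuous_arc_weight: "continuous_on A (chord_weight \<kappa>)"
  unfolding chord_weight_def
  by (intro continuous_intros continuous_arc) (use chord_denominator(3) in \<open>simp add: less_imp_neq[symmetric]\<close>)

lemma chord_weight_nonneg: "0 \<le> \<phi> \<Longrightarrow> \<phi> \<le> pi / 2 \<Longrightarrow> 0 \<le> chord_weight \<kappa> \<phi>"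
  unfolding chord_weight_def using chord_nonneg chord_denominator(3)[of \<phi>] by simp

lemma continuous_integrand:
  assumes "continuous_on UNIV f"
  shows "continuous_on {0..pi/2} (\<lambda>\<phi>. chord_weight \<kappa> \<phi> * sym_integral f (chord \<kappa> \<phi>))"
proof (intro continuous_on_mult continuous_arc_weight continuous_on_compose2[OF continuous_sym_integral[OF assms]] continuous_arc)
  have "chord \<kappa> \<phi> \<le> 3" for \<phi> using chord_le[of \<phi>] by linarith
  then show "chord \<kappa> ` {0..pi/2} \<subseteq> {0..3}" using chord_nonneg by auto
qed

lemma limit_functional_diff:
  assumes "continuous_on UNIV f" "continuous_on UNIV g"
  shows "limit_functional \<kappa> (\<lambda>u. f u - g u) = limit_functional \<kappa> f - limit_functional \<kappa> g"
proof -
  have "integral {0..pi/2} (\<lambda>\<phi>. chord_weight \<kappa> \<phi> * sym_integral f (chord \<kappa> \<phi>) - chord_weight \<kappa> \<phi> * sym_integral g (chord \<kappa> \<phi>)) =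
    integral {0..pi/2} (\<lambda>\<phi>. chord_weight \<kappa> \<phi> * sym_integral f (chord \<kappa> \<phi>)) -
    integral {0..pi/2} (\<lambda>\<phi>. chord_weight \<kappa> \<phi> * sym_integral g (chord \<kappa> \<phi>))"
    by (intro Henstock_Kurzweil_Integration.integral_diff integrable_continuous_real continuous_integrand assms)
  then show ?thesis
    unfolding limit_functional_def sym_integral_diff[OF assms] by (simp add: right_diff_distrib)
qed

lemma limit_functional_abs_le:
  assumes "continuous_on UNIV f" "\<And>u. \<bar>u\<bar> \<le> 2 \<Longrightarrow> \<bar>f u\<bar> \<le> e"
  shows "\<bar>limit_functional \<kappa> f\<bar> \<le> 2 / (1 - \<kappa>) * e"
proof -
  have e: "e \<ge> 0" using assms(2)[of 0] by linarith
  have "norm (integral {0..pi/2} (\<lambda>\<phi>. chord_weight \<kappa> \<phi> * sym_integral f (chord \<kappa> \<phi>))) \<le> 8 * e / (1 - \<kappa>)\<^sup>2 * (pi / 2 - 0)"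
  proof (rule integral_bound[OF _ continuous_integrand[OF assms(1)]])
    fix \<phi> assume "\<phi> \<in> {0..pi/2}"
    then have y: "0 \<le> chord \<kappa> \<phi>" "chord \<kappa> \<phi> \<le> 2" using chord_nonneg chord_le by auto
    have "\<bar>sym_integral f (chord \<kappa> \<phi>)\<bar> \<le> 2 * chord \<kappa> \<phi> * e"
      by (rule sym_integral_abs_le) (use assms y in auto)
    also have "\<dots> \<le> 4 * e" using y e by (intro mult_right_mono) auto
    finally have 1: "\<bar>sym_integral f (chord \<kappa> \<phi>)\<bar> \<le> 4 * e" .
    have 2: "\<bar>chord_weight \<kappa> \<phi>\<bar> \<le> 2 / (1 - \<kappa>)\<^sup>2"
      unfolding chord_weight_def abs_divide using y chord_denominator(1,3)[of \<phi>] chord_denominator(2) by (intro frac_le) auto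
    have "\<bar>chord_weight \<kappa> \<phi>\<bar> * \<bar>sym_integral f (chord \<kappa> \<phi>)\<bar> \<le> 2 / (1 - \<kappa>)\<^sup>2 * (4 * e)"
      by (intro mult_mono 1 2) auto
    then show "norm (chord_weight \<kappa> \<phi> * sym_integral f (chord \<kappa> \<phi>)) \<le> 8 * e / (1 - \<kappa>)\<^sup>2"
      by (simp add: abs_mult)
  qed simp
  then have "\<bar>limit_functional \<kappa> f\<bar> \<le> (1 - \<kappa>) / (2 * pi) * (8 * e / (1 - \<kappa>)\<^sup>2 * (pi / 2))"
    unfolding limit_functional_def abs_mult using \<kappa> by (intro mult_mono) auto
  also have "\<dots> = 2 / (1 - \<kappa>) * e"
  proof -
    have e: "t / (2 * pi) * (8 * e / t\<^sup>2 * (pi / 2)) = 2 / t * e" if "t > 0" for t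
      using that by (simp add: power2_eq_square field_simps)
    show ?thesis by (rule e) (use \<kappa> in simp)
  qed
  finally show ?thesis .
qed

lemma limit_functional_poly:
  "limit_functional \<kappa> (\<lambda>y. \<Sum>i\<le>d. c i * y ^ i) = (\<Sum>i\<le>d. c i * limit_functional \<kappa> (\<lambda>y. y ^ i))"
proof -
  have p: "continuous_on UNIV (\<lambda>y::real. y ^ i)" for i by (intro continuous_intros)
  have s: "sym_integral (\<lambda>y. \<Sum>i\<le>d. c i * y ^ i) Y = (\<Sum>i\<le>d. c i * sym_integral (\<lambda>y. y ^ i) Y)" for Y
    unfolding sym_integral_def
    by (subst integral_sum) (auto intro!: integrable_on_continuous_UNIV continuous_intros)
  have "integral {0..pi/2} (\<lambda>\<phi>. chord_weight \<kappa> \<phi> * sym_integral (\<lambda>y. \<Sum>i\<le>d. c i * y ^ i) (chord \<kappa> \<phi>)) =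
    integral {0..pi/2} (\<lambda>\<phi>. \<Sum>i\<le>d. c i * (chord_weight \<kappa> \<phi> * sym_integral (\<lambda>y. y ^ i) (chord \<kappa> \<phi>)))"
    unfolding s by (simp add: sum_distrib_left mult_ac)
  also have "\<dots> = (\<Sum>i\<le>d. c i * integral {0..pi/2} (\<lambda>\<phi>. chord_weight \<kappa> \<phi> * sym_integral (\<lambda>y. y ^ i) (chord \<kappa> \<phi>)))"
    by (subst integral_sum) (auto intro!: integrable_continuous_real continuous_on_mult_left continuous_integrand[OF p])
  finally show ?thesis
    unfolding limit_functional_def by (simp add: sum_distrib_left mult_ac)
qed

text \<open>Wallis' integral, from the derivative of \<open>sin \<phi> cos^(2 m + 1) \<phi>\<close>,
  which vanishes at both ends.\<close>

lemma integral_cos_power_even: "integral {0..pi/2} (\<lambda>\<phi>. cos \<phi> ^ (2 * m)) = pi / 2 * real ((2 * m) choose m) / 4 ^ m"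
proof (induction m)
  case 0 then show ?case by simp
next
  case (Suc m)
  have int: "(\<lambda>\<phi>. cos \<phi> ^ i) integrable_on {0..pi/2}" for i
    by (intro integrable_continuous_real continuous_intros)
  have "((\<lambda>\<phi>. (2 * real m + 2) * cos \<phi> ^ (2 * Suc m) - (2 * real m + 1) * cos \<phi> ^ (2 * m)) has_integral
     sin (pi/2) * cos (pi/2) ^ (2 * m + 1) - sin 0 * cos 0 ^ (2 * m + 1)) {0..pi/2}"
  proof (rule fundamental_theorem_of_calculus)
    fix x :: real
    have "((\<lambda>\<phi>. sin \<phi> * cos \<phi> ^ (2 * m + 1)) has_real_derivative
      cos x * cos x ^ (2 * m + 1) + (real (2 * m + 1) * cos x ^ (2 * m) * (- sin x)) * sin x) (at x within {0..pi/2})"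
      by (rule derivative_eq_intros refl | simp)+
    moreover have "cos x * cos x ^ (2 * m + 1) + (real (2 * m + 1) * cos x ^ (2 * m) * (- sin x)) * sin x =
      (2 * real m + 2) * cos x ^ (2 * Suc m) - (2 * real m + 1) * cos x ^ (2 * m)"
    proof -
      have "sin x * sin x = 1 - cos x * cos x" using sin_cos_squared_add[of x] by (simp add: power2_eq_square)
      then have "real (2 * m + 1) * cos x ^ (2 * m) * (sin x * sin x) = real (2 * m + 1) * cos x ^ (2 * m) * (1 - cos x * cos x)" by simp
      then show ?thesis by (simp add: algebra_simps)
    qed
    ultimately show "((\<lambda>\<phi>. sin \<phi> * cos \<phi> ^ (2 * m + 1)) has_vector_derivative
      (2 * real m + 2) * cos x ^ (2 * Suc m) - (2 * real m + 1) * cos x ^ (2 * m)) (at x within {0..pi/2})"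
      by (simp only: has_real_derivative_iff_has_vector_derivative)
  qed simp
  then have "integral {0..pi/2} (\<lambda>\<phi>. (2 * real m + 2) * cos \<phi> ^ (2 * Suc m) - (2 * real m + 1) * cos \<phi> ^ (2 * m)) = 0"
    by (subst integral_unique) auto
  then have "(2 * real m + 2) * integral {0..pi/2} (\<lambda>\<phi>. cos \<phi> ^ (2 * Suc m)) =
      (2 * real m + 1) * integral {0..pi/2} (\<lambda>\<phi>. cos \<phi> ^ (2 * m))"
    by (subst (asm) Henstock_Kurzweil_Integration.integral_diff) (auto intro!: integrable_on_mult_right int simp del: mult_Suc_right)
  then have step: "(2 * real m + 2) * integral {0..pi/2} (\<lambda>\<phi>. cos \<phi> ^ (2 * Suc m)) =
      (2 * real m + 1) * (pi / 2 * real ((2 * m) choose m) / 4 ^ m)"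
    by (simp only: Suc)
  have central: "(2 * real m + 2) * real ((2 * Suc m) choose Suc m) = 4 * (2 * real m + 1) * real ((2 * m) choose m)"
  proof -
    have 1: "Suc m * (Suc (2 * m) choose Suc m) = Suc (2 * m) * ((2 * m) choose m)" by (rule Suc_times_binomial_eq[symmetric, unfolded mult.commute[of _ "Suc _"]])
    have 2: "(Suc (Suc (2 * m)) choose Suc m) = 2 * (Suc (2 * m) choose Suc m)"
    proof -
      have "Suc (2 * m) choose m = Suc (2 * m) choose Suc m"
        using binomial_symmetric[of m "Suc (2 * m)"] by simp
      then show ?thesis by simp
    qed
    have "real (Suc m) * real (Suc (2 * m) choose Suc m) = real (Suc (2 * m)) * real ((2 * m) choose m)"
      using 1 by (metis of_nat_mult)
    moreover have "real ((2 * Suc m) choose Suc m) = 2 * real (Suc (2 * m) choose Suc m)" using 2 by simp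
    ultimately show ?thesis by (simp add: algebra_simps)
  qed
  have "(2 * real m + 2) * (pi / 2 * real ((2 * Suc m) choose Suc m) / 4 ^ Suc m) =
      pi / 2 * ((2 * real m + 2) * real ((2 * Suc m) choose Suc m)) / 4 ^ Suc m"
    by (simp only: mult_ac times_divide_eq_right)
  also have "\<dots> = (2 * real m + 1) * (pi / 2 * real ((2 * m) choose m) / 4 ^ m)"
    unfolding central by (simp add: field_simps)
  finally have "(2 * real m + 2) * integral {0..pi/2} (\<lambda>\<phi>. cos \<phi> ^ (2 * Suc m)) =
     (2 * real m + 2) * (pi / 2 * real ((2 * Suc m) choose Suc m) / 4 ^ Suc m)"
    using step by (simp only:)
  moreover have "2 * real m + 2 \<noteq> 0" by linarith
  ultimately show ?case by (metis mult_left_cancel)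
qed

definition trunc_binomial :: "nat \<Rightarrow> nat \<Rightarrow> real" where
  "trunc_binomial m r = (\<Sum>j\<le>r. real (m choose j) * \<kappa> ^ (m - j))"

text \<open>By Pascal's rule the full expansion of \<open>(1 + \<kappa>)^m\<close> is multiplied by
  \<open>1 + \<kappa>\<close>; truncation at \<open>r\<close> costs one boundary term.\<close>

lemma trunc_binomial_Suc:
  assumes "r \<le> m"
  shows "trunc_binomial (Suc m) r = (1 + \<kappa>) * trunc_binomial m r - real (m choose r) * \<kappa> ^ (m - r)"
  using assms
proof (induction r)
  case 0 then show ?case by (simp add: trunc_binomial_def algebra_simps)
next
  case (Suc r)
  have s: "trunc_binomial m' (Suc r) = trunc_binomial m' r + real (m' choose Suc r) * \<kappa> ^ (m' - Suc r)" for m'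
    by (simp add: trunc_binomial_def)
  have e: "\<kappa> ^ (m - r) = \<kappa> * \<kappa> ^ (m - Suc r)" using Suc.prems by (metis Suc_diff_Suc Suc_le_lessD power_Suc)
  show ?case using Suc unfolding s by (simp add: e algebra_simps)
qed

text \<open>This is \<open>2 l + 1\<close> times the limit moment of order
  \<open>2 l\<close>.\<close>

definition half_sum :: "nat \<Rightarrow> real" where
  "half_sum l = trunc_binomial (2 * l + 1) l"

lemma half_sum_Suc:
  "half_sum (Suc l) = (1 + \<kappa>)\<^sup>2 * half_sum l - (1 - \<kappa>) / 2 * (\<kappa> ^ (l + 1) * real ((2 * l + 2) choose (l + 1)))"
proof -
  let ?B = "real ((2 * l + 2) choose (l + 1))"
  have c: "real ((2 * l + 1) choose l) = ?B / 2"
  proof -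
    have "(2 * l + 1) choose l = (2 * l + 1) choose (l + 1)"
      using binomial_symmetric[of l "2 * l + 1"] by simp
    then show ?thesis by simp
  qed
  have 1: "trunc_binomial (2 * l + 2) l = (1 + \<kappa>) * half_sum l - ?B / 2 * \<kappa> ^ (l + 1)"
    using trunc_binomial_Suc[of l "2 * l + 1"] c by (simp add: half_sum_def)
  have 2: "trunc_binomial (2 * l + 2) (l + 1) = trunc_binomial (2 * l + 2) l + ?B * \<kappa> ^ (l + 1)"
    by (simp add: trunc_binomial_def del: binomial_Suc_Suc)
  have 3: "half_sum (Suc l) = (1 + \<kappa>) * trunc_binomial (2 * l + 2) (l + 1) - ?B * \<kappa> ^ (l + 1)"
    using trunc_binomial_Suc[of "l + 1" "2 * l + 2"] by (simp add: half_sum_def del: binomial_Suc_Suc)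
  show ?thesis unfolding 3 2 1 by (simp add: power2_eq_square field_simps)
qed

lemma half_sum_bound: "\<bar>half_sum l\<bar> \<le> \<kappa> * (4 * \<kappa>) ^ l"
proof -
  have "\<bar>half_sum l\<bar> = half_sum l" using \<kappa> by (simp add: half_sum_def trunc_binomial_def sum_nonneg)
  also have "\<dots> \<le> (\<Sum>j\<le>l. real ((2 * l + 1) choose j) * \<kappa> ^ (l + 1))"
    unfolding half_sum_def trunc_binomial_def
    using \<kappa> by (intro sum_mono mult_left_mono power_decreasing) auto
  also have "\<dots> = real (\<Sum>j\<le>l. (2 * l + 1) choose j) * \<kappa> ^ (l + 1)" by (simp add: sum_distrib_right)
  also have "(\<Sum>j\<le>l. (2 * l + 1) choose j) = 4 ^ l" by (subst binomial_r_part_sum) (simp add: power_mult)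
  finally show ?thesis by (simp add: power_mult_distrib mult_ac)
qed

text \<open>The same multiple of the moment of order \<open>2 l\<close> of
  \<open>limit_functional\<close>: integrating \<open>u^(2 l)\<close> over \<open>{-y..y}\<close>
  gives \<open>2 y^(2 l + 1) / (2 l + 1)\<close>.\<close>

definition half_integral :: "nat \<Rightarrow> real" where
  "half_integral l = (1 - \<kappa>) / pi * integral {0..pi/2} (\<lambda>\<phi>. chord \<kappa> \<phi> ^ (2 * l + 2) / ((1 + \<kappa>)\<^sup>2 - (chord \<kappa> \<phi>)\<^sup>2))"

lemma continuous_half_integrand:
  "continuous_on A (\<lambda>\<phi>. chord \<kappa> \<phi> ^ p / ((1 + \<kappa>)\<^sup>2 - (chord \<kappa> \<phi>)\<^sup>2))"
  by (intro continuous_intros continuous_arc) (use chord_denominator(3) in \<open>simp add: less_imp_neq[symmetric]\<close>)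

text \<open>Replacing the squared chord in the numerator by \<open>(1 + \<kappa>)^2\<close> minus
  the denominator separates the previous integral from a pure power of the cosine, which Wallis'
  formula evaluates.\<close>

lemma half_integral_Suc:
  "half_integral (Suc l) = (1 + \<kappa>)\<^sup>2 * half_integral l - (1 - \<kappa>) / 2 * (\<kappa> ^ (l + 1) * real ((2 * l + 2) choose (l + 1)))"
proof -
  let ?D = "\<lambda>\<phi>. (1 + \<kappa>)\<^sup>2 - (chord \<kappa> \<phi>)\<^sup>2"
  have pw: "chord \<kappa> \<phi> ^ (2 * Suc l + 2) / ?D \<phi> = (1 + \<kappa>)\<^sup>2 * (chord \<kappa> \<phi> ^ (2 * l + 2) / ?D \<phi>) - chord \<kappa> \<phi> ^ (2 * l + 2)" for \<phi>
  proof -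
    have "chord \<kappa> \<phi> ^ (2 * Suc l + 2) = ((1 + \<kappa>)\<^sup>2 - ?D \<phi>) * chord \<kappa> \<phi> ^ (2 * l + 2)"
      by (simp add: power2_eq_square)
    moreover have "((c - D) * A) / D = c * (A / D) - A" if "D > 0" for c D A :: real
      using that by (simp add: field_simps)
    ultimately show ?thesis using chord_denominator(3)[of \<phi>] by presburger
  qed
  have cosint: "integral {0..pi/2} (\<lambda>\<phi>. chord \<kappa> \<phi> ^ (2 * l + 2)) = \<kappa> ^ (l + 1) * (pi / 2) * real ((2 * l + 2) choose (l + 1))"
  proof -
    have "chord \<kappa> \<phi> ^ (2 * l + 2) = (4 * \<kappa>) ^ (l + 1) * cos \<phi> ^ (2 * (l + 1))" for \<phi>
    proof -
      have "chord \<kappa> \<phi> ^ (2 * l + 2) = ((chord \<kappa> \<phi>)\<^sup>2) ^ (l + 1)" by (subst power_mult[symmetric]) (simp add: algebra_simps)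
      also have "\<dots> = (4 * \<kappa>) ^ (l + 1) * ((cos \<phi>)\<^sup>2) ^ (l + 1)"
        by (simp only: chord_square power_mult_distrib)
      also have "((cos \<phi>)\<^sup>2) ^ (l + 1) = cos \<phi> ^ (2 * (l + 1))" by (simp only: power_mult)
      finally show ?thesis .
    qed
    then have "integral {0..pi/2} (\<lambda>\<phi>. chord \<kappa> \<phi> ^ (2 * l + 2)) = (4 * \<kappa>) ^ (l + 1) * integral {0..pi/2} (\<lambda>\<phi>. cos \<phi> ^ (2 * (l + 1)))"
      by simp
    also have "\<dots> = \<kappa> ^ (l + 1) * (pi / 2) * real ((2 * (l + 1)) choose (l + 1))"
      unfolding integral_cos_power_even by (simp add: power_mult_distrib del: binomial_Suc_Suc)
    finally show ?thesis by (simp del: binomial_Suc_Suc)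
  qed
  have "integral {0..pi/2} (\<lambda>\<phi>. chord \<kappa> \<phi> ^ (2 * Suc l + 2) / ?D \<phi>) =
     (1 + \<kappa>)\<^sup>2 * integral {0..pi/2} (\<lambda>\<phi>. chord \<kappa> \<phi> ^ (2 * l + 2) / ?D \<phi>) - integral {0..pi/2} (\<lambda>\<phi>. chord \<kappa> \<phi> ^ (2 * l + 2))"
    unfolding pw
  proof (subst Henstock_Kurzweil_Integration.integral_diff)
    show "(\<lambda>\<phi>. (1 + \<kappa>)\<^sup>2 * (chord \<kappa> \<phi> ^ (2 * l + 2) / ?D \<phi>)) integrable_on {0..pi/2}"
      by (intro integrable_continuous_real continuous_on_mult_left continuous_half_integrand)
    show "(\<lambda>\<phi>. chord \<kappa> \<phi> ^ (2 * l + 2)) integrable_on {0..pi/2}"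
      by (intro integrable_continuous_real continuous_on_power continuous_arc)
  qed (simp only: integral_mult_right)
  then have "half_integral (Suc l) = (1 - \<kappa>) / pi * ((1 + \<kappa>)\<^sup>2 * integral {0..pi/2} (\<lambda>\<phi>. chord \<kappa> \<phi> ^ (2 * l + 2) / ?D \<phi>) -
     \<kappa> ^ (l + 1) * (pi / 2) * real ((2 * l + 2) choose (l + 1)))"
    unfolding half_integral_def cosint by simp
  also have "(1 - \<kappa>) / pi * (Q * J - P * (pi / 2) * B) = Q * ((1 - \<kappa>) / pi * J) - (1 - \<kappa>) / 2 * (P * B)"
    for Q J P B :: real
    by (simp add: right_diff_distrib)
  finally show ?thesis unfolding half_integral_def .
qed

lemma half_integral_bound: "\<bar>half_integral l\<bar> \<le> 2 * \<kappa> / (1 - \<kappa>) * (4 * \<kappa>) ^ l"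
proof -
  have "norm (integral {0..pi/2} (\<lambda>\<phi>. chord \<kappa> \<phi> ^ (2 * l + 2) / ((1 + \<kappa>)\<^sup>2 - (chord \<kappa> \<phi>)\<^sup>2))) \<le>
     (4 * \<kappa>) ^ (l + 1) / (1 - \<kappa>)\<^sup>2 * (pi / 2 - 0)"
  proof (rule integral_bound[OF _ continuous_half_integrand])
    fix \<phi> assume "\<phi> \<in> {0..pi/2}"
    have "chord \<kappa> \<phi> ^ (2 * l + 2) = ((chord \<kappa> \<phi>)\<^sup>2) ^ (l + 1)" by (subst power_mult[symmetric]) (simp add: algebra_simps)
    also have "\<dots> \<le> (4 * \<kappa>) ^ (l + 1)" by (intro power_mono chord_square_le) simp
    finally have "chord \<kappa> \<phi> ^ (2 * l + 2) \<le> (4 * \<kappa>) ^ (l + 1)" .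
    moreover have "0 \<le> chord \<kappa> \<phi> ^ (2 * l + 2)" by (rule zero_le_even_power) simp
    ultimately show "norm (chord \<kappa> \<phi> ^ (2 * l + 2) / ((1 + \<kappa>)\<^sup>2 - (chord \<kappa> \<phi>)\<^sup>2)) \<le> (4 * \<kappa>) ^ (l + 1) / (1 - \<kappa>)\<^sup>2"
      using chord_denominator(1,3)[of \<phi>] chord_denominator(2) \<kappa> by (simp only: real_norm_def abs_divide) (intro frac_le, auto)
  qed simp
  then have "\<bar>half_integral l\<bar> \<le> (1 - \<kappa>) / pi * ((4 * \<kappa>) ^ (l + 1) / (1 - \<kappa>)\<^sup>2 * (pi / 2))"
    unfolding half_integral_def abs_mult using \<kappa> by (intro mult_mono) auto
  also have "\<dots> = 2 * \<kappa> / (1 - \<kappa>) * (4 * \<kappa>) ^ l"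
  proof -
    have e: "t / pi * ((4 * \<kappa>) ^ (l + 1) / t\<^sup>2 * (pi / 2)) = 2 * \<kappa> / t * (4 * \<kappa>) ^ l" if "t > 0" for t
      using that by (simp add: power2_eq_square field_simps)
    show ?thesis by (rule e) (use \<kappa> in simp)
  qed
  finally show ?thesis .
qed

text \<open>Both sides satisfy the same recursion, whose homogeneous part grows like
  \<open>(1 + \<kappa>)\<^sup>2\<^sup>l\<close>, while both sides are \<open>O((4 \<kappa>)\<^sup>l)\<close>.\<close>

lemma half_integral_eq_half_sum: "half_integral l = half_sum l"
proof -
  define d where "d l = half_integral l - half_sum l" for l
  have "d (Suc l) = (1 + \<kappa>)\<^sup>2 * d l" for l
    by (simp add: d_def half_integral_Suc half_sum_Suc right_diff_distrib del: binomial_Suc_Suc)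
  then have rec: "d l = ((1 + \<kappa>)\<^sup>2) ^ l * d 0" for l
    by (induction l) simp_all
  define B where "B = 2 * \<kappa> / (1 - \<kappa>) + \<kappa>"
  have bound: "\<bar>d l\<bar> \<le> B * (4 * \<kappa>) ^ l" for l
    using half_integral_bound[of l] half_sum_bound[of l] unfolding d_def B_def distrib_right by linarith
  define r where "r = 4 * \<kappa> / (1 + \<kappa>)\<^sup>2"
  have r: "0 \<le> r" "r < 1" using \<kappa> chord_denominator(2) by (auto simp: r_def power2_eq_square field_simps)
  have "\<bar>d 0\<bar> \<le> B * r ^ l" for l
  proof -
    have "((1 + \<kappa>)\<^sup>2) ^ l * \<bar>d 0\<bar> \<le> B * (4 * \<kappa>) ^ l" using bound[of l] rec[of l] by (simp add: abs_mult)
    moreover have "((1 + \<kappa>)\<^sup>2) ^ l > 0" using \<kappa> by simp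
    ultimately show ?thesis by (simp add: r_def power_divide field_simps)
  qed
  moreover have "(\<lambda>l. B * r ^ l) \<longlonglongrightarrow> B * 0" by (intro tendsto_mult tendsto_const LIMSEQ_realpow_zero r)
  ultimately have "\<bar>d 0\<bar> \<le> B * 0" by (intro LIMSEQ_le_const[of _ "B * 0"]) auto
  then have "d l = 0" using rec[of l] by simp
  then show ?thesis by (simp add: d_def)
qed

lemma limit_functional_power: "limit_functional \<kappa> (\<lambda>y. y ^ p) = limit_moment \<kappa> p"
proof (cases "odd p")
  case True
  have "integral {0..pi/2} (\<lambda>\<phi>. chord_weight \<kappa> \<phi> * sym_integral (\<lambda>y. y ^ p) (chord \<kappa> \<phi>)) = integral {0..pi/2} (\<lambda>\<phi>. 0)"
    using True chord_nonneg by (intro Henstock_Kurzweil_Integration.integral_cong) (simp add: sym_integral_power)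
  then show ?thesis using True by (simp add: limit_functional_def limit_moment_def)
next
  case False
  then obtain l where l: "p = 2 * l" by (auto elim: evenE)
  have "integral {0..pi/2} (\<lambda>\<phi>. chord_weight \<kappa> \<phi> * sym_integral (\<lambda>y. y ^ p) (chord \<kappa> \<phi>)) =
    integral {0..pi/2} (\<lambda>\<phi>. 2 / (2 * real l + 1) * (chord \<kappa> \<phi> ^ (2 * l + 2) / ((1 + \<kappa>)\<^sup>2 - (chord \<kappa> \<phi>)\<^sup>2)))"
    using chord_nonneg by (intro Henstock_Kurzweil_Integration.integral_cong) (simp add: sym_integral_power l chord_weight_def mult_ac)
  then have "limit_functional \<kappa> (\<lambda>y. y ^ p) = half_integral l / (2 * real l + 1)"
  proof -
    have "a / (2 * p) * (2 / q * J) = a / p * J / q" for a p q J :: real by simp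
    then show ?thesis using \<open>integral _ _ = _\<close>
      unfolding limit_functional_def half_integral_def by (simp only: integral_mult_right)
  qed
  also have "\<dots> = limit_moment \<kappa> p"
    unfolding half_integral_eq_half_sum half_sum_def trunc_binomial_def limit_moment_def l sum_divide_distrib sum_distrib_left
  proof (simp, intro sum.cong refl)
    fix b assume b: "b \<in> {..l}"
    have "real ((2 * l + 1) choose b) = fact (2 * l + 1) / (fact b * fact (2 * l + 1 - b))"
      using b by (intro binomial_fact) auto
    also have "(fact (2 * l + 1) :: real) = (2 * real l + 1) * fact (2 * l)" by simp
    finally have "real (Suc (2 * l) choose b) / (2 * real l + 1) = fact (2 * l) / (fact b * fact (Suc (2 * l) - b))"
      by (simp add: divide_simps add_nonneg_eq_0_iff)
    then have e: "real (Suc (2 * l) choose b) / (2 * real l + 1) = fact (2 * l) / (fact b * fact (Suc (2 * l) - b))" .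
    have "real (Suc (2 * l) choose b) * \<kappa> ^ (Suc (2 * l) - b) / (2 * real l + 1) =
      real (Suc (2 * l) choose b) / (2 * real l + 1) * \<kappa> ^ (Suc (2 * l) - b)" by simp
    also have "\<dots> = fact (2 * l) * \<kappa> ^ (Suc (2 * l) - b) / (fact (Suc (2 * l) - b) * fact b)"
      unfolding e by (simp only: mult.commute times_divide_eq_right)
    finally show "real (Suc (2 * l) choose b) * \<kappa> ^ (Suc (2 * l) - b) / (2 * real l + 1) =
      fact (2 * l) * \<kappa> ^ (Suc (2 * l) - b) / (fact (Suc (2 * l) - b) * fact b)" .
  qed
  finally show ?thesis .
qed

theorem scaled_level_mean_limit:
  assumes N: "filterlim N at_top sequentially" and k: "\<And>i. 1 \<le> k i" "\<And>i. k i \<le> N i"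
    and lim: "(\<lambda>i. real (k i) / real (N i)) \<longlonglongrightarrow> \<kappa>" and f: "continuous_on UNIV f"
  shows "(\<lambda>i. scaled_level_mean (N i) (k i) f) \<longlonglongrightarrow> limit_functional \<kappa> f"
proof (rule LIMSEQ_I)
  fix e :: real assume e: "e > 0"
  have N1: "1 \<le> N i" for i using k[of i] by linarith
  define K where "K = 2 / (1 - \<kappa>)"
  have K: "K > 0" using \<kappa> by (simp add: K_def)
  \<comment> \<open>The total error is \<open>\<epsilon>\<close> for the finite mean,
    \<open>\<epsilon>\<close> for the convergence of the polynomial means and
    \<open>K \<epsilon>\<close> for the limit functional.\<close>
  define \<epsilon> where "\<epsilon> = e / (2 + K)"
  have \<epsilon>: "\<epsilon> > 0" using e K by (simp add: \<epsilon>_def)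
  obtain g where g: "real_polynomial_function g" "\<And>x. x \<in> {-2..2} \<Longrightarrow> \<bar>f x - g x\<bar> < \<epsilon>"
    by (rule Stone_Weierstrass_real_polynomial_function[of "{-2..2}" f \<epsilon>, OF compact_Icc continuous_on_subset[OF f subset_UNIV] \<epsilon>]) blast
  obtain c d where cd: "g = (\<lambda>x. \<Sum>i\<le>d. c i * x ^ i)" using g(1) real_polynomial_function_iff_sum by blast
  have gc: "continuous_on UNIV g" unfolding cd by (intro continuous_intros)
  have close: "\<bar>f u - g u\<bar> \<le> \<epsilon>" if "\<bar>u\<bar> \<le> 2" for u using g(2)[of u] that by (auto simp: abs_le_iff)
  have "(\<lambda>i. scaled_level_mean (N i) (k i) g) \<longlonglongrightarrow> limit_functional \<kappa> g"
    unfolding cd limit_functional_poly scaled_level_mean_poly[OF N1] limit_functional_power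
    by (intro tendsto_intros scaled_level_mean_power_limit[OF N k lim])
  from LIMSEQ_D[OF this \<epsilon>] obtain i0
    where i0: "\<forall>i\<ge>i0. norm (scaled_level_mean (N i) (k i) g - limit_functional \<kappa> g) < \<epsilon>" by (elim exE)
  show "\<exists>i0. \<forall>i\<ge>i0. norm (scaled_level_mean (N i) (k i) f - limit_functional \<kappa> f) < e"
  proof (intro exI allI impI)
    fix i assume "i \<ge> i0"
    have 1: "\<bar>scaled_level_mean (N i) (k i) f - scaled_level_mean (N i) (k i) g\<bar> \<le> \<epsilon>"
      unfolding scaled_level_mean_diff[OF N1, symmetric] by (rule scaled_level_mean_abs_le[OF k]) (rule close)
    have 2: "\<bar>limit_functional \<kappa> f - limit_functional \<kappa> g\<bar> \<le> K * \<epsilon>"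
      unfolding limit_functional_diff[OF f gc, symmetric] K_def
      by (rule limit_functional_abs_le) (use close f gc in \<open>auto intro: continuous_on_diff\<close>)
    have "\<bar>scaled_level_mean (N i) (k i) f - limit_functional \<kappa> f\<bar> < \<epsilon> + \<epsilon> + K * \<epsilon>"
      using 1 2 i0[rule_format, OF \<open>i \<ge> i0\<close>] unfolding real_norm_def by linarith
    also have "\<dots> = \<epsilon> * (2 + K)" by (simp add: algebra_simps)
    also have "\<dots> = e" using K by (simp add: \<epsilon>_def)
    finally show "norm (scaled_level_mean (N i) (k i) f - limit_functional \<kappa> f) < e" by simp
  qed
qed

text \<open>A mixture of indicators of intervals has density at most its total weight, here
  \<open>arctan s / (2 \<pi>) < 1 / 4\<close>, computed with the antiderivative
  \<open>arctan (s sin \<phi>)\<close>; a support of length \<open>2 h\<close> gives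
  \<open>h / 2\<close>. Since full occupation has density \<open>1 / 2\<close> in this scale, at
  most half of the sites are occupied.\<close>

lemma limit_functional_bump_le:
  assumes f: "continuous_on UNIV f" and "h \<ge> 0" "\<And>u. 0 \<le> f u" "\<And>u. f u \<le> 1" "\<And>u. \<bar>u - c\<bar> \<ge> h \<Longrightarrow> f u = 0"
  shows "limit_functional \<kappa> f \<le> h / 2"
proof -
  define s where "s = 2 * sqrt \<kappa> / (1 - \<kappa>)"
  have "integral {0..pi/2} (\<lambda>\<phi>. chord_weight \<kappa> \<phi> * sym_integral f (chord \<kappa> \<phi>)) \<le>
      integral {0..pi/2} (\<lambda>\<phi>. chord_weight \<kappa> \<phi> * (2 * h))"
    using chord_nonneg chord_weight_nonneg
    by (intro integral_le integrable_continuous_real continuous_integrand[OF f] continuous_intros continuous_arc_weight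
        mult_left_mono sym_integral_bump_le[where c = c]) (use assms in auto)
  also have "\<dots> = 2 * h * integral {0..pi/2} (chord_weight \<kappa>)" by simp
  also have "integral {0..pi/2} (chord_weight \<kappa>) = arctan s / (1 - \<kappa>)"
  proof -
    have "(chord_weight \<kappa> has_integral (arctan (s * sin (pi/2)) / (1 - \<kappa>) - arctan (s * sin 0) / (1 - \<kappa>))) {0..pi/2}"
    proof (rule fundamental_theorem_of_calculus)
      fix x :: real
      have "((\<lambda>\<phi>. arctan (s * sin \<phi>) / (1 - \<kappa>)) has_real_derivative
          inverse (1 + (s * sin x)\<^sup>2) * (s * cos x) / (1 - \<kappa>)) (at x within {0..pi/2})"
        by (rule derivative_eq_intros refl | use \<kappa> in simp)+
      moreover have "inverse (1 + (s * sin x)\<^sup>2) * (s * cos x) / (1 - \<kappa>) = chord_weight \<kappa> x"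
      proof -
        have den: "(1 + \<kappa>)\<^sup>2 - (chord \<kappa> x)\<^sup>2 = (1 - \<kappa>)\<^sup>2 * (1 + (s * sin x)\<^sup>2)"
        proof -
          have "(1 - \<kappa>)\<^sup>2 * (s * sin x)\<^sup>2 = 4 * \<kappa> * (sin x)\<^sup>2"
            using \<kappa> by (simp add: s_def power_mult_distrib power_divide)
          moreover have "(sin x)\<^sup>2 = 1 - (cos x)\<^sup>2" using sin_cos_squared_add[of x] by linarith
          ultimately have "(1 - \<kappa>)\<^sup>2 * (1 + (s * sin x)\<^sup>2) = (1 - \<kappa>)\<^sup>2 + 4 * \<kappa> * (1 - (cos x)\<^sup>2)"
            by (simp only: distrib_left mult_1_right)
          then show ?thesis unfolding chord_square by (simp only:) (simp add: power2_eq_square algebra_simps)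
        qed
        have "1 + (s * sin x)\<^sup>2 \<noteq> 0" by (smt (verit) zero_le_power2)
        then show ?thesis unfolding chord_weight_def den using \<kappa>
          by (simp add: s_def chord_def power2_eq_square field_simps)
      qed
      ultimately show "((\<lambda>\<phi>. arctan (s * sin \<phi>) / (1 - \<kappa>)) has_vector_derivative chord_weight \<kappa> x) (at x within {0..pi/2})"
        by (simp add: has_real_derivative_iff_has_vector_derivative)
    qed simp
    then show ?thesis by (simp add: integral_unique)
  qed
  finally have "limit_functional \<kappa> f \<le> (1 - \<kappa>) / (2 * pi) * (2 * h * (arctan s / (1 - \<kappa>)))"
    unfolding limit_functional_def using \<kappa> by (intro mult_left_mono) auto
  also have "\<dots> = h / pi * arctan s" using \<kappa> by (simp add: field_simps)
  also have "\<dots> \<le> h / pi * (pi / 2)" using arctan_ubound[of s] assms(2) by (intro mult_left_mono) auto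
  finally show ?thesis by simp
qed

text \<open>The longest chord, at \<open>\<phi> = 0\<close>, covers the whole interval between
  \<open>- 2 sqrt \<kappa>\<close> and \<open>2 sqrt \<kappa>\<close> and hence \<open>c\<close>.
  The integrand is continuous and nonnegative, so one nonzero value suffices.\<close>

lemma limit_functional_pos:
  assumes f: "continuous_on UNIV f" and "\<And>u. 0 \<le> f u" "f c > 0" "\<bar>c\<bar> < 2 * sqrt \<kappa>"
  shows "limit_functional \<kappa> f > 0"
proof -
  let ?g = "\<lambda>\<phi>. chord_weight \<kappa> \<phi> * sym_integral f (chord \<kappa> \<phi>)"
  have nonneg: "sym_integral f Y \<ge> 0" for Y unfolding sym_integral_def using assms(2)
    by (simp add: Henstock_Kurzweil_Integration.integral_nonneg integrable_on_continuous_UNIV[OF f])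
  have arc0: "chord \<kappa> 0 = 2 * sqrt \<kappa>" by (simp add: chord_def)
  have "sym_integral f (2 * sqrt \<kappa>) \<noteq> 0"
  proof
    assume "sym_integral f (2 * sqrt \<kappa>) = 0"
    then have "\<forall>u\<in>{- (2 * sqrt \<kappa>)..2 * sqrt \<kappa>}. f u = 0"
      using integral_eq_0_iff[of "- (2 * sqrt \<kappa>)" "2 * sqrt \<kappa>" f] continuous_on_subset[OF f] assms(2) \<kappa>
      by (simp add: sym_integral_def)
    moreover have "c \<in> {- (2 * sqrt \<kappa>)..2 * sqrt \<kappa>}" using assms(4) by auto
    ultimately show False using assms(3) by auto
  qed
  then have "?g 0 \<noteq> 0" using \<kappa> chord_denominator(3)[of 0] by (simp add: chord_weight_def arc0)
  moreover have "0 \<in> {0..pi/2}" by simp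
  ultimately have "integral {0..pi/2} ?g \<noteq> 0"
    using integral_eq_0_iff[OF continuous_integrand[OF f]] chord_weight_nonneg nonneg by force
  moreover have "integral {0..pi/2} ?g \<ge> 0"
    using chord_weight_nonneg nonneg
    by (intro Henstock_Kurzweil_Integration.integral_nonneg integrable_continuous_real continuous_integrand[OF f]) auto
  ultimately show ?thesis unfolding limit_functional_def using \<kappa> by (simp add: zero_less_mult_iff)
qed

end

section \<open>Edges in a disc\<close>

text \<open>The rescaled position \<open>(n + k - 1 - 2 x) / n\<close> is \<open>-2\<close> times
  the rescaled abscissa, which explains the factors \<open>-2\<close> and the changes of sign
  below.\<close>

lemma up_vertex_coords:
  assumes "1 \<le> n"
  shows "up_vertex n k x = (- (real (n + k - 1) - 2 * real x) / 2, (real n - real k + 1 / 3) * sqrt 3 / 2)"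
proof -
  have "real (n + k - 1) = real n + real k - 1" using assms by (simp add: of_nat_diff)
  then show ?thesis by (simp add: up_vertex_def up_centre_def pt_eq field_simps)
qed

definition right_direction :: "plane set" where
  "right_direction = span {pt (1 / 3) (1 / 3)}"

definition left_direction :: "plane set" where
  "left_direction = span {pt (-2 / 3) (1 / 3)}"

definition vert_direction :: "plane set" where
  "vert_direction = span {pt (1 / 3) (-2 / 3)}"

lemma edge_direction_pair: "edge_direction {p, q} = span {q - p}"
proof -
  have "{x - y |x y. x \<in> {p, q} \<and> y \<in> {p, q}} = {p - p, p - q, q - p, q - q}" by blast
  also have "\<dots> = insert 0 (insert (- (q - p)) {q - p})"
    by (simp only: diff_self minus_diff_eq insert_commute insert_absorb2)
  finally have "{x - y |x y. x \<in> {p, q} \<and> y \<in> {p, q}} = insert 0 (insert (- (q - p)) {q - p})" .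
  then have "edge_direction {p, q} = span (insert (- (q - p)) {q - p})"
    by (simp only: edge_direction_def span_insert_0)
  also have "\<dots> = span {q - p}"
    by (rule span_redundant, rule span_neg, rule span_base) simp
  finally show ?thesis .
qed

lemma edge_direction_up_down:
  "edge_direction {up_centre a b, down_centre c d} =
    span {pt (real_of_int c - real_of_int a + 1 / 3) (real_of_int d - real_of_int b + 1 / 3)}"
  unfolding edge_direction_pair up_centre_def down_centre_def pt_diff by (simp add: algebra_simps)

lemma edge_direction_cases:
  "edge_direction (right_edge n k x) = right_direction"
  "edge_direction (left_edge n k x) = left_direction"
  "edge_direction (vert_edge n k x) = vert_direction"
  unfolding right_edge_def left_edge_def vert_edge_def up_vertex_def down_vertex_def edge_direction_up_down
    right_direction_def left_direction_def vert_direction_def by simp_all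

lemma edge_directions_eq: "edge_directions = {right_direction, left_direction, vert_direction}"
proof (intro equalityI subsetI)
  fix \<theta> assume "\<theta> \<in> edge_directions"
  then obtain a b c d where "\<theta> = edge_direction {up_centre a b, down_centre c d}" "dual_adj a b c d"
    unfolding edge_directions_def dual_edges_eq by blast
  then show "\<theta> \<in> {right_direction, left_direction, vert_direction}"
    unfolding edge_direction_up_down dual_adj_def right_direction_def left_direction_def vert_direction_def by auto
next
  have mem: "edge_direction {up_centre 0 0, down_centre c d} \<in> edge_directions" if "dual_adj 0 0 c d" for c d
    unfolding edge_directions_def dual_edges_eq using that by blast
  fix \<theta> assume "\<theta> \<in> {right_direction, left_direction, vert_direction}"
  then show "\<theta> \<in> edge_directions"
    using mem[of 0 0] mem[of "-1" 0] mem[of 0 "-1"]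
    unfolding edge_direction_up_down dual_adj_def right_direction_def left_direction_def vert_direction_def by auto
qed

lemma vert_direction_neq: "vert_direction \<noteq> right_direction" "vert_direction \<noteq> left_direction"
proof -
  have v: "pt (1 / 3) (-2 / 3) \<in> vert_direction" by (simp add: vert_direction_def span_base)
  have "pt (1 / 3) (-2 / 3) \<notin> right_direction" "pt (1 / 3) (-2 / 3) \<notin> left_direction"
    unfolding right_direction_def left_direction_def span_singleton by (auto simp: pt_scale)
  with v show "vert_direction \<noteq> right_direction" "vert_direction \<noteq> left_direction" by metis+
qed

lemma edge_midpoint_dist:
  assumes "dual_adj a b c d"
  shows "dist (edge_midpoint {up_centre a b, down_centre c d}) (up_centre a b) \<le> 1"
proof -
  let ?u = "up_centre a b" and ?d = "down_centre c d"
  have "dist (edge_midpoint {?u, ?d}) ?u = norm ((1/2) *\<^sub>R (?d - ?u))"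
  proof -
    have "(\<Sum>x\<in>{?u, ?d}. x) = ?u + ?d" by (subst sum.insert) auto
    then have "edge_midpoint {?u, ?d} - ?u = (1/2) *\<^sub>R (?d - ?u)"
      by (simp only: edge_midpoint_def) (simp add: prod_eq_iff field_simps)
    then show ?thesis by (simp only: dist_norm)
  qed
  also have "\<dots> = dist ?d ?u / 2" by (simp add: dist_norm)
  also have "dist ?d ?u \<le> 1"
  proof -
    have "(dist ?d ?u)\<^sup>2 \<le> 1\<^sup>2"
      using assms unfolding up_centre_def down_centre_def dist_pt dual_adj_def
      by (auto simp: power2_eq_square field_simps)
    then show ?thesis by (rule power2_le_imp_le) simp
  qed
  finally show ?thesis by simp
qed

lemma vertex_edge_midpoint_dist:
  "dist (edge_midpoint (right_edge n k x)) (up_vertex n k x) \<le> 1"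
  "dist (edge_midpoint (left_edge n k x)) (up_vertex n k (Suc x)) \<le> 1"
  "dist (edge_midpoint (vert_edge n k x)) (up_vertex n k x) \<le> 1"
  unfolding right_edge_def left_edge_def vert_edge_def up_vertex_def down_vertex_def
  by (rule edge_midpoint_dist; simp add: dual_adj_def)+

text \<open>Every edge of a matching is attached to its unique upward end, so that edges near a
  point can be counted by sites; left edges are shifted by one column for this reason.\<close>

definition edge_at :: "nat \<Rightarrow> (nat \<Rightarrow> nat set) \<Rightarrow> nat \<Rightarrow> nat \<Rightarrow> plane set \<Rightarrow> bool" where
  "edge_at n X k x e \<longleftrightarrow>
     (e = right_edge n k x \<and> right_formula n X k x) \<or>
     (e = left_edge n k (x - 1) \<and> 1 \<le> x \<and> left_formula n X k (x - 1)) \<or>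
     (e = vert_edge n k x \<and> vert_formula n X k x)"

lemma edge_at_midpoint: "edge_at n X k x e \<Longrightarrow> dist (edge_midpoint e) (up_vertex n k x) \<le> 1"
  unfolding edge_at_def using vertex_edge_midpoint_dist(2)[of n k "x - 1"] vertex_edge_midpoint_dist(1,3) by auto

lemma edge_at_unique_vertex: "edge_at n X k x e \<Longrightarrow> edge_at n X k' x' e \<Longrightarrow> k = k' \<and> x = x'"
  unfolding edge_at_def by auto

lemma matching_edge_at:
  assumes n: "n \<ge> 1" and M: "M \<in> matchings n"
  defines "X \<equiv> matching_levels n M"
  shows "e \<in> M \<Longrightarrow> \<exists>k x. up_index n k x \<and> edge_at n X k x e"
    and "up_index n k x \<Longrightarrow> \<exists>e\<in>M. edge_at n X k x e"
    and "edge_at n X k x e \<Longrightarrow> e \<in> M"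
proof -
  note c = matching_consistent[OF n M] and f = matching_edges[OF n M, folded X_def]
  show "edge_at n X k x e \<Longrightarrow> e \<in> M" unfolding edge_at_def f[symmetric] by blast
  show "\<exists>k x. up_index n k x \<and> edge_at n X k x e" if e: "e \<in> M"
  proof -
    have "e \<in> edge_set n (\<lambda>k x. right_edge n k x \<in> M) (\<lambda>k x. left_edge n k x \<in> M) (\<lambda>k x. vert_edge n k x \<in> M)"
      using e matching_eq_edge_set[OF n M] by blast
    then consider k x where "e = right_edge n k x" | k x where "e = left_edge n k x" | k x where "e = vert_edge n k x"
      unfolding edge_set_def by blast
    then show ?thesis
    proof cases
      case (1 k x)
      then have "up_index n k x" using consistentD(1)[OF c, of k x] e by simp
      then show ?thesis using 1 e unfolding edge_at_def f[symmetric] by blast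
    next
      case (2 k x)
      then have "up_index n k (Suc x)" using consistentD(3)[OF c, of k x] e by simp
      moreover have "edge_at n X k (Suc x) e" using 2 e unfolding edge_at_def f[symmetric] by simp
      ultimately show ?thesis by blast
    next
      case (3 k x)
      then have "up_index n k x" using consistentD(5)[OF c, of k x] e by simp
      then show ?thesis using 3 e unfolding edge_at_def f[symmetric] by blast
    qed
  qed
  show "\<exists>e\<in>M. edge_at n X k x e" if "up_index n k x"
    using consistentD(7)[OF c that] unfolding edge_at_def f[symmetric] exactly_one_def by blast
qed

lemma card_matching_le:
  assumes n: "n \<ge> 1" and M: "M \<in> matchings n"
  shows "finite M" "card M \<le> 18 * n\<^sup>2"
proof -
  let ?S = "{..n + 1} \<times> {..<2 * n}"
  let ?E = "(\<lambda>(k, x). right_edge n k x) ` ?S \<union> (\<lambda>(k, x). left_edge n k x) ` ?S \<union> (\<lambda>(k, x). vert_edge n k x) ` ?S"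
  have "M \<subseteq> ?E"
  proof
    fix e assume "e \<in> M"
    then obtain k x where kx: "up_index n k x" "edge_at n (matching_levels n M) k x e"
      using matching_edge_at(1)[OF n M] by blast
    then have "(k, x) \<in> ?S" "(k, x - 1) \<in> ?S" by (auto simp: up_index_def)
    then show "e \<in> ?E" using kx(2) unfolding edge_at_def by force
  qed
  moreover have fin: "finite ?E" by simp
  ultimately show "finite M" by (rule finite_subset)
  have "card M \<le> card ?E" by (rule card_mono[OF fin \<open>M \<subseteq> ?E\<close>])
  also have "\<dots> \<le> card ?S + card ?S + card ?S"
    by (intro card_Un_le[THEN order_trans] add_mono card_image_le) auto
  also have "\<dots> = 6 * n * (n + 2)" by (simp add: card_cartesian_product)
  also have "\<dots> \<le> 6 * n * (3 * n)" using n by (intro mult_left_mono) auto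
  finally show "card M \<le> 18 * n\<^sup>2" by (simp add: power2_eq_square)
qed

text \<open>The random denominator is replaced by its bound \<open>18 n^2\<close>, so that
  \<open>1 - proportion\<close> dominates a count of edges of other directions, which is additive
  over sites. If no edge lies in the disc, the proportion is 0 and this bound is trivial.\<close>

lemma proportion_bounds:
  fixes D :: "plane set"
  assumes n: "n \<ge> 1" and M: "M \<in> matchings n"
  defines "N \<equiv> edges_in M ((\<lambda>x. real n *\<^sub>R x) ` D)"
  shows "0 \<le> proportion n \<theta> D M" "proportion n \<theta> D M \<le> 1"
    and "real (card {e \<in> N. edge_direction e \<noteq> \<theta>}) / (18 * (real n)\<^sup>2) \<le> 1 - proportion n \<theta> D M"
    and "N \<noteq> {} \<Longrightarrow> (\<And>e. e \<in> N \<Longrightarrow> edge_direction e = \<theta>) \<Longrightarrow> proportion n \<theta> D M = 1"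
proof -
  have fin: "finite N" using card_matching_le(1)[OF n M] by (simp add: N_def edges_in_def)
  have p: "proportion n \<theta> D M = real (card {e \<in> N. edge_direction e = \<theta>}) / real (card N)"
    by (simp add: proportion_def N_def Let_def)
  have split: "card N = card {e \<in> N. edge_direction e = \<theta>} + card {e \<in> N. edge_direction e \<noteq> \<theta>}"
  proof -
    have "N = {e \<in> N. edge_direction e = \<theta>} \<union> {e \<in> N. edge_direction e \<noteq> \<theta>}" by blast
    then show ?thesis using fin card_Un_disjoint[of "{e \<in> N. edge_direction e = \<theta>}" "{e \<in> N. edge_direction e \<noteq> \<theta>}"] by auto
  qed
  show "0 \<le> proportion n \<theta> D M" by (simp add: p)
  show "proportion n \<theta> D M \<le> 1" unfolding p using split by (simp add: divide_le_eq_1) linarith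
  show "real (card {e \<in> N. edge_direction e \<noteq> \<theta>}) / (18 * (real n)\<^sup>2) \<le> 1 - proportion n \<theta> D M"
  proof (cases "N = {}")
    case True then show ?thesis by (simp add: p)
  next
    case False
    then have N0: "real (card N) > 0" using fin by (simp add: card_gt_0_iff)
    have "card N \<le> card M" unfolding N_def edges_in_def by (rule card_mono[OF card_matching_le(1)[OF n M]]) auto
    then have "card N \<le> 18 * n\<^sup>2" using card_matching_le(2)[OF n M] by simp
    then have "real (card N) \<le> real (18 * n\<^sup>2)" by (simp only: of_nat_le_iff)
    then have le: "real (card N) \<le> 18 * (real n)\<^sup>2" by simp
    have "real (card {e \<in> N. edge_direction e \<noteq> \<theta>}) / (18 * (real n)\<^sup>2) \<le> real (card {e \<in> N. edge_direction e \<noteq> \<theta>}) / real (card N)"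
      by (intro divide_left_mono le mult_pos_pos N0) (use n in auto)
    also have "\<dots> = 1 - proportion n \<theta> D M" unfolding p using N0 split by (simp add: field_simps)
    finally show ?thesis .
  qed
  show "proportion n \<theta> D M = 1" if "N \<noteq> {}" "\<And>e. e \<in> N \<Longrightarrow> edge_direction e = \<theta>"
  proof -
    have "{e \<in> N. edge_direction e = \<theta>} = N" using that by blast
    then show ?thesis using that fin by (simp add: p)
  qed
qed

lemma mem_scaled_ball:
  fixes c :: plane
  assumes "n \<ge> 1"
  shows "p \<in> (\<lambda>x. real n *\<^sub>R x) ` ball c r \<longleftrightarrow> dist p (real n *\<^sub>R c) < real n * r"
proof -
  have *: "dist (real n *\<^sub>R q) (real n *\<^sub>R c) = real n * dist q c" for q
    by (simp add: dist_norm scaleR_diff_right[symmetric] del: scaleR_diff_right)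
  have "p = real n *\<^sub>R ((1 / real n) *\<^sub>R p)" using assms by simp
  show ?thesis
  proof
    assume "p \<in> (\<lambda>x. real n *\<^sub>R x) ` ball c r"
    then obtain q where "p = real n *\<^sub>R q" "q \<in> ball c r" by blast
    moreover from this have "dist q c < r" by (simp add: dist_commute)
    ultimately show "dist p (real n *\<^sub>R c) < real n * r" using * assms by simp
  next
    assume a: "dist p (real n *\<^sub>R c) < real n * r"
    then have "real n * dist ((1 / real n) *\<^sub>R p) c < real n * r" using *[of "(1 / real n) *\<^sub>R p"] assms by simp
    then have "(1 / real n) *\<^sub>R p \<in> ball c r" using assms by (simp add: dist_commute)
    then show "p \<in> (\<lambda>x. real n *\<^sub>R x) ` ball c r" using \<open>p = _\<close> by blast
  qed
qed

text \<open>The rescaled level of a point: a point at height \<open>y\<close> of the rescaled region belongs to the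
  row whose number of particles is about \<open>n (1 - 2 y / \<surd>3)\<close>.\<close>

definition plane_level :: "plane \<Rightarrow> real" where
  "plane_level p = 1 - 2 * snd p / sqrt 3"

lemma plane_level_vertex:
  assumes "n \<ge> 1"
  shows "plane_level ((1 / real n) *\<^sub>R up_vertex n k x) = real k / real n - 1 / (3 * real n)"
  unfolding plane_level_def up_vertex_coords[OF assms] using assms by (simp add: field_simps)

section \<open>The frozen region\<close>

lemma plane_dist_le:
  fixes p q :: plane
  shows "dist p q \<le> \<bar>fst p - fst q\<bar> + \<bar>snd p - snd q\<bar>"
proof -
  have "dist p q = norm (fst p - fst q, snd p - snd q)" by (cases p; cases q) (simp add: dist_norm)
  then show ?thesis using norm_Pair_le[of "fst p - fst q" "snd p - snd q"] by simp
qed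

lemma dist_nat_scaleR:
  fixes p q :: plane
  shows "dist (real n *\<^sub>R p) (real n *\<^sub>R q) = real n * dist p q"
  by (simp add: dist_norm scaleR_diff_right[symmetric] del: scaleR_diff_right)

text \<open>The sign \<open>s\<close> selects the side. In terms of \<open>plane_level\<close> the
  parabola reads \<open>plane_level p = (fst p)^2\<close>: the row at level \<open>\<kappa>\<close>
  is cut at the abscissas plus and minus \<open>sqrt \<kappa>\<close>.\<close>

definition frozen_zone :: "real \<Rightarrow> plane set" where
  "frozen_zone s = {p. 0 < s * fst p \<and> plane_level p < (fst p)\<^sup>2 \<and> 0 < plane_level p \<and> plane_level p < 1}"

lemma continuous_plane_level: "continuous_on A plane_level"
  unfolding plane_level_def by (intro continuous_intros) auto

lemma open_frozen_zone: "open (frozen_zone s)"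
proof -
  have "frozen_zone s = {p. 0 < s * fst p} \<inter> {p. plane_level p < (fst p)\<^sup>2} \<inter> {p. 0 < plane_level p} \<inter> {p. plane_level p < 1}"
    by (auto simp: frozen_zone_def)
  moreover have "open \<dots>"
    by (intro open_Int open_Collect_less continuous_intros continuous_plane_level)
  ultimately show ?thesis by simp
qed

text \<open>Compactness: a closed disc in the open zone can be enlarged slightly, and on the
  enlarged disc the horizontal distance to the parabola attains a positive minimum.\<close>

lemma frozen_zone_margin:
  assumes "cball c r \<subseteq> frozen_zone s" "r > 0" "s = 1 \<or> s = -1"
  obtains \<epsilon> \<delta> where "\<epsilon> > 0" "0 < \<delta>" "\<delta> \<le> 2"
    "\<And>p. dist p c \<le> r + \<epsilon> \<Longrightarrow> p \<in> frozen_zone s \<and> sqrt (plane_level p) + \<delta> \<le> s * fst p"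
proof -
  obtain \<epsilon> where \<epsilon>: "\<epsilon> > 0" "{x. infdist x (cball c r) \<le> \<epsilon>} \<subseteq> frozen_zone s"
    using compact_in_open_separated[of "cball c r" "frozen_zone s"] assms(1,2) open_frozen_zone by (metis cball_eq_empty compact_cball less_le_not_le order.asym)
  have sub: "cball c (r + \<epsilon>) \<subseteq> frozen_zone s"
  proof
    fix p assume p: "p \<in> cball c (r + \<epsilon>)"
    have "infdist p (cball c r) \<le> \<epsilon>"
    proof (cases "dist c p \<le> r")
      case True
      then have "infdist p (cball c r) = 0" by simp
      then show ?thesis using \<epsilon>(1) by simp
    next
      case False
      define d where "d = dist c p"
      have d: "d > r" "d \<le> r + \<epsilon>" using False p by (auto simp: d_def)
      define q where "q = c + (r / d) *\<^sub>R (p - c)"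
      have np: "norm (p - c) = d" by (simp add: d_def dist_norm norm_minus_commute)
      have "dist c q = r" using d assms(2) np by (simp add: q_def dist_norm)
      then have "infdist p (cball c r) \<le> dist p q" by (intro infdist_le) simp
      also have "p - q = (1 - r / d) *\<^sub>R (p - c)" by (simp add: q_def algebra_simps)
      then have "dist p q = (1 - r / d) * d" using d assms(2) np by (simp add: dist_norm)
      also have "(1 - r / d) * d = d - r" using d assms(2) by (simp add: field_simps)
      also have "d - r \<le> \<epsilon>" using d by simp
      finally show ?thesis .
    qed
    then show "p \<in> frozen_zone s" using \<epsilon>(2) by blast
  qed
  let ?g = "\<lambda>p. s * fst p - sqrt (plane_level p)"
  have pos: "?g p > 0" if "p \<in> frozen_zone s" for p
  proof -
    have "sqrt (plane_level p) < sqrt ((fst p)\<^sup>2)" using that by (intro real_sqrt_less_mono) (simp add: frozen_zone_def)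
    also have "\<dots> = s * fst p" using that assms(3) by (auto simp: frozen_zone_def)
    finally show ?thesis by simp
  qed
  have "continuous_on (cball c (r + \<epsilon>)) ?g"
    by (intro continuous_intros continuous_plane_level)
  moreover have "cball c (r + \<epsilon>) \<noteq> {}" using assms(2) \<epsilon>(1) by simp
  ultimately obtain q where q: "q \<in> cball c (r + \<epsilon>)" "\<And>p. p \<in> cball c (r + \<epsilon>) \<Longrightarrow> ?g q \<le> ?g p"
    using continuous_attains_inf[OF compact_cball, of c "r + \<epsilon>" ?g] by blast
  \<comment> \<open>The cap 2 matches the range of \<open>\<delta>\<close> allowed in
    \<open>edge_particle_tail\<close>.\<close>
  show thesis
  proof (rule that[OF \<epsilon>(1), of "min 2 (?g q)"])
    have "?g q > 0" using pos q(1) sub by blast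
    then show "0 < min 2 (?g q)" by simp
    show "min 2 (?g q) \<le> 2" by simp
    fix p assume "dist p c \<le> r + \<epsilon>"
    then have p: "p \<in> cball c (r + \<epsilon>)" by (simp add: dist_commute)
    have "min 2 (?g q) \<le> ?g p" using q(2)[OF p] by (rule min.coboundedI2)
    then show "p \<in> frozen_zone s \<and> sqrt (plane_level p) + min 2 (?g q) \<le> s * fst p" using sub p by auto
  qed
qed

text \<open>To the right of all \<open>k\<close> particles of row \<open>k\<close> the surplus over
  row \<open>k - 1\<close> is positive, since that row has only \<open>k - 1\<close> particles; this
  excludes a right edge. To the left of all of them row \<open>k\<close> has no particle yet, which
  excludes a left edge.\<close>

lemma frozen_edge:
  assumes n: "n \<ge> 1" and M: "M \<in> matchings n" and k: "1 \<le> k" "k \<le> n"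
    and e: "edge_at n (matching_levels n M) k x e"
    and s: "s = 1 \<and> matching_levels n M k \<subseteq> {..<x} \<or> s = (-1::real) \<and> matching_levels n M k \<subseteq> {x<..}"
  shows "edge_direction e = (if s = 1 then left_direction else right_direction)"
proof -
  let ?X = "matching_levels n M"
  obtain A where A: "A \<in> base_configs n" "?X \<in> patterns n A"
    using matching_levels_pattern[OF n M] by blast
  note row = patterns_row_cases[OF A k]
  have nx: "\<not> vert_formula n ?X k x" using s by (auto simp: vert_formula_def)
  show ?thesis
  proof (cases "s = 1")
    case True
    then have sub: "?X k \<subseteq> {..<x}" using s by auto
    then have "?X k \<inter> {..<x} = ?X k" by blast
    then have "card (?X k \<inter> {..<x}) = k" using row(5) by simp
    moreover have "card (?X (k - 1) \<inter> {..<x}) \<le> k - 1"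
      using card_mono[of "?X (k - 1)" "?X (k - 1) \<inter> {..<x}"] row(2,6) finite_subset[OF row(2)] by auto
    ultimately have "\<not> right_formula n ?X k x" using k by (auto simp: right_formula_def)
    then show ?thesis using e nx True edge_direction_cases(2) by (auto simp: edge_at_def)
  next
    case False
    then have sub: "?X k \<subseteq> {x<..}" using s by auto
    have "\<not> (1 \<le> x \<and> left_formula n ?X k (x - 1))"
    proof
      assume a: "1 \<le> x \<and> left_formula n ?X k (x - 1)"
      then have "card (?X k \<inter> {..<x}) \<noteq> 0" using k by (auto simp: left_formula_def)
      moreover have "?X k \<inter> {..<x} = {}" using sub by auto
      ultimately show False by simp
    qed
    then show ?thesis using e nx False edge_direction_cases(1) by (auto simp: edge_at_def)
  qed
qed

text \<open>The margin passes from the rescaled plane to row \<open>k\<close>. Centres of upward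
  triangles lie a third of a row off, so \<open>plane_level\<close> is
  \<open>k / n - 1 / (3 n)\<close>; subadditivity of the square root pays for this with half of
  \<open>\<delta>\<close>.\<close>

lemma frozen_vertex:
  assumes n: "n \<ge> 1" and big: "1 / real n \<le> \<epsilon>" "2 / sqrt (3 * real n) \<le> \<delta>"
    and margin: "\<And>p. dist p c \<le> r + \<epsilon> \<Longrightarrow> p \<in> frozen_zone s \<and> sqrt (plane_level p) + \<delta> \<le> s * fst p"
    and s: "s = 1 \<or> s = -1"
    and u: "dist (up_vertex n k x) (real n *\<^sub>R c) \<le> real n * r + 1"
  shows "1 \<le> k" "k \<le> n" "- s * (real (n + k - 1) - 2 * real x) \<ge> 2 * sqrt (real k * real n) + \<delta> * real n"
proof -
  let ?p = "(1 / real n) *\<^sub>R up_vertex n k x"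
  let ?Y = "real (n + k - 1) - 2 * real x"
  have n0: "real n > 0" using n by simp
  have "up_vertex n k x = real n *\<^sub>R ?p" using n0 by simp
  then have "real n * dist ?p c = dist (up_vertex n k x) (real n *\<^sub>R c)"
    by (metis dist_nat_scaleR)
  then have "dist ?p c \<le> r + 1 / real n" using u n0 by (simp add: field_simps)
  then have "dist ?p c \<le> r + \<epsilon>" using big(1) by simp
  note m = margin[OF this]
  have lev: "plane_level ?p = real k / real n - 1 / (3 * real n)" by (rule plane_level_vertex[OF n])
  have f: "fst ?p = - ?Y / (2 * real n)" using up_vertex_coords[OF n, of k x] n0 by simp
  have "0 < real k / real n - 1 / (3 * real n)" "real k / real n - 1 / (3 * real n) < 1"
    using m lev by (auto simp: frozen_zone_def)
  then have "1 < 3 * real k" "3 * real k < 3 * real n + 1" using n0 by (auto simp: field_simps)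
  then show "1 \<le> k" "k \<le> n" by linarith+
  have "sqrt (real k / real n) \<le> sqrt (real k / real n - 1 / (3 * real n)) + sqrt (1 / (3 * real n))"
    using sqrt_add_le_add_sqrt[of "real k / real n - 1 / (3 * real n)" "1 / (3 * real n)"]
      \<open>0 < real k / real n - 1 / (3 * real n)\<close> n0 by simp
  moreover have "sqrt (1 / (3 * real n)) \<le> \<delta> / 2" using big(2) by (simp add: real_sqrt_divide)
  ultimately have "sqrt (real k / real n) + \<delta> / 2 \<le> s * (- ?Y / (2 * real n))"
    using m unfolding lev f by linarith
  then have "2 * real n * (sqrt (real k / real n) + \<delta> / 2) \<le> 2 * real n * (s * (- ?Y / (2 * real n)))"
    using n0 by (intro mult_left_mono) auto
  also have "2 * real n * (s * (- Y / (2 * real n))) = - s * Y" for Y using n0 by simp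
  finally have "2 * real n * (sqrt (real k / real n) + \<delta> / 2) \<le> - s * ?Y" .
  moreover have "2 * real n * (sqrt (real k / real n) + \<delta> / 2) = 2 * (real n * sqrt (real k / real n)) + \<delta> * real n"
    by (simp add: algebra_simps)
  moreover have "real n * sqrt (real k / real n) = sqrt (real k * real n)"
    using n0 by (simp add: real_sqrt_divide real_sqrt_mult field_simps)
  ultimately show "- s * ?Y \<ge> 2 * sqrt (real k * real n) + \<delta> * real n" by linarith
qed

text \<open>Needed because the proportion is 0 when no edge lies in the disc. Rounding the height
  and abscissa of \<open>n c\<close> gives a triangle at bounded distance, and the strict
  inequalities for \<open>c\<close> keep it in the region for large \<open>n\<close>.\<close>

lemma vertex_near:
  fixes c :: plane
  assumes lev: "0 < plane_level c" "plane_level c < 1" and hor: "\<bar>fst c\<bar> < (1 + plane_level c) / 2"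
  obtains n0 where "\<And>n. n \<ge> n0 \<Longrightarrow> \<exists>k x. up_index n k x \<and> dist (up_vertex n k x) (real n *\<^sub>R c) \<le> 2"
proof -
  define \<kappa> where "\<kappa> = plane_level c"
  define m where "m = min (1 - \<kappa>) ((1 + \<kappa>) / 2 - \<bar>fst c\<bar>)"
  have m: "m > 0" using lev hor by (simp add: m_def \<kappa>_def)
  obtain n0 where n0: "real n0 \<ge> 1 / m" using real_arch_simple by blast
  show thesis
  proof (rule that[of "max 1 n0"])
    fix n assume n: "max 1 n0 \<le> n"
    have rn: "real n \<ge> 1" using n by simp
    have "real n \<ge> 1 / m" using n n0 by (meson max.bounded_iff of_nat_le_iff order_trans)
    then have nm: "real n * m \<ge> 1" using m by (simp add: field_simps)
    have nm1: "real n * (1 - \<kappa>) \<ge> 1"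
      using nm mult_left_mono[of m "1 - \<kappa>" "real n"] by (simp add: m_def)
    have nm2: "real n * ((1 + \<kappa>) / 2 - \<bar>fst c\<bar>) \<ge> 1"
      using nm mult_left_mono[of m "(1 + \<kappa>) / 2 - \<bar>fst c\<bar>" "real n"] by (simp add: m_def)
    define k where "k = nat \<lceil>real n * \<kappa>\<rceil>"
    have nk: "0 < real n * \<kappa>" using rn lev by (simp add: \<kappa>_def)
    have k: "real n * \<kappa> \<le> real k" "real k < real n * \<kappa> + 1"
      using nk unfolding k_def by linarith+
    have k1: "1 \<le> k" using k nk by linarith
    have "real k < real n + 1" using k nm1 by (simp add: algebra_simps)
    then have kn: "k \<le> n" by linarith
    define t where "t = real (n + k - 1) / 2 + real n * fst c"
    have N: "real (n + k - 1) = real n + real k - 1" using k1 by (simp add: of_nat_diff)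
    have nc: "\<bar>real n * fst c\<bar> = real n * \<bar>fst c\<bar>" by (simp add: abs_mult)
    have nm2': "real n * \<bar>fst c\<bar> + 1 \<le> real n / 2 + real n * \<kappa> / 2" using nm2 by (simp add: algebra_simps add_divide_distrib)
    have ac: "- (real n * \<bar>fst c\<bar>) \<le> real n * fst c" "real n * fst c \<le> real n * \<bar>fst c\<bar>"
      using nc by linarith+
    have t: "0 \<le> t" "t < real (n + k)"
      using nm2' ac k unfolding t_def N of_nat_add by argo+
    define x where "x = nat \<lfloor>t\<rfloor>"
    have x: "real x \<le> t" "t < real x + 1" using t unfolding x_def by linarith+
    have "up_index n k x" using k1 kn x t by (auto simp: up_index_def)
    moreover have "dist (up_vertex n k x) (real n *\<^sub>R c) \<le> 2"
    proof -
      have c2: "snd c = (1 - \<kappa>) * sqrt 3 / 2" by (simp add: \<kappa>_def plane_level_def)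
      have "fst (up_vertex n k x) - fst (real n *\<^sub>R c) = real x - t"
        using up_vertex_coords[of n k x] n by (simp add: t_def field_simps)
      then have 1: "\<bar>fst (up_vertex n k x) - fst (real n *\<^sub>R c)\<bar> \<le> 1" using x by simp
      have "snd (up_vertex n k x) - snd (real n *\<^sub>R c) = (real n * \<kappa> - real k + 1 / 3) * (sqrt 3 / 2)"
        using up_vertex_coords[of n k x] n by (simp add: c2 field_simps)
      then have "\<bar>snd (up_vertex n k x) - snd (real n *\<^sub>R c)\<bar> = \<bar>real n * \<kappa> - real k + 1 / 3\<bar> * (sqrt 3 / 2)"
        by (simp only: abs_mult) simp
      also have "\<dots> \<le> 1 * 1"
      proof (intro mult_mono)
        show "\<bar>real n * \<kappa> - real k + 1 / 3\<bar> \<le> 1" using k by linarith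
        show "sqrt 3 / 2 \<le> 1" using real_sqrt_le_mono[of 3 4] by simp
      qed auto
      finally show ?thesis using 1 plane_dist_le[of "up_vertex n k x" "real n *\<^sub>R c"] by linarith
    qed
    ultimately show "\<exists>k x. up_index n k x \<and> dist (up_vertex n k x) (real n *\<^sub>R c) \<le> 2" by blast
  qed
qed

theorem frozen_outside:
  assumes zone: "cball c r \<subseteq> frozen_zone s" and r: "r > 0" and s: "s = 1 \<or> s = -1"
    and hor: "\<bar>fst c\<bar> < (1 + plane_level c) / 2"
  shows "converges_in_probability random_matching
    (\<lambda>n. proportion n (if s = 1 then left_direction else right_direction) (ball c r)) 1"
  unfolding converges_in_probability_def
proof (intro allI impI)
  fix \<eta> :: real assume "\<eta> > 0"
  let ?\<theta> = "if s = 1 then left_direction else right_direction"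
  obtain \<epsilon> \<delta> where ed: "\<epsilon> > 0" "0 < \<delta>" "\<delta> \<le> 2"
    "\<And>p. dist p c \<le> r + \<epsilon> \<Longrightarrow> p \<in> frozen_zone s \<and> sqrt (plane_level p) + \<delta> \<le> s * fst p"
    using frozen_zone_margin[OF zone r s] by blast
  have "c \<in> frozen_zone s" using zone r by auto
  then have lev: "0 < plane_level c" "plane_level c < 1" by (auto simp: frozen_zone_def)
  obtain n0 where n0: "\<And>n. n \<ge> n0 \<Longrightarrow> \<exists>k x. up_index n k x \<and> dist (up_vertex n k x) (real n *\<^sub>R c) \<le> 2"
    using vertex_near[OF lev hor] by blast
  \<comment> \<open>The bad event for row \<open>k\<close>: some particle is beyond the parabola by
    \<open>\<delta> n\<close> in the scale of \<open>N - 2 x\<close>. The union bound over all rows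
    costs only the factor \<open>n\<close> in \<open>?B\<close>.\<close>
  define E where "E n k = {M. \<exists>x\<in>matching_levels n M k. - s * (real (n + k - 1) - 2 * real x) \<ge> 2 * sqrt (real k * real n) + \<delta> * real n}" for n k
  have good: "proportion n ?\<theta> (ball c r) M = 1"
    if n: "n \<ge> 1" "n \<ge> n0" "1 / real n \<le> \<epsilon>" "2 / sqrt (3 * real n) \<le> \<delta>" "3 < real n * r"
      and M: "M \<in> matchings n" "M \<notin> (\<Union>k\<in>{1..n}. E n k)" for n M
  proof (rule proportion_bounds(4)[OF n(1) M(1)])
    let ?X = "matching_levels n M"
    obtain k x where kx: "up_index n k x" "dist (up_vertex n k x) (real n *\<^sub>R c) \<le> 2" using n0[OF n(2)] by blast
    obtain e where e: "e \<in> M" "edge_at n ?X k x e" using matching_edge_at(2)[OF n(1) M(1) kx(1)] by blast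
    have "dist (edge_midpoint e) (real n *\<^sub>R c) \<le> 3"
      using dist_triangle[of "edge_midpoint e" "real n *\<^sub>R c" "up_vertex n k x"] edge_at_midpoint[OF e(2)] kx(2) by linarith
    then have "e \<in> edges_in M ((\<lambda>x. real n *\<^sub>R x) ` ball c r)"
      using e(1) n(5) unfolding edges_in_def mem_Collect_eq mem_scaled_ball[OF n(1)] by simp
    then show "edges_in M ((\<lambda>x. real n *\<^sub>R x) ` ball c r) \<noteq> {}" by blast
  next
    let ?X = "matching_levels n M"
    fix e assume "e \<in> edges_in M ((\<lambda>x. real n *\<^sub>R x) ` ball c r)"
    then have e: "e \<in> M" "dist (edge_midpoint e) (real n *\<^sub>R c) < real n * r"
      unfolding edges_in_def mem_Collect_eq mem_scaled_ball[OF n(1)] by auto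
    obtain k x where kx: "up_index n k x" "edge_at n ?X k x e" using matching_edge_at(1)[OF n(1) M(1) e(1)] by blast
    have "dist (up_vertex n k x) (real n *\<^sub>R c) \<le> real n * r + 1"
      using dist_triangle[of "up_vertex n k x" "real n *\<^sub>R c" "edge_midpoint e"] edge_at_midpoint[OF kx(2)] e(2)
      by (simp add: dist_commute)
    then have fv: "1 \<le> k" "k \<le> n" "- s * (real (n + k - 1) - 2 * real x) \<ge> 2 * sqrt (real k * real n) + \<delta> * real n"
      using frozen_vertex[of n \<epsilon> \<delta> c r s k x] n(1,3,4) ed(4) s by blast+
    have lt: "- s * (real (n + k - 1) - 2 * real x') < - s * (real (n + k - 1) - 2 * real x)" if "x' \<in> ?X k" for x'
    proof -
      have "k \<in> {1..n}" using fv(1,2) by simp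
      then have "M \<notin> E n k" using M(2) by blast
      then have "\<not> - s * (real (n + k - 1) - 2 * real x') \<ge> 2 * sqrt (real k * real n) + \<delta> * real n"
        unfolding E_def using that by blast
      then show ?thesis using fv(3) by linarith
    qed
    have "s = 1 \<and> ?X k \<subseteq> {..<x} \<or> s = -1 \<and> ?X k \<subseteq> {x<..}"
      using s lt by (auto simp: algebra_simps)
    then show "edge_direction e = ?\<theta>" by (rule frozen_edge[OF n(1) M(1) fv(1,2) kx(2)])
  qed
  let ?B = "\<lambda>n. real n * (4 / \<delta> * exp 1 * exp (- \<delta>\<^sup>2 * real n / 8))"
  have bound: "measure_pmf.prob (random_matching n) {M. \<bar>proportion n ?\<theta> (ball c r) M - 1\<bar> > \<eta>} \<le> ?B n"
    if n: "n \<ge> 1" "n \<ge> n0" "1 / real n \<le> \<epsilon>" "2 / sqrt (3 * real n) \<le> \<delta>" "3 < real n * r" for n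
  proof -
    have "measure_pmf.prob (random_matching n) {M. \<bar>proportion n ?\<theta> (ball c r) M - 1\<bar> > \<eta>} \<le>
      measure_pmf.prob (random_matching n) (\<Union>k\<in>{1..n}. E n k)"
    proof (rule measure_pmf.finite_measure_mono_AE)
      show "AE M in measure_pmf (random_matching n). M \<in> {M. \<bar>proportion n ?\<theta> (ball c r) M - 1\<bar> > \<eta>} \<longrightarrow> M \<in> (\<Union>k\<in>{1..n}. E n k)"
      proof (rule AE_pmfI, rule impI, rule ccontr)
        fix M assume "M \<in> set_pmf (random_matching n)" "M \<in> {M. \<bar>proportion n ?\<theta> (ball c r) M - 1\<bar> > \<eta>}" "M \<notin> (\<Union>k\<in>{1..n}. E n k)"
        then have "proportion n ?\<theta> (ball c r) M = 1" using good[OF n] set_pmf_random_matching[OF n(1)] by blast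
        then show False using \<open>M \<in> {M. _}\<close> \<open>\<eta> > 0\<close> by simp
      qed
    qed simp
    also have "\<dots> \<le> (\<Sum>k\<in>{1..n}. measure_pmf.prob (random_matching n) (E n k))"
      by (rule measure_pmf.finite_measure_subadditive_finite) auto
    also have "\<dots> \<le> (\<Sum>k\<in>{1..n}. 4 / \<delta> * exp 1 * exp (- \<delta>\<^sup>2 * real n / 8))"
      unfolding E_def using s by (intro sum_mono edge_particle_tail ed) auto
    also have "\<dots> = ?B n" by simp
    finally show ?thesis .
  qed
  have ev: "\<forall>\<^sub>F n in sequentially. n \<ge> 1 \<and> n \<ge> n0 \<and> 1 / real n \<le> \<epsilon> \<and> 2 / sqrt (3 * real n) \<le> \<delta> \<and> 3 < real n * r"
  proof (intro eventually_conj eventually_ge_at_top)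
    have "(\<lambda>n. 1 / real n) \<longlonglongrightarrow> 0" by real_asymp
    then show "\<forall>\<^sub>F n in sequentially. 1 / real n \<le> \<epsilon>" using ed(1) by (intro eventually_mono[OF order_tendstoD(2)[of _ 0]]) auto
    have "(\<lambda>n. 2 / sqrt (3 * real n)) \<longlonglongrightarrow> 0" by real_asymp
    then show "\<forall>\<^sub>F n in sequentially. 2 / sqrt (3 * real n) \<le> \<delta>" using ed(2) by (intro eventually_mono[OF order_tendstoD(2)[of _ 0]]) auto
    have "filterlim (\<lambda>n. real n * r) at_top sequentially" using r by real_asymp
    then show "\<forall>\<^sub>F n in sequentially. 3 < real n * r" by (simp add: filterlim_at_top_dense)
  qed
  show "(\<lambda>n. measure_pmf.prob (random_matching n) {M. \<bar>proportion n ?\<theta> (ball c r) M - 1\<bar> > \<eta>}) \<longlonglongrightarrow> 0"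
  proof (rule Lim_null_comparison)
    show "\<forall>\<^sub>F n in sequentially. norm (measure_pmf.prob (random_matching n) {M. \<bar>proportion n ?\<theta> (ball c r) M - 1\<bar> > \<eta>}) \<le> ?B n"
      using ev by eventually_elim (use bound in auto)
    have "\<delta>\<^sup>2 > 0" using ed(2) by simp
    then show "?B \<longlonglongrightarrow> 0" using ed(2) by real_asymp
  qed
qed

section \<open>The liquid region\<close>

text \<open>The deficit lies in \<open>[0, 1]\<close>: it is at most \<open>e / 2\<close> outside a
  bad event of small probability and at most 1 on it.\<close>

lemma expectation_deficit_tendsto_0:
  assumes "converges_in_probability random_matching (\<lambda>n. proportion n \<theta> D) 1"
  shows "(\<lambda>n. measure_pmf.expectation (random_matching n) (\<lambda>M. 1 - proportion n \<theta> D M)) \<longlonglongrightarrow> 0"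
proof (rule LIMSEQ_I)
  fix e :: real assume e: "e > 0"
  let ?B = "\<lambda>n. {M. \<bar>proportion n \<theta> D M - 1\<bar> > e / 2}"
  have "(\<lambda>n. measure_pmf.prob (random_matching n) (?B n)) \<longlonglongrightarrow> 0"
    by (rule assms[unfolded converges_in_probability_def, rule_format]) (use e in simp)
  then have "\<forall>\<^sub>F n in sequentially. measure_pmf.prob (random_matching n) (?B n) < e / 2"
    using e by (intro order_tendstoD(2)) auto
  then obtain n0 where n0: "\<And>n. n \<ge> n0 \<Longrightarrow> measure_pmf.prob (random_matching n) (?B n) < e / 2"
    unfolding eventually_sequentially by blast
  show "\<exists>no. \<forall>n\<ge>no. norm (measure_pmf.expectation (random_matching n) (\<lambda>M. 1 - proportion n \<theta> D M) - 0) < e"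
  proof (intro exI[of _ "max 1 n0"] allI impI)
    fix n assume "max 1 n0 \<le> n"
    then have n: "n \<ge> 1" "n \<ge> n0" by auto
    note int = integrable_random_matching[OF n(1)]
    have b: "0 \<le> 1 - proportion n \<theta> D M" "1 - proportion n \<theta> D M \<le> 1" if "M \<in> matchings n" for M
      using proportion_bounds(1,2)[OF n(1) that] by auto
    have "measure_pmf.expectation (random_matching n) (\<lambda>M. 1 - proportion n \<theta> D M) \<le>
      measure_pmf.expectation (random_matching n) (\<lambda>M. e / 2 + indicator (?B n) M)"
    proof (intro integral_mono_AE int AE_pmfI)
      fix M assume "M \<in> set_pmf (random_matching n)"
      then have "M \<in> matchings n" using set_pmf_random_matching[OF n(1)] by simp
      then show "1 - proportion n \<theta> D M \<le> e / 2 + indicator (?B n) M"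
        using b[of M] e by (cases "M \<in> ?B n") (auto simp: abs_if split: if_splits)
    qed
    also have "\<dots> = e / 2 + measure_pmf.prob (random_matching n) (?B n)"
      by (simp add: int)
    also have "\<dots> < e" using n0[OF n(2)] by simp
    finally have "measure_pmf.expectation (random_matching n) (\<lambda>M. 1 - proportion n \<theta> D M) < e" .
    moreover have "0 \<le> measure_pmf.expectation (random_matching n) (\<lambda>M. 1 - proportion n \<theta> D M)"
      by (intro integral_nonneg_AE AE_pmfI) (use b set_pmf_random_matching[OF n(1)] in auto)
    ultimately show "norm (measure_pmf.expectation (random_matching n) (\<lambda>M. 1 - proportion n \<theta> D M) - 0) < e" by simp
  qed
qed

lemma card_nat_between:
  assumes "0 \<le> a"
  shows "finite {x::nat. a \<le> real x \<and> real x \<le> b}" "b - a - 1 \<le> real (card {x::nat. a \<le> real x \<and> real x \<le> b})"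
proof -
  have fin: "finite {x::nat. a \<le> real x \<and> real x \<le> b}"
    by (rule finite_subset[of _ "{..nat \<lfloor>b\<rfloor>}"]) (auto simp: le_nat_iff le_floor_iff)
  then show "finite {x::nat. a \<le> real x \<and> real x \<le> b}" .
  show "b - a - 1 \<le> real (card {x::nat. a \<le> real x \<and> real x \<le> b})"
  proof (cases "b - a \<le> 1")
    case True
    then show ?thesis by (smt (verit) of_nat_0_le_iff)
  next
    case False
    have "{nat \<lceil>a\<rceil>..nat \<lfloor>b\<rfloor>} \<subseteq> {x::nat. a \<le> real x \<and> real x \<le> b}"
    proof
      fix x assume "x \<in> {nat \<lceil>a\<rceil>..nat \<lfloor>b\<rfloor>}"
      then have x: "nat \<lceil>a\<rceil> \<le> x" "x \<le> nat \<lfloor>b\<rfloor>" by auto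
      have "0 \<le> b" using assms False by linarith
      then have "0 \<le> \<lfloor>b\<rfloor>" by simp
      then have "\<lceil>a\<rceil> \<le> int x" "int x \<le> \<lfloor>b\<rfloor>" using x by linarith+
      then show "x \<in> {x::nat. a \<le> real x \<and> real x \<le> b}" by (simp add: ceiling_le_iff le_floor_iff)
    qed
    then have "card {nat \<lceil>a\<rceil>..nat \<lfloor>b\<rfloor>} \<le> card {x::nat. a \<le> real x \<and> real x \<le> b}" by (rule card_mono[OF fin])
    moreover have "b - a - 1 \<le> real (card {nat \<lceil>a\<rceil>..nat \<lfloor>b\<rfloor>})"
      using assms False by (simp add: of_nat_diff) linarith
    ultimately show ?thesis by linarith
  qed
qed

text \<open>The slope makes the plateau \<open>\<bar>u - y\<bar> \<le> 3 h / 4\<close> wide relative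
  to the support: full occupation gives about \<open>3 h / 4\<close> or more, the limiting density
  at most \<open>h / 2\<close>. This gap settles the case of vertical edges.\<close>

definition bump :: "real \<Rightarrow> real \<Rightarrow> real \<Rightarrow> real" where
  "bump y h u = max 0 (min 1 (4 * (h - \<bar>u - y\<bar>) / h))"

lemma bump_props:
  assumes "h > 0"
  shows "continuous_on UNIV (bump y h)" "0 \<le> bump y h u" "bump y h u \<le> 1"
    and "\<bar>u - y\<bar> \<ge> h \<Longrightarrow> bump y h u = 0" "\<bar>u - y\<bar> \<le> 3 * h / 4 \<Longrightarrow> bump y h u = 1"
proof -
  show "continuous_on UNIV (bump y h)" unfolding bump_def
    by (intro continuous_intros) (use assms in auto)
  show "0 \<le> bump y h u" "bump y h u \<le> 1" by (auto simp: bump_def)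
  show "bump y h u = 0" if "\<bar>u - y\<bar> \<ge> h"
  proof -
    have "4 * (h - \<bar>u - y\<bar>) / h \<le> 0" using that assms by (simp add: divide_le_0_iff)
    then show ?thesis by (simp add: bump_def)
  qed
  show "bump y h u = 1" if "\<bar>u - y\<bar> \<le> 3 * h / 4"
  proof -
    have "1 \<le> 4 * (h - \<bar>u - y\<bar>) / h" using that assms by (simp add: le_divide_eq)
    then show ?thesis by (simp add: bump_def)
  qed
qed

text \<open>Sites of row \<open>k\<close> whose edge is certain to have a direction other than
  \<open>\<theta>\<close>. For non-vertical \<open>\<theta>\<close> only vertical edges are counted,
  so that particle positions decide in every case.\<close>

definition off_sites :: "plane set \<Rightarrow> nat \<Rightarrow> nat \<Rightarrow> plane set set \<Rightarrow> nat set" where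
  "off_sites \<theta> n k M = (if \<theta> = vert_direction then {..<n + k} - matching_levels n M k else matching_levels n M k)"

lemma off_site_edge:
  assumes n: "n \<ge> 1" and M: "M \<in> matchings n" and k: "1 \<le> k" "k \<le> n" and x: "x \<in> off_sites \<theta> n k M"
    and \<theta>: "\<theta> \<in> edge_directions"
  shows "\<exists>e\<in>M. edge_at n (matching_levels n M) k x e \<and> edge_direction e \<noteq> \<theta>"
proof (cases "\<theta> = vert_direction")
  case True
  then have x': "x < n + k" "x \<notin> matching_levels n M k" using x by (auto simp: off_sites_def)
  then have "up_index n k x" using k by (auto simp: up_index_def)
  then obtain e where e: "e \<in> M" "edge_at n (matching_levels n M) k x e" using matching_edge_at(2)[OF n M] by blast
  have "\<not> vert_formula n (matching_levels n M) k x" using x' by (simp add: vert_formula_def)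
  then have "edge_direction e = right_direction \<or> edge_direction e = left_direction"
    using e(2) edge_direction_cases unfolding edge_at_def by blast
  then show ?thesis using e True vert_direction_neq by auto
next
  case False
  then have "vert_formula n (matching_levels n M) k x" using x k by (simp add: off_sites_def vert_formula_def)
  then have at: "edge_at n (matching_levels n M) k x (vert_edge n k x)" by (simp add: edge_at_def)
  then show ?thesis using matching_edge_at(3)[OF n M at] edge_direction_cases(3) False by auto
qed

text \<open>Each off-site in the support of the bump owns an edge of another direction, distinct
  sites own distinct edges, and these lie in the disc: an offset \<open>h\<close> in the scale of
  the bump is \<open>h / 2\<close> in the plane, \<open>\<eta>\<close> controls the vertical offset,
  and \<open>4 < n r\<close> absorbs rounding and the distance from triangle to midpoint.\<close>

lemma off_sites_bound:
  assumes n: "n \<ge> 1" and M: "M \<in> matchings n" and \<theta>: "\<theta> \<in> edge_directions" and h: "h > 0"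
    and small: "h / 2 + \<eta> \<le> r / 2" "4 < real n * r"
    and K: "\<And>k. k \<in> K \<Longrightarrow> 1 \<le> k \<and> k \<le> n \<and> \<bar>real k / real n - plane_level c\<bar> \<le> \<eta>"
  shows "(\<Sum>k\<in>K. \<Sum>x\<in>off_sites \<theta> n k M. bump (-2 * fst c) h ((real (n + k - 1) - 2 * real x) / real n)) \<le>
    real (card {e \<in> edges_in M ((\<lambda>x. real n *\<^sub>R x) ` ball c r). edge_direction e \<noteq> \<theta>})"
proof -
  let ?f = "\<lambda>k x. bump (-2 * fst c) h ((real (n + k - 1) - 2 * real x) / real n)"
  let ?N = "{e \<in> edges_in M ((\<lambda>x. real n *\<^sub>R x) ` ball c r). edge_direction e \<noteq> \<theta>}"
  define S where "S k = {x \<in> off_sites \<theta> n k M. ?f k x \<noteq> 0}" for k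
  have finK: "finite K" by (rule finite_subset[of _ "{..n}"]) (use K in auto)
  have fin_off: "finite (off_sites \<theta> n k M)" if "k \<in> K" for k
    using matching_levels_facts(1)[OF M, of k] K[OF that] by (auto simp: off_sites_def)
  have finS: "finite (S k)" if "k \<in> K" for k using fin_off[OF that] by (simp add: S_def)
  have "(\<Sum>k\<in>K. \<Sum>x\<in>off_sites \<theta> n k M. ?f k x) = (\<Sum>k\<in>K. \<Sum>x\<in>S k. ?f k x)"
    by (intro sum.cong refl sum.mono_neutral_right fin_off) (auto simp: S_def)
  also have "\<dots> \<le> (\<Sum>k\<in>K. \<Sum>x\<in>S k. 1)" by (intro sum_mono bump_props(3)[OF h])
  also have "\<dots> = real (card (Sigma K S))" using finK finS by (simp add: card_SigmaI)
  also have "card (Sigma K S) \<le> card ?N"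
  proof -
    have "\<forall>q\<in>Sigma K S. \<exists>e. e \<in> M \<and> edge_at n (matching_levels n M) (fst q) (snd q) e \<and> edge_direction e \<noteq> \<theta>"
    proof
      fix q assume "q \<in> Sigma K S"
      then have "fst q \<in> K" "snd q \<in> off_sites \<theta> n (fst q) M" by (auto simp: S_def)
      then show "\<exists>e. e \<in> M \<and> edge_at n (matching_levels n M) (fst q) (snd q) e \<and> edge_direction e \<noteq> \<theta>"
        using off_site_edge[OF n M _ _ _ \<theta>] K by blast
    qed
    then obtain g where g: "\<And>q. q \<in> Sigma K S \<Longrightarrow> g q \<in> M \<and> edge_at n (matching_levels n M) (fst q) (snd q) (g q) \<and> edge_direction (g q) \<noteq> \<theta>"
      by (metis bchoice)
    have "inj_on g (Sigma K S)"
    proof (rule inj_onI)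
      fix p q assume pq: "p \<in> Sigma K S" "q \<in> Sigma K S" "g p = g q"
      then have "edge_at n (matching_levels n M) (fst p) (snd p) (g q)" "edge_at n (matching_levels n M) (fst q) (snd q) (g q)"
        using g[OF pq(1)] g[OF pq(2)] by auto
      then show "p = q" using edge_at_unique_vertex by (metis prod.expand)
    qed
    moreover have "g ` Sigma K S \<subseteq> ?N"
    proof
      fix e assume "e \<in> g ` Sigma K S"
      then obtain k x where kx: "k \<in> K" "x \<in> S k" "e = g (k, x)" by auto
      then have e: "e \<in> M" "edge_at n (matching_levels n M) k x e" "edge_direction e \<noteq> \<theta>" using g[of "(k, x)"] by auto
      have f0: "\<bar>(real (n + k - 1) - 2 * real x) / real n - (-2 * fst c)\<bar> < h"
      proof (rule ccontr)
        assume "\<not> ?thesis"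
        then have "?f k x = 0" by (intro bump_props(4)[OF h]) simp
        then show False using kx(2) by (simp add: S_def)
      qed
      have rn: "real n > 0" using n by simp
      have 1: "\<bar>fst (up_vertex n k x) - fst (real n *\<^sub>R c)\<bar> \<le> real n * (h / 2)"
      proof -
        have "fst (up_vertex n k x) - fst (real n *\<^sub>R c) = - (real n / 2) * ((real (n + k - 1) - 2 * real x) / real n - (-2 * fst c))"
          using up_vertex_coords[OF n, of k x] rn by (simp add: field_simps)
        then have "\<bar>fst (up_vertex n k x) - fst (real n *\<^sub>R c)\<bar> = real n / 2 * \<bar>(real (n + k - 1) - 2 * real x) / real n - (-2 * fst c)\<bar>"
          by (simp only: abs_mult) simp
        also have "\<dots> \<le> real n / 2 * h" using f0 by (intro mult_left_mono) auto
        finally show ?thesis by simp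
      qed
      have 2: "\<bar>snd (up_vertex n k x) - snd (real n *\<^sub>R c)\<bar> \<le> real n * \<eta> + 1"
      proof -
        have c2: "snd c = (1 - plane_level c) * sqrt 3 / 2" by (simp add: plane_level_def)
        have "snd (up_vertex n k x) - snd (real n *\<^sub>R c) = (1 / 3 - real n * (real k / real n - plane_level c)) * (sqrt 3 / 2)"
          unfolding c2 snd_scaleR using up_vertex_coords[OF n, of k x] rn by (simp add: field_simps)
        then have "\<bar>snd (up_vertex n k x) - snd (real n *\<^sub>R c)\<bar> = \<bar>1 / 3 - real n * (real k / real n - plane_level c)\<bar> * (sqrt 3 / 2)"
          by (simp only: abs_mult) simp
        also have "\<dots> \<le> (1 / 3 + real n * \<eta>) * 1"
        proof (intro mult_mono)
          have "\<bar>real n * (real k / real n - plane_level c)\<bar> \<le> real n * \<eta>"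
            unfolding abs_mult using K[OF kx(1)] by (simp add: mult_left_mono)
          then show "\<bar>1 / 3 - real n * (real k / real n - plane_level c)\<bar> \<le> 1 / 3 + real n * \<eta>" by linarith
          then show "0 \<le> 1 / 3 + real n * \<eta>" by linarith
          show "sqrt 3 / 2 \<le> 1" using real_sqrt_le_mono[of 3 4] by simp
        qed simp
        finally show ?thesis by simp
      qed
      have "dist (edge_midpoint e) (real n *\<^sub>R c) \<le> real n * (h / 2) + (real n * \<eta> + 1) + 1"
        using dist_triangle[of "edge_midpoint e" "real n *\<^sub>R c" "up_vertex n k x"] edge_at_midpoint[OF e(2)]
          plane_dist_le[of "up_vertex n k x" "real n *\<^sub>R c"] 1 2 by linarith
      also have "\<dots> = real n * (h / 2 + \<eta>) + 2" by (simp add: algebra_simps)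
      also have "\<dots> \<le> real n * (r / 2) + 2" using small(1) by (intro add_right_mono mult_left_mono) auto
      also have "\<dots> < real n * r" using small(2) by simp
      finally show "e \<in> ?N" using e(1,3) unfolding edges_in_def mem_Collect_eq mem_scaled_ball[OF n] by simp
    qed
    moreover have "finite ?N" using card_matching_le(1)[OF n M] by (simp add: edges_in_def)
    ultimately show ?thesis by (rule card_inj_on_le)
  qed
  finally show ?thesis by simp
qed

text \<open>On the plateau every site counts fully. It has length \<open>3 h / 2\<close> and the
  sites are \<open>2 / n\<close> apart, hence at least \<open>3 h n / 4 - 1\<close> of them;
  \<open>slack\<close> keeps the plateau away from the ends of the row.\<close>

lemma site_sum_lower_bound:
  assumes n: "n \<ge> 1" and h: "h > 0" and k: "1 \<le> k" "real n * \<beta> \<le> real n + real k"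
    and slack: "\<bar>y\<bar> + 2 * h \<le> \<beta>" and big: "1 \<le> real n * h"
  shows "3 * h / 4 - 1 / real n \<le> (\<Sum>x<n + k. bump y h ((real (n + k - 1) - 2 * real x) / real n)) / real n"
proof -
  let ?N = "real (n + k - 1)"
  define a where "a = (?N - real n * y - 3 * h * real n / 4) / 2"
  define b where "b = (?N - real n * y + 3 * h * real n / 4) / 2"
  have rn: "real n > 0" using n by simp
  have N: "?N = real n + real k - 1" using n by (simp add: of_nat_diff)
  have sl: "real n * \<bar>y\<bar> + 2 * (real n * h) \<le> real n + real k"
    using mult_left_mono[OF slack, of "real n"] rn k(2) by (simp add: algebra_simps)
  have ny: "\<bar>real n * y\<bar> = real n * \<bar>y\<bar>" by (simp add: abs_mult)
  have hn: "3 * h * real n / 4 = 3 / 4 * (real n * h)" by simp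
  have ny': "real n * y \<le> real n * \<bar>y\<bar>" "- (real n * \<bar>y\<bar>) \<le> real n * y" using ny by linarith+
  have lin: "0 \<le> (p - 1 - B - 3 / 4 * H) / 2 \<and> (p - 1 - B + 3 / 4 * H) / 2 < p"
    if "A + 2 * H \<le> p" "B \<le> A" "- A \<le> B" "1 \<le> H" for A B H p :: real
    using that by argo
  have a: "0 \<le> a" unfolding a_def N hn using lin[OF sl ny' big] by blast
  have b: "b < real n + real k" unfolding b_def N hn using lin[OF sl ny' big] by blast
  let ?J = "{x::nat. a \<le> real x \<and> real x \<le> b}"
  have sub: "?J \<subseteq> {..<n + k}" using b by auto
  have one: "bump y h ((?N - 2 * real x) / real n) = 1" if "x \<in> ?J" for x
  proof (rule bump_props(5)[OF h])
    have "- (3 * h * real n / 4) \<le> ?N - 2 * real x - real n * y" "?N - 2 * real x - real n * y \<le> 3 * h * real n / 4"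
      using that by (auto simp: a_def b_def)
    moreover have "3 * h * real n / 4 = 3 * h / 4 * real n" by simp
    ultimately have "\<bar>?N - 2 * real x - real n * y\<bar> \<le> 3 * h / 4 * real n"
      by (simp only: abs_le_iff minus_le_iff)
    moreover have "(?N - 2 * real x) / real n - y = (?N - 2 * real x - real n * y) / real n" using rn by (simp add: field_simps)
    ultimately show "\<bar>(?N - 2 * real x) / real n - y\<bar> \<le> 3 * h / 4"
      using rn by (simp only: abs_divide pos_divide_le_eq abs_of_pos)
  qed
  have "3 * h * real n / 4 - 1 = b - a - 1" by (simp add: a_def b_def field_simps)
  also have "\<dots> \<le> real (card ?J)" by (rule card_nat_between(2)[OF a])
  also have "\<dots> = (\<Sum>x\<in>?J. bump y h ((?N - 2 * real x) / real n))" using one by simp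
  also have "\<dots> \<le> (\<Sum>x<n + k. bump y h ((?N - 2 * real x) / real n))"
    by (rule sum_mono2) (use sub bump_props(2)[OF h] in auto)
  finally have "3 * h * real n / 4 - 1 \<le> (\<Sum>x<n + k. bump y h ((?N - 2 * real x) / real n))" .
  then have "(3 * h * real n / 4 - 1) / real n \<le> (\<Sum>x<n + k. bump y h ((?N - 2 * real x) / real n)) / real n"
    using rn by (intro divide_right_mono) auto
  then show ?thesis using rn by (simp add: field_simps)
qed

theorem liquid_inside:
  fixes c :: plane
  assumes r: "r > 0" and \<theta>: "\<theta> \<in> edge_directions"
    and lev: "(fst c)\<^sup>2 < plane_level c" "plane_level c < 1"
  shows "\<not> converges_in_probability random_matching (\<lambda>n. proportion n \<theta> (ball c r)) 1"
proof
  assume conv: "converges_in_probability random_matching (\<lambda>n. proportion n \<theta> (ball c r)) 1"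
  define \<kappa> where "\<kappa> = plane_level c"
  define y where "y = -2 * fst c"
  define Z where "Z n = measure_pmf.expectation (random_matching n) (\<lambda>M. 1 - proportion n \<theta> (ball c r) M)" for n
  have Z0: "Z \<longlonglongrightarrow> 0" unfolding Z_def by (rule expectation_deficit_tendsto_0[OF conv])
  have \<kappa>: "(fst c)\<^sup>2 < \<kappa>" "\<kappa> < 1" using lev by (auto simp: \<kappa>_def)
  \<comment> \<open>The rows within \<open>\<eta>\<close> of \<open>\<kappa>\<close> cross the disc,
    still have the abscissa of \<open>c\<close> strictly inside the parabola, and stay below level
    1.\<close>
  define \<eta> where "\<eta> = min (r / 8) (min ((\<kappa> - (fst c)\<^sup>2) / 2) ((1 - \<kappa>) / 2))"
  have \<eta>: "\<eta> > 0" "\<eta> \<le> r / 8" "(fst c)\<^sup>2 < \<kappa> - \<eta>" "\<kappa> + \<eta> < 1"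
    using r \<kappa> by (auto simp: \<eta>_def min_def field_simps)
  have \<kappa>0: "0 < \<kappa> - \<eta>" using \<eta>(3) zero_le_power2[of "fst c"] by linarith
  have y: "\<bar>y\<bar> < 2 * sqrt t" if "\<kappa> - \<eta> \<le> t" for t
  proof -
    have "sqrt ((fst c)\<^sup>2) < sqrt t" using \<eta>(3) that by (intro real_sqrt_less_mono) linarith
    then show ?thesis by (simp add: y_def abs_mult)
  qed
  \<comment> \<open>By \<open>2 sqrt t \<le> 1 + t\<close>, an abscissa inside the parabola at level
    \<open>t\<close> is also strictly inside the row, whose half-width is
    \<open>(1 + t) / 2\<close>.\<close>
  have y2: "\<bar>y\<bar> < 1 + \<kappa> - \<eta>"
  proof -
    have "0 \<le> (sqrt (\<kappa> - \<eta>) - 1)\<^sup>2" by simp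
    then have "2 * sqrt (\<kappa> - \<eta>) \<le> 1 + (\<kappa> - \<eta>)" using \<kappa>0 by (simp add: power2_diff)
    then show ?thesis using y[of "\<kappa> - \<eta>"] by simp
  qed
  define h where "h = min (r / 2) ((1 + \<kappa> - \<eta> - \<bar>y\<bar>) / 2)"
  have h: "h > 0" "h \<le> r / 2" "\<bar>y\<bar> + 2 * h \<le> 1 + \<kappa> - \<eta>" using r y2 by (auto simp: h_def min_def field_simps)
  let ?f = "bump y h"
  define m where "m n k = measure_pmf.expectation (random_matching n)
     (\<lambda>M. \<Sum>x\<in>off_sites \<theta> n k M. ?f ((real (n + k - 1) - 2 * real x) / real n)) / real n" for n k
  \<comment> \<open>By averaging over the rows that cross the disc, some row has few edges of other directions.\<close>
  have ex: "\<exists>k. 1 \<le> k \<and> k \<le> n \<and> \<bar>real k / real n - \<kappa>\<bar> \<le> \<eta> \<and> m n k \<le> 36 / \<eta> * Z n"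
    if n: "n \<ge> 1" and big: "4 < real n * r" "2 \<le> real n * \<eta>" for n
  proof (rule ccontr)
    assume neg: "\<not> ?thesis"
    define K where "K = {k. 1 \<le> k \<and> k \<le> n \<and> \<bar>real k / real n - \<kappa>\<bar> \<le> \<eta>}"
    have rn: "real n > 0" using n by simp
    have finK: "finite K" by (rule finite_subset[of _ "{..n}"]) (auto simp: K_def)
    have cardK: "real n * \<eta> / 2 \<le> real (card K)"
    proof -
      have "{k::nat. real n * \<kappa> \<le> real k \<and> real k \<le> real n * (\<kappa> + \<eta>)} \<subseteq> K"
      proof
        fix k assume "k \<in> {k::nat. real n * \<kappa> \<le> real k \<and> real k \<le> real n * (\<kappa> + \<eta>)}"
        then have k: "real n * \<kappa> \<le> real k" "real k \<le> real n * (\<kappa> + \<eta>)" by auto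
        have "0 < real n * \<kappa>" using rn \<kappa>0 \<eta>(1) by simp
        then have "1 \<le> k" using k(1) by linarith
        moreover have "real n * (\<kappa> + \<eta>) \<le> real n * 1" using \<eta>(4) by (intro mult_left_mono) auto
        then have "k \<le> n" using k(2) by linarith
        moreover have "\<kappa> \<le> real k / real n" "real k / real n \<le> \<kappa> + \<eta>"
          using k rn by (auto simp: field_simps)
        then have "\<bar>real k / real n - \<kappa>\<bar> \<le> \<eta>" using \<eta>(1) by linarith
        ultimately show "k \<in> K" by (simp add: K_def)
      qed
      then have "card {k::nat. real n * \<kappa> \<le> real k \<and> real k \<le> real n * (\<kappa> + \<eta>)} \<le> card K" by (rule card_mono[OF finK])
      moreover have "real n * (\<kappa> + \<eta>) - real n * \<kappa> - 1 \<le> real (card {k::nat. real n * \<kappa> \<le> real k \<and> real k \<le> real n * (\<kappa> + \<eta>)})"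
        by (rule card_nat_between(2)) (use \<kappa>0 \<eta>(1) in simp)
      ultimately show ?thesis using big(2) by (simp add: algebra_simps)
    qed
    then have "real (card K) > 0" using big(2) by linarith
    then have Kne: "K \<noteq> {}" by auto
    note int = integrable_random_matching[OF n]
    have Zn: "0 \<le> Z n" unfolding Z_def
      by (intro integral_nonneg_AE AE_pmfI) (use proportion_bounds(2)[OF n] set_pmf_random_matching[OF n] in auto)
    have "(\<Sum>k\<in>K. real n * m n k) = measure_pmf.expectation (random_matching n)
       (\<lambda>M. \<Sum>k\<in>K. \<Sum>x\<in>off_sites \<theta> n k M. ?f ((real (n + k - 1) - 2 * real x) / real n))"
      using rn by (subst Bochner_Integration.integral_sum) (auto simp: m_def int)
    also have "\<dots> \<le> measure_pmf.expectation (random_matching n) (\<lambda>M. 18 * (real n)\<^sup>2 * (1 - proportion n \<theta> (ball c r) M))"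
    proof (intro integral_mono_AE int AE_pmfI)
      fix M assume "M \<in> set_pmf (random_matching n)"
      then have M: "M \<in> matchings n" using set_pmf_random_matching[OF n] by simp
      have "(\<Sum>k\<in>K. \<Sum>x\<in>off_sites \<theta> n k M. ?f ((real (n + k - 1) - 2 * real x) / real n)) \<le>
        real (card {e \<in> edges_in M ((\<lambda>x. real n *\<^sub>R x) ` ball c r). edge_direction e \<noteq> \<theta>})"
        unfolding y_def
        by (rule off_sites_bound[OF n M \<theta> h(1), of \<eta>]) (use h \<eta> big in \<open>auto simp: K_def \<kappa>_def\<close>)
      also have "\<dots> \<le> 18 * (real n)\<^sup>2 * (1 - proportion n \<theta> (ball c r) M)"
        using proportion_bounds(3)[OF n M, of "ball c r" \<theta>] rn by (simp add: pos_divide_le_eq mult.commute)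
      finally show "(\<Sum>k\<in>K. \<Sum>x\<in>off_sites \<theta> n k M. ?f ((real (n + k - 1) - 2 * real x) / real n)) \<le>
        18 * (real n)\<^sup>2 * (1 - proportion n \<theta> (ball c r) M)" .
    qed
    also have "\<dots> = 18 * (real n)\<^sup>2 * Z n" by (simp add: Z_def)
    \<comment> \<open>At least \<open>n \<eta> / 2\<close> rows share the bound
      \<open>18 n^2 Z n\<close>; this is the origin of \<open>36 / \<eta>\<close>.\<close>
    also have "\<dots> = real n * \<eta> / 2 * (real n * (36 / \<eta> * Z n))" using \<eta>(1) by (simp add: power2_eq_square)
    also have "\<dots> \<le> real (card K) * (real n * (36 / \<eta> * Z n))" using cardK Zn \<eta>(1) by (intro mult_right_mono) auto
    also have "\<dots> = (\<Sum>k\<in>K. real n * (36 / \<eta> * Z n))" by simp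
    also have "\<dots> < (\<Sum>k\<in>K. real n * m n k)"
    proof (rule sum_strict_mono[OF finK Kne])
      fix k assume "k \<in> K"
      then have "\<not> m n k \<le> 36 / \<eta> * Z n" using neg unfolding K_def by blast
      then have "36 / \<eta> * Z n < m n k" by (rule not_le_imp_less)
      then show "real n * (36 / \<eta> * Z n) < real n * m n k" using rn by (rule mult_strict_left_mono)
    qed
    finally show False by simp
  qed
  have "\<forall>\<^sub>F n in sequentially. n \<ge> 1 \<and> 4 < real n * r \<and> 2 \<le> real n * \<eta> \<and> 1 \<le> real n * h"
  proof (intro eventually_conj eventually_ge_at_top)
    have lim: "filterlim (\<lambda>n. real n * t) at_top sequentially" if "t > 0" for t using that by real_asymp
    show "\<forall>\<^sub>F n in sequentially. 4 < real n * r" using lim[OF r] by (simp add: filterlim_at_top_dense)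
    show "\<forall>\<^sub>F n in sequentially. 2 \<le> real n * \<eta>" using lim[OF \<eta>(1)] by (simp add: filterlim_at_top)
    show "\<forall>\<^sub>F n in sequentially. 1 \<le> real n * h" using lim[OF h(1)] by (simp add: filterlim_at_top)
  qed
  then obtain n1 where n1: "\<And>n. n \<ge> n1 \<Longrightarrow> n \<ge> 1 \<and> 4 < real n * r \<and> 2 \<le> real n * \<eta> \<and> 1 \<le> real n * h"
    unfolding eventually_sequentially by blast
  define N where "N i = n1 + i" for i
  have "\<forall>i. \<exists>k. 1 \<le> k \<and> k \<le> N i \<and> \<bar>real k / real (N i) - \<kappa>\<bar> \<le> \<eta> \<and> m (N i) k \<le> 36 / \<eta> * Z (N i)"
  proof
    fix i
    have "n1 \<le> N i" by (simp add: N_def)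
    then show "\<exists>k. 1 \<le> k \<and> k \<le> N i \<and> \<bar>real k / real (N i) - \<kappa>\<bar> \<le> \<eta> \<and> m (N i) k \<le> 36 / \<eta> * Z (N i)"
      using ex[of "N i"] n1[of "N i"] by blast
  qed
  from choice[OF this] obtain k where kk: "\<forall>i. 1 \<le> k i \<and> k i \<le> N i \<and> \<bar>real (k i) / real (N i) - \<kappa>\<bar> \<le> \<eta> \<and>
      m (N i) (k i) \<le> 36 / \<eta> * Z (N i)" by (elim exE)
  then have k: "1 \<le> k i" "k i \<le> N i" "\<bar>real (k i) / real (N i) - \<kappa>\<bar> \<le> \<eta>"
      "m (N i) (k i) \<le> 36 / \<eta> * Z (N i)" for i by simp_all
  have mem: "real (k i) / real (N i) \<in> {\<kappa> - \<eta>..\<kappa> + \<eta>}" for i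
    using k(3)[of i] unfolding abs_le_iff by simp
  \<comment> \<open>The heights of the selected rows are controlled only up to this interval, so a
    subsequence with convergent \<open>k / n\<close> is taken.\<close>
  have sc: "seq_compact {\<kappa> - \<eta>..\<kappa> + \<eta>}" by (intro compact_imp_seq_compact compact_Icc)
  obtain t \<rho> where t: "t \<in> {\<kappa> - \<eta>..\<kappa> + \<eta>}" "strict_mono \<rho>" "((\<lambda>i. real (k i) / real (N i)) \<circ> \<rho>) \<longlonglongrightarrow> t"
    by (rule seq_compactE[OF sc, of "\<lambda>i. real (k i) / real (N i)"]) (use mem in blast)+
  have t01: "0 < t" "t < 1" using t(1) \<kappa>0 \<eta>(4) by auto
  have "filterlim N at_top sequentially" unfolding N_def by (rule filterlim_at_top_mono[OF filterlim_ident]) (simp add: eventually_sequentially)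
  then have Ntop: "filterlim (\<lambda>i. N (\<rho> i)) at_top sequentially"
    by (rule filterlim_compose) (rule filterlim_subseq[OF t(2)])
  have fc: "continuous_on UNIV ?f" by (rule bump_props(1)[OF h(1)])
  have lim: "(\<lambda>i. scaled_level_mean (N (\<rho> i)) (k (\<rho> i)) ?f) \<longlonglongrightarrow> limit_functional t ?f"
    by (rule scaled_level_mean_limit[OF t01 Ntop k(1) k(2) _ fc]) (use t(3) in \<open>simp add: o_def\<close>)
  have ZN: "(\<lambda>i. 36 / \<eta> * Z (N (\<rho> i))) \<longlonglongrightarrow> 36 / \<eta> * 0"
    by (intro tendsto_mult tendsto_const filterlim_compose[OF Z0 Ntop])
  show False
  proof (cases "\<theta> = vert_direction")
    case False
    \<comment> \<open>Too few vertical edges would make the limiting density vanish near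
      \<open>y\<close>, against its positivity.\<close>
    then have "scaled_level_mean (N (\<rho> i)) (k (\<rho> i)) ?f \<le> 36 / \<eta> * Z (N (\<rho> i))" for i
      using k(4)[of "\<rho> i"] by (simp add: m_def off_sites_def scaled_level_mean_def)
    then have "limit_functional t ?f \<le> 36 / \<eta> * 0" by (intro LIMSEQ_le[OF lim ZN]) auto
    moreover have "limit_functional t ?f > 0"
      by (rule limit_functional_pos[OF t01 fc, of y]) (use bump_props[OF h(1)] h(1) y[of t] t(1) in auto)
    ultimately show False by simp
  next
    case True
    \<comment> \<open>Too few non-vertical edges would fill nearly all sites of the plateau, a mass
      of \<open>3 h / 4\<close>, which exceeds the bound \<open>h / 2\<close> on the limit.\<close>
    have low: "3 * h / 4 - 1 / real (N (\<rho> i)) - 36 / \<eta> * Z (N (\<rho> i)) \<le> scaled_level_mean (N (\<rho> i)) (k (\<rho> i)) ?f" for i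
    proof -
      let ?n = "N (\<rho> i)" and ?k = "k (\<rho> i)"
      have n: "?n \<ge> 1" "1 \<le> real ?n * h" using n1[of ?n] by (auto simp: N_def)
      let ?g = "\<lambda>x. ?f ((real (?n + ?k - 1) - 2 * real x) / real ?n)"
      have "real ?n * (\<kappa> - \<eta>) \<le> real ?k"
      proof -
        have "\<kappa> - \<eta> \<le> real ?k / real ?n" using k(3)[of "\<rho> i"] by linarith
        then show ?thesis using n(1) by (simp add: field_simps)
      qed
      then have "real ?n * (1 + \<kappa> - \<eta>) \<le> real ?n + real ?k" by (simp add: algebra_simps)
      then have s: "3 * h / 4 - 1 / real ?n \<le> (\<Sum>x<?n + ?k. ?g x) / real ?n"
        by (rule site_sum_lower_bound[OF n(1) h(1) k(1) _ h(3) n(2)])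
      have "m ?n ?k = measure_pmf.expectation (random_matching ?n) (\<lambda>M. (\<Sum>x<?n + ?k. ?g x) - (\<Sum>x\<in>matching_levels ?n M ?k. ?g x)) / real ?n"
      proof -
        have "(\<Sum>x\<in>off_sites \<theta> ?n ?k M. ?g x) = (\<Sum>x<?n + ?k. ?g x) - (\<Sum>x\<in>matching_levels ?n M ?k. ?g x)"
          if M: "M \<in> matchings ?n" for M
        proof -
          note facts = matching_levels_facts[OF M k(1) k(2)]
          have "matching_levels ?n M ?k \<subseteq> {..<?n + ?k}" using facts(3) n(1) by fastforce
          then show ?thesis unfolding off_sites_def if_P[OF True] by (intro sum_diff) auto
        qed
        then show ?thesis unfolding m_def expectation_random_matching[OF n(1)] by simp
      qed
      also have "\<dots> = (\<Sum>x<?n + ?k. ?g x) / real ?n - scaled_level_mean ?n ?k ?f"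
        unfolding scaled_level_mean_def by (simp add: integrable_random_matching[OF n(1)] diff_divide_distrib)
      finally show ?thesis using s k(4)[of "\<rho> i"] by linarith
    qed
    have "(\<lambda>i. 1 / real (N (\<rho> i))) \<longlonglongrightarrow> 0"
      using Ntop by (intro tendsto_divide_0[OF tendsto_const])
        (auto intro: filterlim_at_top_imp_at_infinity filterlim_compose[OF filterlim_real_sequentially])
    then have "(\<lambda>i. 3 * h / 4 - 1 / real (N (\<rho> i)) - 36 / \<eta> * Z (N (\<rho> i))) \<longlonglongrightarrow> 3 * h / 4 - 0 - 36 / \<eta> * 0"
      by (intro tendsto_diff tendsto_const ZN)
    then have "3 * h / 4 - 0 - 36 / \<eta> * 0 \<le> limit_functional t ?f"
      by (rule LIMSEQ_le[OF _ lim]) (use low in auto)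
    moreover have "limit_functional t ?f \<le> h / 2"
      by (rule limit_functional_bump_le[OF t01 fc, of h y]) (use bump_props[OF h(1)] h(1) in auto)
    ultimately show False using h(1) by simp
  qed
qed

section \<open>The parabola\<close>

text \<open>The locus \<open>plane_level p = (fst p)^2\<close>. It is tangent to the top side of the
  trapezoid at its midpoint and to the two legs at \<open>(1, 0)\<close> and
  \<open>(-1, 0)\<close>.\<close>

definition limit_parabola :: "plane set" where
  "limit_parabola = {p. snd p = sqrt 3 / 2 * (1 - (fst p)\<^sup>2)}"

definition parabola_interior :: "plane set" where
  "parabola_interior = {p. snd p < sqrt 3 / 2 * (1 - (fst p)\<^sup>2)}"

lemma infdist_horizontal_line:
  fixes p :: plane
  shows "infdist p {q. snd q = t} = \<bar>snd p - t\<bar>"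
proof (rule antisym)
  have "infdist p {q. snd q = t} \<le> dist p (fst p, t)" by (rule infdist_le) simp
  also have "\<dots> \<le> \<bar>snd p - t\<bar>" using plane_dist_le[of p "(fst p, t)"] by simp
  finally show "infdist p {q. snd q = t} \<le> \<bar>snd p - t\<bar>" .
  have ne: "{q :: plane. snd q = t} \<noteq> {}" by (metis (mono_tags) empty_Collect_eq snd_conv)
  show "\<bar>snd p - t\<bar> \<le> infdist p {q. snd q = t}"
    unfolding infdist_notempty[OF ne]
  proof (rule cINF_greatest[OF ne])
    fix q :: plane assume "q \<in> {q. snd q = t}"
    then show "\<bar>snd p - t\<bar> \<le> dist p q" using dist_snd_le[of p q] by (simp add: dist_real_def)
  qed
qed

lemma parabola_limit_parabola: "parabola limit_parabola"
proof -
  define s :: real where "s = sqrt 3 / 2"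
  \<comment> \<open>The parabola of height \<open>s (1 - x^2)\<close> has its vertex at height
    \<open>s\<close> and focal distance \<open>1 / (4 s)\<close>, so focus and directrix lie at
    heights \<open>s - f\<close> and \<open>s + f\<close>.\<close>
  define f where "f = 1 / (4 * s)"
  have s: "s > 0" by (simp add: s_def)
  have fs: "4 * f * s = 1" using s by (simp add: f_def)
  have f: "f > 0" using s by (simp add: f_def)
  let ?F = "(0, s - f) :: plane" and ?d = "{q :: plane. snd q = s + f}"
  have hyper: "?d = {q. (0, 1) \<bullet> q = s + f}" by (auto simp: inner_prod_def)
  have "affine ?d" unfolding hyper by (rule affine_hyperplane)
  moreover have "aff_dim ?d = 1" unfolding hyper by (subst aff_dim_hyperplane) (auto simp: zero_prod_def)
  moreover have "?F \<notin> ?d" using f by simp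
  moreover have "limit_parabola = {x. dist x ?F = infdist x ?d}"
    unfolding limit_parabola_def
  proof (rule Collect_cong)
    fix p :: plane
    have "dist p ?F = infdist p ?d \<longleftrightarrow> (dist p ?F)\<^sup>2 = (snd p - (s + f))\<^sup>2"
      unfolding infdist_horizontal_line by (metis abs_ge_zero power2_abs power2_eq_iff_nonneg zero_le_dist)
    also have "(dist p ?F)\<^sup>2 = (fst p)\<^sup>2 + (snd p - (s - f))\<^sup>2"
      by (cases p) (simp add: dist_Pair_Pair dist_real_def)
    also have "(fst p)\<^sup>2 + (snd p - (s - f))\<^sup>2 = (snd p - (s + f))\<^sup>2 \<longleftrightarrow> (fst p)\<^sup>2 + 4 * f * (snd p - s) = 0"
      by (simp add: power2_eq_square algebra_simps)
    also have "\<dots> \<longleftrightarrow> s * (fst p)\<^sup>2 + (4 * f * s) * (snd p - s) = 0"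
    proof -
      have "s * (fst p)\<^sup>2 + (4 * f * s) * (snd p - s) = s * ((fst p)\<^sup>2 + 4 * f * (snd p - s))" by (simp add: algebra_simps)
      then show ?thesis using s by simp
    qed
    also have "\<dots> \<longleftrightarrow> snd p = s * (1 - (fst p)\<^sup>2)" unfolding fs by (simp add: algebra_simps)
    finally show "snd p = sqrt 3 / 2 * (1 - (fst p)\<^sup>2) \<longleftrightarrow> dist p ?F = infdist p ?d"
      by (simp only: s_def)
  qed
  ultimately show ?thesis unfolding parabola_def by blast
qed

lemma open_parabola_interior: "open parabola_interior"
  unfolding parabola_interior_def by (intro open_Collect_less continuous_intros)

lemma convex_parabola_interior: "convex parabola_interior"
proof (rule convexI)
  fix p q :: plane and u v :: real
  assume p: "p \<in> parabola_interior" and q: "q \<in> parabola_interior" and uv: "0 \<le> u" "0 \<le> v" "u + v = 1"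
  define s :: real where "s = sqrt 3 / 2"
  have s: "s > 0" by (simp add: s_def)
  have p': "snd p < s * (1 - (fst p)\<^sup>2)" and q': "snd q < s * (1 - (fst q)\<^sup>2)"
    using p q by (auto simp: parabola_interior_def s_def)
  have sq: "(u * fst p + v * fst q)\<^sup>2 \<le> u * (fst p)\<^sup>2 + v * (fst q)\<^sup>2"
  proof -
    have v: "v = 1 - u" using uv by simp
    have "u * (fst p)\<^sup>2 + v * (fst q)\<^sup>2 - (u * fst p + v * fst q)\<^sup>2 = u * v * (fst p - fst q)\<^sup>2"
      unfolding v by (simp add: power2_eq_square algebra_simps)
    moreover have "0 \<le> u * v * (fst p - fst q)\<^sup>2" using uv by simp
    ultimately show ?thesis by linarith
  qed
  have "u * snd p + v * snd q < u * (s * (1 - (fst p)\<^sup>2)) + v * (s * (1 - (fst q)\<^sup>2))"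
  proof (cases "u = 0")
    case True then show ?thesis using uv q' by simp
  next
    case False
    then have "u * snd p < u * (s * (1 - (fst p)\<^sup>2))" using uv p' by simp
    moreover have "v * snd q \<le> v * (s * (1 - (fst q)\<^sup>2))" using uv q' by (intro mult_left_mono) auto
    ultimately show ?thesis by linarith
  qed
  also have "\<dots> = s * (u + v - (u * (fst p)\<^sup>2 + v * (fst q)\<^sup>2))" by (simp add: algebra_simps)
  also have "\<dots> \<le> s * (1 - (u * fst p + v * fst q)\<^sup>2)" using sq s uv by (intro mult_left_mono) auto
  finally show "u *\<^sub>R p + v *\<^sub>R q \<in> parabola_interior" by (simp add: parabola_interior_def s_def)
qed

lemma closure_parabola_interior: "closure parabola_interior = {p. snd p \<le> sqrt 3 / 2 * (1 - (fst p)\<^sup>2)}"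
proof (rule antisym)
  show "closure parabola_interior \<subseteq> {p. snd p \<le> sqrt 3 / 2 * (1 - (fst p)\<^sup>2)}"
  proof (rule closure_minimal)
    show "closed {p::plane. snd p \<le> sqrt 3 / 2 * (1 - (fst p)\<^sup>2)}"
      by (intro closed_Collect_le continuous_intros)
  qed (auto simp: parabola_interior_def)
  show "{p. snd p \<le> sqrt 3 / 2 * (1 - (fst p)\<^sup>2)} \<subseteq> closure parabola_interior"
  proof
    fix p :: plane assume p: "p \<in> {p. snd p \<le> sqrt 3 / 2 * (1 - (fst p)\<^sup>2)}"
    show "p \<in> closure parabola_interior"
      unfolding closure_approachable
    proof (intro allI impI)
      fix e :: real assume e: "e > 0"
      have "(fst p, snd p - e / 2) \<in> parabola_interior" using p e by (simp add: parabola_interior_def)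
      moreover have "dist (fst p, snd p - e / 2) p < e" using plane_dist_le[of "(fst p, snd p - e / 2)" p] e by simp
      ultimately show "\<exists>y\<in>parabola_interior. dist y p < e" by blast
    qed
  qed
qed

lemma frontier_parabola_interior: "frontier parabola_interior = limit_parabola"
  unfolding frontier_def interior_open[OF open_parabola_interior] closure_parabola_interior
  by (auto simp: parabola_interior_def limit_parabola_def)

text \<open>Each side gives a half-plane containing the trapezoid, which is checked at the corners,
  and the interior lies in the open half-plane.\<close>

lemma interior_limit_trapezoid:
  assumes "p \<in> interior limit_trapezoid"
  shows "0 < plane_level p" "plane_level p < 1" "\<bar>fst p\<bar> < (1 + plane_level p) / 2"
proof -
  have *: "a \<bullet> p < b" if a: "a \<noteq> 0"
    and corners: "\<And>q. q \<in> {(1, 0), (-1, 0), (1/2, sqrt 3 / 2), (-1/2, sqrt 3 / 2)} \<Longrightarrow> a \<bullet> q \<le> b" for a :: plane and b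
  proof -
    have "limit_trapezoid \<subseteq> {q. a \<bullet> q \<le> b}"
      unfolding limit_trapezoid_def
      by (rule hull_minimal) (use corners in \<open>auto intro: convex_halfspace_le\<close>)
    then have "interior limit_trapezoid \<subseteq> {q. a \<bullet> q < b}"
      using interior_mono interior_halfspace_le[OF a] by metis
    then show ?thesis using assms by blast
  qed
  have "(0, -1) \<bullet> p < 0" by (rule *) (auto simp: zero_prod_def)
  then show "plane_level p < 1" by (simp add: plane_level_def inner_prod_def)
  have "(0, 1) \<bullet> p < sqrt 3 / 2" by (rule *) (auto simp: zero_prod_def)
  then show "0 < plane_level p" by (simp add: plane_level_def inner_prod_def field_simps)
  have "(1, 1 / sqrt 3) \<bullet> p < 1" by (rule *) (auto simp: zero_prod_def)
  moreover have "(-1, 1 / sqrt 3) \<bullet> p < 1" by (rule *) (auto simp: zero_prod_def)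
  ultimately show "\<bar>fst p\<bar> < (1 + plane_level p) / 2"
    by (simp add: plane_level_def inner_prod_def abs_less_iff field_simps)
qed

lemma parabola_interior_level: "p \<in> parabola_interior \<longleftrightarrow> (fst p)\<^sup>2 < plane_level p"
proof -
  have "snd p < sqrt 3 / 2 * (1 - (fst p)\<^sup>2) \<longleftrightarrow> 2 * snd p / sqrt 3 < 1 - (fst p)\<^sup>2"
    by (simp add: pos_divide_less_eq) (simp add: field_simps)
  then show ?thesis by (auto simp: parabola_interior_def plane_level_def)
qed

lemma outside_closure_level: "p \<notin> closure parabola_interior \<longleftrightarrow> plane_level p < (fst p)\<^sup>2"
proof -
  have "snd p \<le> sqrt 3 / 2 * (1 - (fst p)\<^sup>2) \<longleftrightarrow> 2 * snd p / sqrt 3 \<le> 1 - (fst p)\<^sup>2"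
    by (simp add: pos_divide_le_eq) (simp add: field_simps)
  then show ?thesis by (auto simp: closure_parabola_interior plane_level_def)
qed

text \<open>Outside the parabola \<open>0 < plane_level p < (fst p)^2\<close>, so the abscissa never
  vanishes and has constant sign on a connected set. The components need not be identified
  further.\<close>

lemma component_in_frozen_zone:
  assumes C: "C \<in> components (interior limit_trapezoid - closure parabola_interior)"
  obtains s where "s = 1 \<or> s = -1" "C \<subseteq> frozen_zone s"
proof -
  have sub: "C \<subseteq> interior limit_trapezoid - closure parabola_interior" by (rule in_components_subset[OF C])
  have lev: "0 < plane_level p" "plane_level p < 1" "plane_level p < (fst p)\<^sup>2" if "p \<in> C" for p
    using sub that interior_limit_trapezoid[of p] outside_closure_level[of p] by auto
  have nz: "fst p \<noteq> 0" if "p \<in> C" for p using lev(1,3)[OF that] by auto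
  have conn: "connected (fst ` C)"
    by (rule connected_continuous_image[OF _ in_components_connected[OF C]]) (intro continuous_intros)
  have "(\<forall>p\<in>C. 0 < fst p) \<or> (\<forall>p\<in>C. fst p < 0)"
  proof (rule ccontr)
    assume "\<not> ?thesis"
    then obtain p q where pq: "p \<in> C" "fst p \<le> 0" "q \<in> C" "0 \<le> fst q" by (auto simp: not_less)
    then have "0 \<in> fst ` C" using connectedD_interval[OF conn, of "fst p" "fst q" 0] by auto
    then show False using nz by auto
  qed
  then show thesis
  proof
    assume "\<forall>p\<in>C. 0 < fst p"
    then have "C \<subseteq> frozen_zone 1" using lev by (auto simp: frozen_zone_def)
    then show thesis by (intro that[of 1]) auto
  next
    assume "\<forall>p\<in>C. fst p < 0"
    then have "C \<subseteq> frozen_zone (-1)" using lev by (auto simp: frozen_zone_def)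
    then show thesis by (intro that[of "-1"]) auto
  qed
qed

theorem corollary6p8:
  shows "\<exists>P I :: plane set.
    parabola P \<and> open I \<and> convex I \<and> frontier I = P \<and>
    (\<forall>C \<in> components (interior limit_trapezoid - closure I).
       \<exists>\<theta> \<in> edge_directions. \<forall>c r. r > 0 \<and> closure (ball c r) \<subseteq> C \<longrightarrow>
         converges_in_probability random_matching (\<lambda>n. proportion n \<theta> (ball c r)) 1) \<and>
    (\<forall>c r. r > 0 \<and> closure (ball c r) \<subseteq> interior limit_trapezoid \<inter> I \<longrightarrow>
       (\<forall>\<theta> \<in> edge_directions.
         \<not> converges_in_probability random_matching (\<lambda>n. proportion n \<theta> (ball c r)) 1))"
proof (rule exI[of _ limit_parabola], rule exI[of _ parabola_interior], intro conjI ballI allI impI)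
  show "parabola limit_parabola" by (rule parabola_limit_parabola)
  show "open parabola_interior" by (rule open_parabola_interior)
  show "convex parabola_interior" by (rule convex_parabola_interior)
  show "frontier parabola_interior = limit_parabola" by (rule frontier_parabola_interior)
next
  fix C assume C: "C \<in> components (interior limit_trapezoid - closure parabola_interior)"
  obtain s where s: "s = 1 \<or> s = -1" "C \<subseteq> frozen_zone s" by (rule component_in_frozen_zone[OF C])
  show "\<exists>\<theta>\<in>edge_directions. \<forall>c r. r > 0 \<and> closure (ball c r) \<subseteq> C \<longrightarrow>
         converges_in_probability random_matching (\<lambda>n. proportion n \<theta> (ball c r)) 1"
  proof (intro bexI[of _ "if s = 1 then left_direction else right_direction"] allI impI)
    show "(if s = 1 then left_direction else right_direction) \<in> edge_directions" by (simp add: edge_directions_eq)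
    fix c :: plane and r :: real assume cr: "r > 0 \<and> closure (ball c r) \<subseteq> C"
    then have r: "r > 0" and ball: "cball c r \<subseteq> C" by auto
    have "c \<in> C" using ball r by auto
    then have "c \<in> interior limit_trapezoid" using in_components_subset[OF C] by blast
    then show "converges_in_probability random_matching
        (\<lambda>n. proportion n (if s = 1 then left_direction else right_direction) (ball c r)) 1"
      using frozen_outside[OF subset_trans[OF ball s(2)] r s(1)] interior_limit_trapezoid(3) by blast
  qed
next
  fix c :: plane and r :: real and \<theta>
  assume cr: "r > 0 \<and> closure (ball c r) \<subseteq> interior limit_trapezoid \<inter> parabola_interior" and \<theta>: "\<theta> \<in> edge_directions"
  then have r: "r > 0" and "cball c r \<subseteq> interior limit_trapezoid \<inter> parabola_interior" by auto
  then have "c \<in> interior limit_trapezoid" "c \<in> parabola_interior" by auto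
  then show "\<not> converges_in_probability random_matching (\<lambda>n. proportion n \<theta> (ball c r)) 1"
    using liquid_inside[OF r \<theta>] interior_limit_trapezoid(2) parabola_interior_level by blast
qed

end
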